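(* Let $m,n$ be natural numbers with $m>n\ge 1$, and let $S_n\subset S_m$ be the symmetric groups of degrees $n$ and $m$. Then $\mathcal{K}(\widehat{S_m}\cup\widehat{S_n})$, equipped with the convolution $*$ defined in the context for the pair $(G,G_0)=(S_m,S_n)$, is a hypergroup.
   Context: $S_n$ is regarded as the subgroup of $S_m$ (permutations of $\{1,\dots,m\}$) fixing $n+1,\dots,m$. Let $G$ be a finite group and $G_0$ a subgroup. $\hat G$ is the set of equivalence classes of irreducible complex representations of $G$. For a finite-dimensional representation $\pi$ the normalized character is $ch(\pi)(g)=\frac{1}{\dim\pi}\mathrm{tr}(\pi(g))$. The set: $\mathcal{K}(\hat{G}\cup\widehat{G_0})=\{(ch(\pi),\circ),(ch(\tau),\bullet):\pi\in\hat G,\ \tau\in\widehat{G_0}\}$ (a disjoint union). If a finite-dimensional representation $\sigma$ of $G$ decomposes as $\sigma\cong\bigoplus_k m_k\sigma_k$ with distinct $\sigma_k\in\hat G$, then $ch(\sigma)=\sum_k\frac{m_k\dim\sigma_k}{\dim\sigma}ch(\sigma_k)$, and $(ch(\sigma),\circ)$ is understood as the probability measure giving mass $\frac{m_k\dim\sigma_k}{\dim\sigma}$ to $(ch(\sigma_k),\circ)$; similarly $(ch(\sigma),\bullet)$ for representations $\sigma$ of $G_0$. A point is identified with its Dirac measure. Convolution: for $\pi_i,\pi_j,\pi\in\hat G$ and $\tau_i,\tau_j,\tau\in\widehat{G_0}$, $(ch(\pi_i),\circ)*(ch(\pi_j),\circ)=(ch(\pi_i)ch(\pi_j),\circ)$;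 $(ch(\pi),\circ)*(ch(\tau),\bullet)=(ch(\mathrm{res}_{G_0}^G\pi)\,ch(\tau),\bullet)$; $(ch(\tau),\bullet)*(ch(\pi),\circ)=(ch(\tau)\,ch(\mathrm{res}_{G_0}^G\pi),\bullet)$; $(ch(\tau_i),\bullet)*(ch(\tau_j),\bullet)=(ch(\mathrm{ind}_{G_0}^G(\tau_i\otimes\tau_j)),\circ)$, extended bilinearly (products of characters are the normalized characters of tensor products). Hypergroup (finite case): a finite set $K$ with a convolution $*$ is a hypergroup if: for all $x,y\in K$, $\delta_x*\delta_y$ is a probability measure on $K$; the bilinear extension of $*$ to measures on $K$ is associative; there is a unit $e\in K$ with $\delta_e*\delta_x=\delta_x*\delta_e=\delta_x$ for all $x$; and there is an involution $x\mapsto x^-$ of $K$ (with $(x^-)^-=x$), extended to measures by push-forward, such that $\delta_{x^-}*\delta_{y^-}=(\delta_y*\delta_x)^-$ and $e\in\mathrm{supp}(\delta_x*\delta_y)$ if and only if $x=y^-$, for all $x,y\in K$. *)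

theory Defs
  imports
    "HOL-Algebra.Sym_Groups"
    "HOL-Algebra.Left_Coset"
    "Jordan_Normal_Form.VS_Connect"
begin

section \<open>Finite hypergroups\<close>

text \<open>A measure on a finite set \<open>K\<close> is given by its point masses, as a real function vanishing
  off \<open>K\<close>. A convolution is given by its values on pairs of points: \<open>conv x y\<close> is the
  convolution of the Dirac measures at \<open>x\<close> and \<open>y\<close>.\<close>

definition measures_on :: "'k set \<Rightarrow> ('k \<Rightarrow> real) set" where
  "measures_on K = {\<mu>. \<forall>x. x \<notin> K \<longrightarrow> \<mu> x = 0}"

definition prob_measures_on :: "'k set \<Rightarrow> ('k \<Rightarrow> real) set" where
  "prob_measures_on K = {\<mu> \<in> measures_on K. (\<forall>x\<in>K. 0 \<le> \<mu> x) \<and> (\<Sum>x\<in>K. \<mu> x) = 1}"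

definition dirac :: "'k \<Rightarrow> 'k \<Rightarrow> real" where
  "dirac x = (\<lambda>y. if y = x then 1 else 0)"

definition supp :: "('k \<Rightarrow> real) \<Rightarrow> 'k set" where
  "supp \<mu> = {x. \<mu> x \<noteq> 0}"

definition push_forward :: "'k set \<Rightarrow> ('k \<Rightarrow> 'k) \<Rightarrow> ('k \<Rightarrow> real) \<Rightarrow> 'k \<Rightarrow> real" where
  "push_forward K f \<mu> = (\<lambda>z. \<Sum>x \<in> {x \<in> K. f x = z}. \<mu> x)"

definition bilinear_ext ::
  "'k set \<Rightarrow> ('k \<Rightarrow> 'k \<Rightarrow> 'k \<Rightarrow> real) \<Rightarrow> ('k \<Rightarrow> real) \<Rightarrow> ('k \<Rightarrow> real) \<Rightarrow> 'k \<Rightarrow> real" where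
  "bilinear_ext K conv \<mu> \<nu> = (\<lambda>z. \<Sum>x\<in>K. \<Sum>y\<in>K. \<mu> x * \<nu> y * conv x y z)"

definition finite_hypergroup :: "'k set \<Rightarrow> ('k \<Rightarrow> 'k \<Rightarrow> 'k \<Rightarrow> real) \<Rightarrow> bool" where
  "finite_hypergroup K conv \<longleftrightarrow>
     finite K \<and>
     (\<forall>x\<in>K. \<forall>y\<in>K. conv x y \<in> prob_measures_on K) \<and>
     (\<forall>\<mu>\<in>measures_on K. \<forall>\<nu>\<in>measures_on K. \<forall>\<kappa>\<in>measures_on K.
        bilinear_ext K conv (bilinear_ext K conv \<mu> \<nu>) \<kappa> =
        bilinear_ext K conv \<mu> (bilinear_ext K conv \<nu> \<kappa>)) \<and>
     (\<exists>e\<in>K.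
        (\<forall>x\<in>K. conv e x = dirac x \<and> conv x e = dirac x) \<and>
        (\<exists>invol.
           (\<forall>x\<in>K. invol x \<in> K \<and> invol (invol x) = x) \<and>
           (\<forall>x\<in>K. \<forall>y\<in>K.
              conv (invol x) (invol y) = push_forward K invol (conv y x) \<and>
              (e \<in> supp (conv x y) \<longleftrightarrow> x = invol y))))"


section \<open>Finite-dimensional complex representations\<close>

text \<open>A pair \<open>(d, \<rho>)\<close> stands for a representation on the column vectors of length \<open>d\<close>. The values
  of \<open>\<rho>\<close> off the carrier of the group are irrelevant, so the same pair also denotes the
  restriction to a subgroup.\<close>

type_synonym 'g rep = "nat \<times> ('g \<Rightarrow> complex mat)"

abbreviation GL :: "nat \<Rightarrow> complex mat monoid" where
  "GL d \<equiv> units_of (ring_mat TYPE(complex) d ())"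

definition is_rep :: "('g, 'b) monoid_scheme \<Rightarrow> 'g rep \<Rightarrow> bool" where
  "is_rep G = (\<lambda>(d, \<rho>). \<rho> \<in> hom G (GL d))"

definition irreducible_rep :: "('g, 'b) monoid_scheme \<Rightarrow> 'g rep \<Rightarrow> bool" where
  "irreducible_rep G = (\<lambda>(d, \<rho>). is_rep G (d, \<rho>) \<and> d > 0 \<and>
     (\<forall>W. VectorSpace.subspace class_ring W (module_vec TYPE(complex) d) \<and>
          (\<forall>g\<in>carrier G. \<forall>w\<in>W. \<rho> g *\<^sub>v w \<in> W)
        \<longrightarrow> W = {0\<^sub>v d} \<or> W = carrier_vec d))"

definition equiv_rep :: "('g, 'b) monoid_scheme \<Rightarrow> 'g rep \<Rightarrow> 'g rep \<Rightarrow> bool" where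
  "equiv_rep G = (\<lambda>(d, \<rho>) (d', \<rho>'). d = d' \<and>
     (\<exists>P\<in>carrier (GL d). \<forall>g\<in>carrier G. P * \<rho> g = \<rho>' g * P))"

definition direct_sum_rep :: "'g rep list \<Rightarrow> 'g rep" where
  "direct_sum_rep \<rho>s =
     (sum_list (map fst \<rho>s), \<lambda>g. diag_block_mat (map (\<lambda>\<rho>. snd \<rho> g) \<rho>s))"

definition kronecker :: "complex mat \<Rightarrow> complex mat \<Rightarrow> complex mat" where
  "kronecker A B = mat (dim_row A * dim_row B) (dim_col A * dim_col B)
     (\<lambda>(i, j). A $$ (i div dim_row B, j div dim_col B) * B $$ (i mod dim_row B, j mod dim_col B))"

definition tensor_rep :: "'g rep \<Rightarrow> 'g rep \<Rightarrow> 'g rep" where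
  "tensor_rep = (\<lambda>(d, \<rho>) (d', \<rho>'). (d * d', \<lambda>g. kronecker (\<rho> g) (\<rho>' g)))"

text \<open>A left transversal of the subgroup \<open>H\<close>, chosen arbitrarily; different choices lead to
  equivalent induced representations.\<close>

definition left_transversal :: "('g, 'b) monoid_scheme \<Rightarrow> 'g set \<Rightarrow> 'g list" where
  "left_transversal G H = (SOME ts. set ts \<subseteq> carrier G \<and>
     bij_betw (\<lambda>i. (ts ! i) <#\<^bsub>G\<^esub> H) {..<length ts} (lcosets\<^bsub>G\<^esub> H))"

text \<open>The induced representation acts on the direct sum of the spaces \<open>t\<^sub>i \<otimes> V\<close>, where the \<open>t\<^sub>i\<close> form
  a left transversal, by \<open>g (t\<^sub>j \<otimes> v) = t\<^sub>i \<otimes> h v\<close> for \<open>g t\<^sub>j = t\<^sub>i h\<close> with \<open>h\<close> in \<open>H\<close>. Thus the block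
  of its matrix at \<open>(i, j)\<close> is the matrix of \<open>h\<close> if \<open>h = t\<^sub>i\<^sup>-\<^sup>1 g t\<^sub>j\<close> lies in \<open>H\<close>, and zero
  otherwise.\<close>

definition ind_rep :: "('g, 'b) monoid_scheme \<Rightarrow> 'g set \<Rightarrow> 'g rep \<Rightarrow> 'g rep" where
  "ind_rep G H = (\<lambda>(d, \<rho>). let ts = left_transversal G H; N = length ts * d in
     (N, \<lambda>g. mat N N (\<lambda>(a, b).
        let h = inv\<^bsub>G\<^esub> (ts ! (a div d)) \<otimes>\<^bsub>G\<^esub> g \<otimes>\<^bsub>G\<^esub> (ts ! (b div d))
        in if h \<in> H then \<rho> h $$ (a mod d, b mod d) else 0)))"


section \<open>Normalized characters and the convolution\<close>

definition trace_mat :: "complex mat \<Rightarrow> complex" where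
  "trace_mat A = (\<Sum>i<dim_row A. A $$ (i, i))"

text \<open>Restricting to the carrier makes equality of characters mean equality on the group.\<close>

definition ch :: "('g, 'b) monoid_scheme \<Rightarrow> 'g rep \<Rightarrow> 'g \<Rightarrow> complex" where
  "ch G = (\<lambda>(d, \<rho>). \<lambda>g\<in>carrier G. trace_mat (\<rho> g) / of_nat d)"

definition irr_chars :: "('g, 'b) monoid_scheme \<Rightarrow> ('g \<Rightarrow> complex) set" where
  "irr_chars G = {ch G \<pi> | \<pi>. irreducible_rep G \<pi>}"

text \<open>An irreducible representation is determined up to equivalence by its normalized character.\<close>

definition rep_of_char :: "('g, 'b) monoid_scheme \<Rightarrow> ('g \<Rightarrow> complex) \<Rightarrow> 'g rep" where
  "rep_of_char G x = (SOME \<pi>. irreducible_rep G \<pi> \<and> ch G \<pi> = x)"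

definition decomposition :: "('g, 'b) monoid_scheme \<Rightarrow> 'g rep \<Rightarrow> 'g rep list" where
  "decomposition G \<sigma> =
     (SOME \<sigma>s. (\<forall>\<rho>\<in>set \<sigma>s. irreducible_rep G \<rho>) \<and> equiv_rep G \<sigma> (direct_sum_rep \<sigma>s))"

text \<open>The probability measure denoted by the normalized character of \<open>\<sigma>\<close>. The summands with
  normalized character \<open>x\<close> are the copies of one irreducible constituent, so the total is its
  multiplicity times its dimension over the dimension of \<open>\<sigma>\<close>.\<close>

definition ch_measure :: "('g, 'b) monoid_scheme \<Rightarrow> 'g rep \<Rightarrow> ('g \<Rightarrow> complex) \<Rightarrow> real" where
  "ch_measure G \<sigma> x =
     (\<Sum>\<rho>\<leftarrow>decomposition G \<sigma>. if ch G \<rho> = x then real (fst \<rho>) / real (fst \<sigma>) else 0)"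

text \<open>The tags \<open>\<circ>\<close> and \<open>\<bullet>\<close> are rendered by the injections \<^const>\<open>Inl\<close> and \<^const>\<open>Inr\<close>. The subgroup
  is given by its underlying set \<open>H\<close>.\<close>

type_synonym 'g char_point = "('g \<Rightarrow> complex) + ('g \<Rightarrow> complex)"

definition char_set :: "('g, 'b) monoid_scheme \<Rightarrow> 'g set \<Rightarrow> 'g char_point set" where
  "char_set G H = irr_chars G <+> irr_chars (G\<lparr>carrier := H\<rparr>)"

definition circ_measure :: "('g, 'b) monoid_scheme \<Rightarrow> 'g rep \<Rightarrow> 'g char_point \<Rightarrow> real" where
  "circ_measure G \<sigma> = case_sum (ch_measure G \<sigma>) (\<lambda>_. 0)"

definition bullet_measure ::
  "('g, 'b) monoid_scheme \<Rightarrow> 'g set \<Rightarrow> 'g rep \<Rightarrow> 'g char_point \<Rightarrow> real" where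
  "bullet_measure G H \<sigma> = case_sum (\<lambda>_. 0) (ch_measure (G\<lparr>carrier := H\<rparr>) \<sigma>)"

fun char_conv ::
  "('g, 'b) monoid_scheme \<Rightarrow> 'g set \<Rightarrow> 'g char_point \<Rightarrow> 'g char_point \<Rightarrow> 'g char_point \<Rightarrow> real" where
  "char_conv G H (Inl x) (Inl y) =
     circ_measure G (tensor_rep (rep_of_char G x) (rep_of_char G y))"
| "char_conv G H (Inl x) (Inr t) =
     bullet_measure G H (tensor_rep (rep_of_char G x) (rep_of_char (G\<lparr>carrier := H\<rparr>) t))"
| "char_conv G H (Inr t) (Inl x) =
     bullet_measure G H (tensor_rep (rep_of_char (G\<lparr>carrier := H\<rparr>) t) (rep_of_char G x))"
| "char_conv G H (Inr s) (Inr t) =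
     circ_measure G (ind_rep G H
       (tensor_rep (rep_of_char (G\<lparr>carrier := H\<rparr>) s) (rep_of_char (G\<lparr>carrier := H\<rparr>) t)))"


section \<open>Symmetric groups\<close>

text \<open>Permutations of \<open>{1..n}\<close> are functions on all natural numbers that are the identity off
  \<open>{1..n}\<close>, so the smaller symmetric group is literally a subgroup of the larger one.\<close>

lemma subgroup_sym_group:
  assumes "n \<le> m"
  shows "subgroup (carrier (sym_group n)) (sym_group m)"
    and "(sym_group m)\<lparr>carrier := carrier (sym_group n)\<rparr> = sym_group n"
proof -
  have sub: "carrier (sym_group n) \<subseteq> carrier (sym_group m)"
  proof
    fix p assume "p \<in> carrier (sym_group n)"
    then have "p permutes {1..n}" by (simp only: sym_group_carrier)
    then have "p permutes {1..m}" by (rule permutes_subset) (use assms in auto)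
    then show "p \<in> carrier (sym_group m)" by (simp only: sym_group_carrier)
  qed
  show eq: "(sym_group m)\<lparr>carrier := carrier (sym_group n)\<rparr> = sym_group n"
    by (simp add: sym_group_def)
  show "subgroup (carrier (sym_group n)) (sym_group m)"
    by (rule group.group_incl_imp_subgroup) (use sub eq sym_group_is_group in auto)
qed

end

theory Submission
  imports Defs "Jordan_Normal_Form.DL_Rank" "Jordan_Normal_Form.Spectral_Radius"
begin

text \<open>
  Why the theorem holds. Let \<open>H\<close> be a subgroup of a finite group \<open>G\<close>. A measure on the disjoint
  union of the two sets of irreducible normalized characters defines two functions: on \<open>G\<close> the
  linear combination \<open>f\<close> of its circle points, and on \<open>H\<close> the linear combination \<open>\<phi>\<close> of its bullet
  points. Irreducible characters are linearly independent, so the measure can be recovered from the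
  pair \<open>(f, \<phi>)\<close> (\<open>measure_eqI\<close>). In terms of such pairs the convolution becomes
  \<open>(f, \<phi>) * (f', \<phi>') = (f f' + Ind (\<phi> \<phi>'), f \<phi>' + \<phi> f')\<close>,
  where \<open>Ind\<close> is normalized induction of class functions (\<open>circ_fun_star\<close>, \<open>bullet_fun_star\<close>).

  Multiplying out, associativity follows from two identities: the projection formula
  \<open>Ind (f \<phi>) = f Ind \<phi>\<close> for class functions \<open>f\<close> on \<open>G\<close> (\<open>projection_formula\<close>), and the identity
  \<open>Ind (\<phi> \<psi>) \<chi> = \<phi> Ind (\<psi> \<chi>)\<close> on \<open>H\<close>. The second one is a genuine restriction on the pair. It holds
  if \<open>H\<close> controls fusion, that is, if elements of \<open>H\<close> that are conjugate in \<open>G\<close> are already conjugate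
  in \<open>H\<close>: then \<open>Ind \<phi>\<close> agrees on \<open>H\<close> with \<open>\<phi> Ind 1\<close> (\<open>induced_function_restrict\<close>). Symmetric groups
  satisfy this condition, because a permutation that conjugates one permutation of \<open>{1..n}\<close> to another
  matters only on the points that are moved, and can be replaced by a permutation of \<open>{1..n}\<close>
  (\<open>conjugate_within_subset\<close>).

  The unit is the trivial character of \<open>G\<close>, and the involution sends a character \<open>x\<close> to the dual
  character \<open>g \<mapsto> x (g\<^sup>-\<^sup>1)\<close>. The mass of a convolution at the unit is, up to a positive factor,
  a multiplicity of the trivial representation; for two bullet points it is moved from \<open>G\<close> to \<open>H\<close> by Frobenius reciprocity
  (\<open>sum_induced_function\<close>). By the orthogonality relations it is nonzero exactly for a character and
  its dual (\<open>unit_in_supp_iff\<close>).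

  These arguments rest on the classical theory of complex representations: complete reducibility
  (\<open>decomposition_exists\<close>), Schur's lemma (\<open>schur\<close>, \<open>schur_scalar\<close>), the orthogonality relations
  (\<open>irr_chars_orthogonal\<close>), and the finiteness of the set of irreducible characters
  (\<open>finite_irr_chars\<close>). They make the measure of a representation depend on its character only,
  whatever transversals, representatives and decompositions were chosen in its construction.
\<close>

section \<open>Matrix representations and their equivalence\<close>

text \<open>The general carrier rules for products contain the inner dimension as a variable that rewriting
  cannot determine. With a single dimension left to instantiate they can be used by the simplifier.\<close>

lemmas square_mat_mult = assoc_mult_mat[of _ d d _ d _ d for d] mult_carrier_mat[of _ d d _ d for d]

lemma carrier_GL:
  "A \<in> carrier (GL d) \<longleftrightarrow>
     A \<in> carrier_mat d d \<and> (\<exists>B\<in>carrier_mat d d. A * B = 1\<^sub>m d \<and> B * A = 1\<^sub>m d)"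
  by (auto simp: units_of_def Units_def ring_mat_def)

text \<open>For a multiplicative map, values in the invertible matrices amount to the unit acting as the
  identity: an invertible idempotent is the identity, and conversely \<open>\<rho> (inv g)\<close> inverts \<open>\<rho> g\<close>.\<close>

lemma (in group) is_rep_iff:
  "is_rep G (d, \<rho>) \<longleftrightarrow>
     (\<forall>g\<in>carrier G. \<rho> g \<in> carrier_mat d d) \<and> \<rho> \<one> = 1\<^sub>m d \<and>
     (\<forall>g\<in>carrier G. \<forall>h\<in>carrier G. \<rho> (g \<otimes> h) = \<rho> g * \<rho> h)"
  (is "?L \<longleftrightarrow> ?R")
proof
  assume L: ?L
  then have GL: "\<rho> g \<in> carrier (GL d)" if "g \<in> carrier G" for g
    using that unfolding is_rep_def hom_def by auto
  then have c: "\<rho> g \<in> carrier_mat d d" if "g \<in> carrier G" for g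
    using that by (simp add: carrier_GL)
  have m: "\<rho> (g \<otimes> h) = \<rho> g * \<rho> h" if "g \<in> carrier G" "h \<in> carrier G" for g h
    using L that unfolding is_rep_def hom_def by (simp add: units_of_def ring_mat_def)
  obtain B where B: "B \<in> carrier_mat d d" "B * \<rho> \<one> = 1\<^sub>m d"
    using GL[OF one_closed] by (auto simp: carrier_GL)
  have "\<rho> \<one> = (B * \<rho> \<one>) * \<rho> \<one>"
    using c[OF one_closed] B by simp
  also have "\<dots> = B * (\<rho> \<one> * \<rho> \<one>)"
    by (rule assoc_mult_mat) (use c[OF one_closed] B in auto)
  also have "\<dots> = 1\<^sub>m d"
    using m[OF one_closed one_closed] B by simp
  finally show ?R using c m by blast
next
  assume R: ?R
  have "\<rho> g \<in> carrier (GL d)" if "g \<in> carrier G" for g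
    unfolding carrier_GL
    using R that by (metis inv_closed l_inv r_inv)
  then show ?L
    using R unfolding is_rep_def hom_def by (auto simp: units_of_def ring_mat_def)
qed

lemma equiv_repE:
  assumes "equiv_rep G (d, \<rho>) (d', \<rho>')"
  obtains P Q where "d' = d" "P \<in> carrier_mat d d" "Q \<in> carrier_mat d d"
    "P * Q = 1\<^sub>m d" "Q * P = 1\<^sub>m d" "\<And>g. g \<in> carrier G \<Longrightarrow> P * \<rho> g = \<rho>' g * P"
  using assms unfolding equiv_rep_def by (auto simp: carrier_GL)

lemma equiv_repI:
  assumes "P \<in> carrier_mat d d" "Q \<in> carrier_mat d d"
    "P * Q = 1\<^sub>m d" "Q * P = 1\<^sub>m d" "\<And>g. g \<in> carrier G \<Longrightarrow> P * \<rho> g = \<rho>' g * P"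
  shows "equiv_rep G (d, \<rho>) (d, \<rho>')"
proof -
  have "P \<in> carrier (GL d)" using assms(1-4) carrier_GL by blast
  then show ?thesis using assms(5) unfolding equiv_rep_def by auto
qed

lemma equiv_rep_refl:
  assumes "\<And>g. g \<in> carrier G \<Longrightarrow> \<rho> g \<in> carrier_mat d d"
  shows "equiv_rep G (d, \<rho>) (d, \<rho>)"
  by (rule equiv_repI[of "1\<^sub>m d" _ "1\<^sub>m d"]) (use assms in \<open>auto simp: left_mult_one_mat[of _ d d] right_mult_one_mat[of _ d d]\<close>)

lemma equiv_rep_trans:
  assumes "equiv_rep G (d1, \<rho>1) (d2, \<rho>2)" "equiv_rep G (d2, \<rho>2) (d3, \<rho>3)"
    and c: "\<And>g. g \<in> carrier G \<Longrightarrow> \<rho>1 g \<in> carrier_mat d1 d1"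
      "\<And>g. g \<in> carrier G \<Longrightarrow> \<rho>2 g \<in> carrier_mat d2 d2"
      "\<And>g. g \<in> carrier G \<Longrightarrow> \<rho>3 g \<in> carrier_mat d3 d3"
  shows "equiv_rep G (d1, \<rho>1) (d3, \<rho>3)"
proof -
  obtain P Q where PQ: "d2 = d1" "P \<in> carrier_mat d1 d1" "Q \<in> carrier_mat d1 d1"
    "P * Q = 1\<^sub>m d1" "Q * P = 1\<^sub>m d1" "\<And>g. g \<in> carrier G \<Longrightarrow> P * \<rho>1 g = \<rho>2 g * P"
    using equiv_repE[OF assms(1)] by metis
  obtain R S where RS: "d3 = d1" "R \<in> carrier_mat d1 d1" "S \<in> carrier_mat d1 d1"
    "R * S = 1\<^sub>m d1" "S * R = 1\<^sub>m d1" "\<And>g. g \<in> carrier G \<Longrightarrow> R * \<rho>2 g = \<rho>3 g * R"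
    using equiv_repE[OF assms(2)] PQ(1) by metis
  note [simp] = PQ(2,3) RS(2,3)
  have 1: "R * P * (Q * S) = 1\<^sub>m d1"
  proof -
    have "R * P * (Q * S) = R * (P * Q) * S"
      by (simp add: square_mat_mult[where d = d1])
    then show ?thesis using PQ RS by (simp add: right_mult_one_mat[of _ d1 d1])
  qed
  have 2: "Q * S * (R * P) = 1\<^sub>m d1"
  proof -
    have "Q * S * (R * P) = Q * (S * R) * P"
      by (simp add: square_mat_mult[where d = d1])
    then show ?thesis using PQ RS by (simp add: right_mult_one_mat[of _ d1 d1])
  qed
  have 3: "R * P * \<rho>1 g = \<rho>3 g * (R * P)" if g: "g \<in> carrier G" for g
  proof -
    have [simp]: "\<rho>1 g \<in> carrier_mat d1 d1" "\<rho>2 g \<in> carrier_mat d1 d1" "\<rho>3 g \<in> carrier_mat d1 d1"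
      using c[OF g] PQ RS by auto
    have "R * P * \<rho>1 g = R * (P * \<rho>1 g)"
      by (simp add: square_mat_mult[where d = d1])
    also have "\<dots> = R * \<rho>2 g * P"
      using PQ(6)[OF g] by (simp add: square_mat_mult[where d = d1])
    also have "\<dots> = \<rho>3 g * (R * P)"
      using RS(6)[OF g] by (simp add: square_mat_mult[where d = d1])
    finally show ?thesis .
  qed
  have "equiv_rep G (d1, \<rho>1) (d1, \<rho>3)"
    by (rule equiv_repI[OF _ _ 1 2 3]) (simp_all add: square_mat_mult[where d = d1])
  then show ?thesis using RS(1) by simp
qed

section \<open>Complete reducibility\<close>

lemma subspace_vec_iff:
  fixes W :: "complex vec set"
  shows "VectorSpace.subspace class_ring W (module_vec TYPE(complex) d) \<longleftrightarrow>
     W \<subseteq> carrier_vec d \<and> 0\<^sub>v d \<in> W \<and> (\<forall>v\<in>W. \<forall>w\<in>W. v + w \<in> W) \<and> (\<forall>c. \<forall>v\<in>W. c \<cdot>\<^sub>v v \<in> W)"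
proof -
  interpret vec_space "TYPE(complex)" d .
  show ?thesis
    unfolding VectorSpace.subspace_def
    using vectorspace_axioms module_axioms
    by (simp add: LinearCombinations.submodule_def class_ring_simps Ball_def) blast
qed

text \<open>Extend a basis of \<open>W\<close> to a basis of the whole space and take these vectors as the columns of \<open>P\<close>.
  In the new coordinates \<open>W\<close> is cut out by the vanishing of the coordinates from \<open>k\<close> on.\<close>

lemma adapted_basis:
  fixes W :: "complex vec set"
  assumes W: "VectorSpace.subspace class_ring W (module_vec TYPE(complex) d)"
    and "W \<noteq> {0\<^sub>v d}" "W \<noteq> carrier_vec d"
  obtains k P Q where "0 < k" "k < d" "P \<in> carrier_mat d d" "Q \<in> carrier_mat d d"
    "P * Q = 1\<^sub>m d" "Q * P = 1\<^sub>m d"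
    "\<And>v. v \<in> carrier_vec d \<Longrightarrow> P *\<^sub>v v \<in> W \<longleftrightarrow> (\<forall>i. k \<le> i \<longrightarrow> i < d \<longrightarrow> v $ i = 0)"
proof -
  interpret vec_space "TYPE(complex)" d .
  have Wc: "W \<subseteq> carrier_vec d" using W[unfolded subspace_vec_iff] by blast
  have sub: "submodule class_ring W V" using W by (simp add: VectorSpace.subspace_def)
  have bound: "finite A \<and> card A \<le> d" if "A \<subseteq> carrier_vec d" "lin_indpt A" for A
    using li_le_dim[OF fin_dim that] by (simp only: dim_is_n)
  \<comment> \<open>a maximal independent subset of \<open>W\<close>, hence a basis of it\<close>
  obtain A where A: "finite A" "maximal A (\<lambda>S. S \<subseteq> W \<and> lin_indpt S)"
  proof -
    have "lin_indpt {}" by (simp add: lin_dep_def)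
    then show ?thesis
      using maximal_exists[of "\<lambda>S. S \<subseteq> W \<and> lin_indpt S" d "{}"] bound[OF subset_trans[OF _ Wc]] that by auto
  qed
  have AW: "A \<subseteq> W" "lin_indpt A" and Amax: "\<And>B. A \<subseteq> B \<Longrightarrow> B \<subseteq> W \<Longrightarrow> lin_indpt B \<Longrightarrow> B = A"
    using A(2) unfolding maximal_def by auto
  have Ac: "A \<subseteq> carrier_vec d" using AW Wc by auto
  have spanA: "span A = W"
  proof
    show "span A \<subseteq> W" by (rule span_is_subset[OF AW(1) sub])
    show "W \<subseteq> span A"
    proof
      fix w assume w: "w \<in> W"
      show "w \<in> span A"
      proof (rule ccontr)
        assume n: "w \<notin> span A"
        have wA: "w \<notin> A" using n in_own_span[of A] Ac by auto
        have "lin_indpt (A \<union> {w})"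
          using lin_dep_iff_in_span[of A w] Ac AW w Wc n wA by auto
        then show False using Amax[of "A \<union> {w}"] w AW wA by auto
      qed
    qed
  qed
  \<comment> \<open>its extension to a basis of the whole space\<close>
  obtain B where B: "maximal B (\<lambda>S. A \<subseteq> S \<and> S \<subseteq> carrier_vec d \<and> lin_indpt S)"
    using maximal_exists[of "\<lambda>S. A \<subseteq> S \<and> S \<subseteq> carrier_vec d \<and> lin_indpt S" d A] bound Ac AW by auto
  have AB: "A \<subseteq> B" and Bc: "B \<subseteq> carrier_vec d" and Bli: "lin_indpt B"
    and Bmax: "\<And>C. A \<subseteq> C \<Longrightarrow> C \<subseteq> carrier_vec d \<Longrightarrow> lin_indpt C \<Longrightarrow> B \<subseteq> C \<Longrightarrow> C = B"
    using B unfolding maximal_def by (blast, blast, blast, blast)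
  have "C = B" if "B \<subseteq> C" "C \<subseteq> carrier_vec d" "lin_indpt C" for C
    by (rule Bmax[OF _ that(2,3,1)]) (use AB that(1) in blast)
  then have "maximal B (\<lambda>S. S \<subseteq> carrier_vec d \<and> lin_indpt S)"
    using Bc Bli unfolding maximal_def by blast
  then have Bbasis: "basis B" by (rule max_li_is_basis)
  have "finite B" using bound[OF Bc Bli] by blast
  then have cardB: "card B = d" using dim_basis[OF \<open>finite B\<close> Bbasis] dim_is_n by simp
  obtain us where us: "set us = A" "distinct us" using finite_distinct_list[OF A(1)] by auto
  obtain ws where ws: "set ws = B - A" "distinct ws"
    using finite_distinct_list[of "B - A"] \<open>finite B\<close> by auto
  define k where "k = length us"
  define P where "P = mat_of_cols d (us @ ws)"
  have dist: "distinct (us @ ws)" and setB: "set (us @ ws) = B"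
    using us ws AB by auto
  have len: "length (us @ ws) = d"
    using distinct_card[OF dist] setB cardB by simp
  have P: "P \<in> carrier_mat d d" unfolding P_def using len by (metis mat_of_cols_carrier(1))
  have "cols P = us @ ws" unfolding P_def by (rule cols_mat_of_cols) (use setB Bc in auto)
  then have "rank P = d" using lin_indpt_full_rank[OF P] dist setB Bli by auto
  then have "det P \<noteq> 0" using det_rank_iff[OF P] by simp
  then have "P \<in> Units (ring_mat TYPE(complex) d ())" by (rule det_non_zero_imp_unit[OF P])
  then obtain Q where Q: "Q \<in> carrier_mat d d" "P * Q = 1\<^sub>m d" "Q * P = 1\<^sub>m d"
    by (auto simp: Units_def ring_mat_def)
  have kd: "k \<le> d" using len k_def by simp
  have lc: "P *\<^sub>v v = lincomb_list (\<lambda>i. v $ i) us"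
    if v: "v \<in> carrier_vec d" and z: "\<forall>i. k \<le> i \<longrightarrow> i < d \<longrightarrow> v $ i = 0" for v
  proof (rule eq_vecI)
    have usd: "\<forall>w\<in>set us. dim_vec w = d" using us Ac by auto
    have L: "lincomb_list (\<lambda>i. v $ i) us = mat_of_cols d us *\<^sub>v vec k (\<lambda>i. v $ i)"
      unfolding k_def by (rule lincomb_list_as_mat_mult[OF usd])
    show "dim_vec (P *\<^sub>v v) = dim_vec (lincomb_list (\<lambda>i. v $ i) us)"
      using P by (simp add: L)
    fix i assume "i < dim_vec (lincomb_list (\<lambda>i. v $ i) us)"
    then have i: "i < d" by (simp add: L)
    have "(P *\<^sub>v v) $ i = (\<Sum>j<d. (us @ ws) ! j $ i * v $ j)"
      using i P v len by (simp add: scalar_prod_def P_def mat_of_cols_index lessThan_atLeast0 flip: length_append)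
    also have "\<dots> = (\<Sum>j<k. (us @ ws) ! j $ i * v $ j)"
      by (rule sum.mono_neutral_right) (use kd z in auto)
    also have "\<dots> = (\<Sum>j<k. us ! j $ i * v $ j)"
      by (rule sum.cong) (auto simp: k_def nth_append)
    also have "\<dots> = lincomb_list (\<lambda>i. v $ i) us $ i"
      unfolding L using i by (simp add: scalar_prod_def mat_of_cols_index lessThan_atLeast0 k_def)
    finally show "(P *\<^sub>v v) $ i = lincomb_list (\<lambda>i. v $ i) us $ i" .
  qed
  have spanl: "span_list us = W" using span_list_as_span[of us] us Ac spanA by auto
  have PW: "P *\<^sub>v v \<in> W \<longleftrightarrow> (\<forall>i. k \<le> i \<longrightarrow> i < d \<longrightarrow> v $ i = 0)" if v: "v \<in> carrier_vec d" for v
  proof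
    assume "\<forall>i. k \<le> i \<longrightarrow> i < d \<longrightarrow> v $ i = 0"
    from lc[OF v this] show "P *\<^sub>v v \<in> W" using spanl by (auto simp: span_list_def)
  next
    assume "P *\<^sub>v v \<in> W"
    then obtain c where c: "P *\<^sub>v v = lincomb_list c us" using spanl by (auto simp: span_list_def)
    define u where "u = vec d (\<lambda>i. if i < k then c i else 0)"
    have u: "u \<in> carrier_vec d" by (simp add: u_def)
    have "P *\<^sub>v u = lincomb_list (\<lambda>i. u $ i) us" by (rule lc[OF u]) (simp add: u_def)
    also have "\<dots> = lincomb_list c us"
      unfolding lincomb_list_def using kd by (auto intro!: arg_cong[of _ _ sumlist] simp: u_def k_def)
    finally have "P *\<^sub>v u = P *\<^sub>v v" using c by simp
    then have "Q *\<^sub>v (P *\<^sub>v u) = Q *\<^sub>v (P *\<^sub>v v)" by simp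
    then have "u = v" using Q P u v
      by (simp add: assoc_mult_mat_vec[symmetric, of _ d d _ d] one_mult_mat_vec[of _ d])
    then show "\<forall>i. k \<le> i \<longrightarrow> i < d \<longrightarrow> v $ i = 0" by (auto simp: u_def)
  qed
  have "k \<noteq> 0"
  proof
    assume "k = 0"
    then have "A = {}" using us k_def by auto
    then show False using spanA span_empty assms(2) by auto
  qed
  moreover have "k \<noteq> d"
  proof
    assume "k = d"
    then have "P *\<^sub>v v \<in> W" if "v \<in> carrier_vec d" for v using PW[OF that] by auto
    moreover have "w = P *\<^sub>v (Q *\<^sub>v w)" if "w \<in> carrier_vec d" for w
      using that P Q by (simp add: assoc_mult_mat_vec[symmetric, of _ d d _ d] one_mult_mat_vec[of _ d])
    ultimately have "w \<in> W" if "w \<in> carrier_vec d" for w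
      using that Q(1) by (metis mult_mat_vec_carrier)
    then show False using Wc assms(3) by auto
  qed
  ultimately show ?thesis using that[of k P Q] kd P Q PW by auto
qed

text \<open>Matrices of all dimensions share one type, which has no common zero matrix. A sum of matrices
  therefore carries its dimensions explicitly.\<close>

definition sum_mat :: "nat \<Rightarrow> nat \<Rightarrow> ('a \<Rightarrow> complex mat) \<Rightarrow> 'a set \<Rightarrow> complex mat" where
  "sum_mat nr nc f S = mat nr nc (\<lambda>ij. \<Sum>h\<in>S. f h $$ ij)"

lemma sum_mat_carrier [simp]: "sum_mat nr nc f S \<in> carrier_mat nr nc"
  by (simp add: sum_mat_def)

lemma mult_sum_mat:
  assumes "A \<in> carrier_mat n nr" "\<And>h. h \<in> S \<Longrightarrow> f h \<in> carrier_mat nr nc"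
  shows "A * sum_mat nr nc f S = sum_mat n nc (\<lambda>h. A * f h) S"
proof (rule eq_matI)
  fix i j assume "i < dim_row (sum_mat n nc (\<lambda>h. A * f h) S)" "j < dim_col (sum_mat n nc (\<lambda>h. A * f h) S)"
  then have ij: "i < n" "j < nc" by (simp_all add: sum_mat_def)
  have "(A * sum_mat nr nc f S) $$ (i, j) = (\<Sum>k<nr. \<Sum>h\<in>S. A $$ (i, k) * f h $$ (k, j))"
    using assms(1) ij by (simp add: scalar_prod_def sum_mat_def sum_distrib_left lessThan_atLeast0)
  also have "\<dots> = (\<Sum>h\<in>S. \<Sum>k<nr. A $$ (i, k) * f h $$ (k, j))" by (rule sum.swap)
  also have "\<dots> = (\<Sum>h\<in>S. (A * f h) $$ (i, j))"
  proof (rule sum.cong[OF refl])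
    fix h assume "h \<in> S"
    then have "f h \<in> carrier_mat nr nc" by (rule assms)
    then show "(\<Sum>k<nr. A $$ (i, k) * f h $$ (k, j)) = (A * f h) $$ (i, j)"
      using assms(1) ij by (simp add: scalar_prod_def lessThan_atLeast0)
  qed
  finally show "(A * sum_mat nr nc f S) $$ (i, j) = sum_mat n nc (\<lambda>h. A * f h) S $$ (i, j)"
    using ij by (simp add: sum_mat_def)
qed (use assms in \<open>auto simp: sum_mat_def\<close>)

lemma sum_mat_mult:
  assumes "A \<in> carrier_mat nc n" "\<And>h. h \<in> S \<Longrightarrow> f h \<in> carrier_mat nr nc"
  shows "sum_mat nr nc f S * A = sum_mat nr n (\<lambda>h. f h * A) S"
proof (rule eq_matI)
  fix i j assume "i < dim_row (sum_mat nr n (\<lambda>h. f h * A) S)" "j < dim_col (sum_mat nr n (\<lambda>h. f h * A) S)"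
  then have ij: "i < nr" "j < n" by (simp_all add: sum_mat_def)
  have "(sum_mat nr nc f S * A) $$ (i, j) = (\<Sum>k<nc. \<Sum>h\<in>S. f h $$ (i, k) * A $$ (k, j))"
    using assms(1) ij by (simp add: scalar_prod_def sum_mat_def sum_distrib_right lessThan_atLeast0)
  also have "\<dots> = (\<Sum>h\<in>S. \<Sum>k<nc. f h $$ (i, k) * A $$ (k, j))" by (rule sum.swap)
  also have "\<dots> = (\<Sum>h\<in>S. (f h * A) $$ (i, j))"
  proof (rule sum.cong[OF refl])
    fix h assume "h \<in> S"
    then have "f h \<in> carrier_mat nr nc" by (rule assms)
    then show "(\<Sum>k<nc. f h $$ (i, k) * A $$ (k, j)) = (f h * A) $$ (i, j)"
      using assms(1) ij by (simp add: scalar_prod_def lessThan_atLeast0)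
  qed
  finally show "(sum_mat nr nc f S * A) $$ (i, j) = sum_mat nr n (\<lambda>h. f h * A) S $$ (i, j)"
    using ij by (simp add: sum_mat_def)
qed (use assms in \<open>auto simp: sum_mat_def\<close>)

lemma sum_mat_cong:
  "(\<And>h. h \<in> S \<Longrightarrow> f h = g h) \<Longrightarrow> sum_mat nr nc f S = sum_mat nr nc g S"
  by (simp add: sum_mat_def)

text \<open>The translation invariance on which the averaging arguments for Maschke's theorem and for the
  orthogonality relations rest.\<close>

lemma (in group) sum_mat_translate:
  assumes "g \<in> carrier G"
  shows "sum_mat nr nc (\<lambda>h. f (g \<otimes> h)) (carrier G) = sum_mat nr nc f (carrier G)"
proof -
  have "bij_betw (\<lambda>h. g \<otimes> h) (carrier G) (carrier G)"
    using assms by (intro bij_betwI[where g = "\<lambda>h. inv g \<otimes> h"]) (auto simp flip: m_assoc)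
  then show ?thesis
    unfolding sum_mat_def by (simp add: sum.reindex_bij_betw[where g = "\<lambda>h. f h $$ ij" for ij])
qed

lemma equiv_repI_right:
  assumes PQ: "P \<in> carrier_mat d d" "Q \<in> carrier_mat d d" "P * Q = 1\<^sub>m d" "Q * P = 1\<^sub>m d"
    and c: "\<And>g. g \<in> carrier G \<Longrightarrow> \<rho> g \<in> carrier_mat d d"
      "\<And>g. g \<in> carrier G \<Longrightarrow> \<rho>' g \<in> carrier_mat d d"
    and i: "\<And>g. g \<in> carrier G \<Longrightarrow> \<rho> g * P = P * \<rho>' g"
  shows "equiv_rep G (d, \<rho>) (d, \<rho>')"
proof (rule equiv_repI[OF PQ(2,1,4,3)])
  fix g assume g: "g \<in> carrier G"
  note [simp] = PQ c[OF g]
  have "Q * \<rho> g = Q * (\<rho> g * P) * Q"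
    by (simp add: square_mat_mult[where d = d] right_mult_one_mat[of _ d d])
  also have "\<dots> = (Q * P) * \<rho>' g * Q"
    unfolding i[OF g] using assoc_mult_mat[OF PQ(2,1) c(2)[OF g]] by simp
  also have "\<dots> = \<rho>' g * Q" by (simp add: left_mult_one_mat[of _ d d])
  finally show "Q * \<rho> g = \<rho>' g * Q" .
qed

lemma four_block_mat_inj:
  assumes e: "four_block_mat A B C D = four_block_mat A' B' C' D'"
    and c: "A \<in> carrier_mat k k'" "B \<in> carrier_mat k l'" "C \<in> carrier_mat l k'" "D \<in> carrier_mat l l'"
      "A' \<in> carrier_mat k k'" "B' \<in> carrier_mat k l'" "C' \<in> carrier_mat l k'" "D' \<in> carrier_mat l l'"
  shows "A = A'" "B = B'" "D = D'"
proof -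
  have E: "four_block_mat A B C D $$ (i, j) = four_block_mat A' B' C' D' $$ (i, j)" for i j
    using e by simp
  show "A = A'"
  proof (rule eq_matI)
    fix i j assume "i < dim_row A'" "j < dim_col A'"
    then show "A $$ (i, j) = A' $$ (i, j)" using E[of i j] c by simp
  qed (use c in auto)
  show "B = B'"
  proof (rule eq_matI)
    fix i j assume "i < dim_row B'" "j < dim_col B'"
    then show "B $$ (i, j) = B' $$ (i, j)" using E[of i "j + k'"] c by simp
  qed (use c in auto)
  show "D = D'"
  proof (rule eq_matI)
    fix i j assume "i < dim_row D'" "j < dim_col D'"
    then show "D $$ (i, j) = D' $$ (i, j)" using E[of "i + k" "j + k'"] c by simp
  qed (use c in auto)
qed

text \<open>A representation that is not irreducible has a proper nonzero invariant subspace. In coordinates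
  adapted to it, invariance says that the lower left block vanishes.\<close>

lemma (in group) block_triangular_form:
  assumes rep: "is_rep G (d, \<rho>)" and "d > 0" and red: "\<not> irreducible_rep G (d, \<rho>)"
  obtains k l A B D P Q where "0 < k" "0 < l" "d = k + l"
    "P \<in> carrier_mat d d" "Q \<in> carrier_mat d d" "P * Q = 1\<^sub>m d" "Q * P = 1\<^sub>m d"
    "\<And>g. g \<in> carrier G \<Longrightarrow> A g \<in> carrier_mat k k"
    "\<And>g. g \<in> carrier G \<Longrightarrow> B g \<in> carrier_mat k l"
    "\<And>g. g \<in> carrier G \<Longrightarrow> D g \<in> carrier_mat l l"
    "\<And>g. g \<in> carrier G \<Longrightarrow> \<rho> g * P = P * four_block_mat (A g) (B g) (0\<^sub>m l k) (D g)"
proof -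
  obtain W where W: "VectorSpace.subspace class_ring W (module_vec TYPE(complex) d)"
    and inv: "\<And>g w. g \<in> carrier G \<Longrightarrow> w \<in> W \<Longrightarrow> \<rho> g *\<^sub>v w \<in> W"
    and ne: "W \<noteq> {0\<^sub>v d}" "W \<noteq> carrier_vec d"
    using rep red \<open>d > 0\<close> unfolding irreducible_rep_def by auto
  obtain k P Q where k: "0 < k" "k < d" and PQ: "P \<in> carrier_mat d d" "Q \<in> carrier_mat d d"
    "P * Q = 1\<^sub>m d" "Q * P = 1\<^sub>m d"
    and PW: "\<And>v. v \<in> carrier_vec d \<Longrightarrow> P *\<^sub>v v \<in> W \<longleftrightarrow> (\<forall>i. k \<le> i \<longrightarrow> i < d \<longrightarrow> v $ i = 0)"
    proof (rule adapted_basis[OF W ne], goal_cases)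
    case 1
    show ?case by (rule 1(1)[OF 1(2-)])
  qed
  have c: "\<rho> g \<in> carrier_mat d d" if "g \<in> carrier G" for g
    using rep that by (simp add: is_rep_iff)
  define R where "R g = Q * \<rho> g * P" for g
  define l where "l = d - k"
  define A where "A g = mat k k (\<lambda>(i, j). R g $$ (i, j))" for g
  define B where "B g = mat k l (\<lambda>(i, j). R g $$ (i, j + k))" for g
  define D where "D g = mat l l (\<lambda>(i, j). R g $$ (i + k, j + k))" for g
  have d: "d = k + l" using k by (simp add: l_def)
  have Rc: "R g \<in> carrier_mat d d" if "g \<in> carrier G" for g
    using PQ c[OF that] by (simp add: R_def square_mat_mult[where d = d])
  have PR: "\<rho> g * P = P * R g" if "g \<in> carrier G" for g
  proof -
    have "P * R g = (P * Q) * (\<rho> g * P)"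
      unfolding R_def using PQ(1,2) c[OF that] by (simp add: square_mat_mult[where d = d])
    then show ?thesis using PQ c[OF that] by (simp add: square_mat_mult[where d = d] left_mult_one_mat[of _ d d])
  qed
  have low: "R g $$ (i, j) = 0" if g: "g \<in> carrier G" and "k \<le> i" "i < d" "j < k" for g i j
  proof -
    have jd: "j < d" using that k by simp
    have "P *\<^sub>v unit_vec d j \<in> W"
      using PW[of "unit_vec d j"] that by (auto simp: unit_vec_def)
    then have "\<rho> g *\<^sub>v (P *\<^sub>v unit_vec d j) \<in> W" by (rule inv[OF g])
    also have "\<rho> g *\<^sub>v (P *\<^sub>v unit_vec d j) = P *\<^sub>v (R g *\<^sub>v unit_vec d j)"
    proof -
      have "\<rho> g *\<^sub>v (P *\<^sub>v unit_vec d j) = (\<rho> g * P) *\<^sub>v unit_vec d j"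
        by (rule assoc_mult_mat_vec[symmetric, OF c[OF g] PQ(1)]) simp
      also have "\<dots> = P *\<^sub>v (R g *\<^sub>v unit_vec d j)"
        unfolding PR[OF g] by (rule assoc_mult_mat_vec[OF PQ(1) Rc[OF g]]) simp
      finally show ?thesis .
    qed
    finally have "(R g *\<^sub>v unit_vec d j) $ i = 0"
      using PW[of "R g *\<^sub>v unit_vec d j"] Rc[OF g] that by auto
    then show ?thesis using Rc[OF g] that jd by simp
  qed
  have "R g = four_block_mat (A g) (B g) (0\<^sub>m l k) (D g)" if g: "g \<in> carrier G" for g
    using Rc[OF g] low[OF g] d by (intro eq_matI) (auto simp: A_def B_def D_def)
  then show ?thesis
    using that[of k l P Q A B D] k d PQ PR by (auto simp: A_def B_def D_def)
qed

text \<open>Multiplicativity of the block triangular form says that the diagonal blocks are representations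
  and that \<open>B (g h) = A g B h + B g D h\<close>. Summing \<open>B h D (h\<^sup>-\<^sup>1)\<close> over the group and dividing by its
  order gives a matrix \<open>X\<close> with \<open>A g X + B g = X D g\<close>. Conjugation by the unipotent matrix with
  upper right block \<open>X\<close> then removes the block \<open>B\<close>.\<close>

theorem (in group) maschke_splitting:
  assumes fin: "finite (carrier G)" and rep: "is_rep G (d, \<rho>)"
    and "d > 0" and "\<not> irreducible_rep G (d, \<rho>)"
  obtains k l A D where "0 < k" "0 < l" "d = k + l" "is_rep G (k, A)" "is_rep G (l, D)"
    "equiv_rep G (d, \<rho>) (d, \<lambda>g. four_block_mat (A g) (0\<^sub>m k l) (0\<^sub>m l k) (D g))"
proof -
  obtain k l A B D P Q where kl: "0 < k" "0 < l" "d = k + l"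
    and PQ: "P \<in> carrier_mat d d" "Q \<in> carrier_mat d d" "P * Q = 1\<^sub>m d" "Q * P = 1\<^sub>m d"
    and Ac: "\<And>g. g \<in> carrier G \<Longrightarrow> A g \<in> carrier_mat k k"
    and Bc: "\<And>g. g \<in> carrier G \<Longrightarrow> B g \<in> carrier_mat k l"
    and Dc: "\<And>g. g \<in> carrier G \<Longrightarrow> D g \<in> carrier_mat l l"
    and tri: "\<And>g. g \<in> carrier G \<Longrightarrow> \<rho> g * P = P * four_block_mat (A g) (B g) (0\<^sub>m l k) (D g)"
    proof (rule block_triangular_form[OF assms(2-4)], goal_cases)
    case 1
    show ?case by (rule 1(1)[OF 1(2-)])
  qed
  define R where "R g = four_block_mat (A g) (B g) (0\<^sub>m l k) (D g)" for g
  have \<rho>c: "\<rho> g \<in> carrier_mat d d" if "g \<in> carrier G" for g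
    using rep that by (simp add: is_rep_iff)
  have Rc: "R g \<in> carrier_mat d d" if "g \<in> carrier G" for g
    unfolding R_def kl(3) using Ac[OF that] Dc[OF that] by (rule four_block_carrier_mat)
  have R_eq: "R g = Q * \<rho> g * P" if g: "g \<in> carrier G" for g
  proof -
    have "Q * \<rho> g * P = Q * (P * R g)"
      using tri[OF g] assoc_mult_mat[OF PQ(2) \<rho>c[OF g] PQ(1)] by (simp add: R_def)
    also have "\<dots> = R g"
      using assoc_mult_mat[OF PQ(2,1) Rc[OF g]] PQ(4) Rc[OF g] by (simp add: left_mult_one_mat[of _ d d])
    finally show ?thesis by simp
  qed
  have Rmult: "R (g \<otimes> h) = R g * R h" if g: "g \<in> carrier G" and h: "h \<in> carrier G" for g h
  proof -
    have "R g * R h = Q * \<rho> g * (P * Q) * (\<rho> h * P)"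
      unfolding R_eq[OF g] R_eq[OF h] using PQ(1,2) \<rho>c[OF g] \<rho>c[OF h]
      by (simp add: square_mat_mult[where d = d])
    also have "\<dots> = Q * \<rho> (g \<otimes> h) * P"
      using PQ \<rho>c[OF g] \<rho>c[OF h] rep g h
      by (simp add: is_rep_iff square_mat_mult[where d = d] right_mult_one_mat[of _ d d])
    finally show ?thesis using R_eq g h by simp
  qed
  have Rone: "R \<one> = 1\<^sub>m d"
    using R_eq[OF one_closed] rep PQ by (simp add: is_rep_iff right_mult_one_mat[of _ d d])
  have blocks: "A (g \<otimes> h) = A g * A h" "B (g \<otimes> h) = A g * B h + B g * D h"
    "D (g \<otimes> h) = D g * D h" if g: "g \<in> carrier G" and h: "h \<in> carrier G" for g h
  proof -
    note c = Ac[OF g] Bc[OF g] Dc[OF g] Ac[OF h] Bc[OF h] Dc[OF h]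
      Ac[OF m_closed[OF g h]] Bc[OF m_closed[OF g h]] Dc[OF m_closed[OF g h]]
    have "R g * R h = four_block_mat (A g * A h + B g * 0\<^sub>m l k) (A g * B h + B g * D h)
        (0\<^sub>m l k * A h + D g * 0\<^sub>m l k) (0\<^sub>m l k * B h + D g * D h)"
      unfolding R_def by (rule mult_four_block_mat) (use c in auto)
    also have "\<dots> = four_block_mat (A g * A h) (A g * B h + B g * D h) (0\<^sub>m l k) (D g * D h)"
      using c by (simp add: right_add_zero_mat[of _ k k] left_add_zero_mat[of _ l l]
          left_mult_zero_mat[of _ k k] left_mult_zero_mat[of _ k l] right_mult_zero_mat[of _ k l] right_mult_zero_mat[of _ l l])
    finally have e: "four_block_mat (A (g \<otimes> h)) (B (g \<otimes> h)) (0\<^sub>m l k) (D (g \<otimes> h)) =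
        four_block_mat (A g * A h) (A g * B h + B g * D h) (0\<^sub>m l k) (D g * D h)"
      using Rmult[OF g h] by (simp add: R_def)
    note inj = four_block_mat_inj[OF e, of k k l l]
    show "A (g \<otimes> h) = A g * A h" "B (g \<otimes> h) = A g * B h + B g * D h" "D (g \<otimes> h) = D g * D h"
      by (rule inj; use c in auto)+
  qed
  have ones: "A \<one> = 1\<^sub>m k" "D \<one> = 1\<^sub>m l"
  proof -
    have e: "four_block_mat (A \<one>) (B \<one>) (0\<^sub>m l k) (D \<one>) =
        four_block_mat (1\<^sub>m k) (0\<^sub>m k l) (0\<^sub>m l k) (1\<^sub>m l)"
      using Rone kl by (simp add: R_def)
    note inj = four_block_mat_inj[OF e, of k k l l]
    show "A \<one> = 1\<^sub>m k" "D \<one> = 1\<^sub>m l"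
      by (rule inj; use Ac Bc Dc in auto)+
  qed
  have repA: "is_rep G (k, A)" and repD: "is_rep G (l, D)"
    using Ac Dc blocks ones by (auto simp: is_rep_iff)
  define N where "N = (of_nat (card (carrier G)) :: complex)"
  have N: "N \<noteq> 0" unfolding N_def using fin one_closed by auto
  define S where "S = sum_mat k l (\<lambda>h. B h * D (inv h)) (carrier G)"
  define X where "X = (1 / N) \<cdot>\<^sub>m S"
  have Sc: "S \<in> carrier_mat k l" by (simp add: S_def)
  have Xc: "X \<in> carrier_mat k l" using Sc by (simp add: X_def)
  have BDc: "B h * D (inv h) \<in> carrier_mat k l" if "h \<in> carrier G" for h
    using that by (intro mult_carrier_mat[OF Bc Dc]) auto
  \<comment> \<open>reindex the sum by left translation, and apply the rule for the off-diagonal block\<close>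
  have AS: "A g * S + N \<cdot>\<^sub>m B g = S * D g" if g: "g \<in> carrier G" for g
  proof -
    have "S * D g = sum_mat k l (\<lambda>h. B h * D (inv h) * D g) (carrier G)"
      unfolding S_def by (rule sum_mat_mult[OF Dc[OF g] BDc])
    also have "\<dots> = sum_mat k l (\<lambda>h. B (g \<otimes> h) * D (inv (g \<otimes> h)) * D g) (carrier G)"
      by (rule sum_mat_translate[OF g, symmetric])
    also have "\<dots> = sum_mat k l (\<lambda>h. A g * (B h * D (inv h)) + B g) (carrier G)"
    proof (rule sum_mat_cong)
      fix h assume h: "h \<in> carrier G"
      have ih: "inv h \<in> carrier G" using h by simp
      note c = Ac[OF g] Bc[OF g] Dc[OF g] Bc[OF h] Dc[OF h] Dc[OF ih]
      have "B (g \<otimes> h) * D (inv (g \<otimes> h)) * D g = B (g \<otimes> h) * (D (inv (g \<otimes> h)) * D g)"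
        by (rule assoc_mult_mat[OF Bc Dc Dc]) (use g h in auto)
      also have "D (inv (g \<otimes> h)) * D g = D (inv h)"
        using blocks(3)[of "inv (g \<otimes> h)" g] g h by (simp add: inv_mult_group m_assoc)
      also have "B (g \<otimes> h) * D (inv h) = A g * B h * D (inv h) + B g * D h * D (inv h)"
        unfolding blocks(2)[OF g h] by (rule add_mult_distrib_mat) (use c in auto)
      also have "A g * B h * D (inv h) = A g * (B h * D (inv h))"
        by (rule assoc_mult_mat) (use c in auto)
      also have "B g * D h * D (inv h) = B g * (D h * D (inv h))"
        by (rule assoc_mult_mat) (use c in auto)
      also have "D h * D (inv h) = 1\<^sub>m l"
        using blocks(3)[of h "inv h"] h ones by simp
      also have "B g * 1\<^sub>m l = B g" using c(2) by (rule right_mult_one_mat)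
      finally show "B (g \<otimes> h) * D (inv (g \<otimes> h)) * D g = A g * (B h * D (inv h)) + B g" .
    qed
    also have "\<dots> = sum_mat k l (\<lambda>h. A g * (B h * D (inv h))) (carrier G) + N \<cdot>\<^sub>m B g"
    proof (rule eq_matI)
      fix i j
      assume "i < dim_row (sum_mat k l (\<lambda>h. A g * (B h * D (inv h))) (carrier G) + N \<cdot>\<^sub>m B g)"
        "j < dim_col (sum_mat k l (\<lambda>h. A g * (B h * D (inv h))) (carrier G) + N \<cdot>\<^sub>m B g)"
      then have ij: "i < k" "j < l" using Bc[OF g] by auto
      show "sum_mat k l (\<lambda>h. A g * (B h * D (inv h)) + B g) (carrier G) $$ (i, j) =
          (sum_mat k l (\<lambda>h. A g * (B h * D (inv h))) (carrier G) + N \<cdot>\<^sub>m B g) $$ (i, j)"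
        using ij Bc[OF g] by (simp add: sum_mat_def sum.distrib N_def del: index_mult_mat)
    qed (use Bc[OF g] in \<open>auto simp: sum_mat_def\<close>)
    also have "sum_mat k l (\<lambda>h. A g * (B h * D (inv h))) (carrier G) = A g * S"
      unfolding S_def by (rule mult_sum_mat[OF Ac[OF g] BDc, symmetric])
    finally show ?thesis by simp
  qed
  have AX: "A g * X + B g = X * D g" if g: "g \<in> carrier G" for g
  proof -
    have "X * D g = (1 / N) \<cdot>\<^sub>m (S * D g)"
      unfolding X_def by (rule mult_smult_assoc_mat[OF Sc Dc[OF g]])
    also have "\<dots> = (1 / N) \<cdot>\<^sub>m (A g * S) + (1 / N) \<cdot>\<^sub>m (N \<cdot>\<^sub>m B g)"
      unfolding AS[OF g, symmetric]
      by (rule add_smult_distrib_left_mat[of _ k l]) (use Ac[OF g] Sc Bc[OF g] in auto)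
    also have "(1 / N) \<cdot>\<^sub>m (N \<cdot>\<^sub>m B g) = B g" using N by (intro eq_matI) auto
    also have "(1 / N) \<cdot>\<^sub>m (A g * S) = A g * X"
      unfolding X_def by (rule mult_smult_distrib[OF Ac[OF g] Sc, symmetric])
    finally show ?thesis by simp
  qed
  define U where "U = four_block_mat (1\<^sub>m k) X (0\<^sub>m l k) (1\<^sub>m l)"
  define U' where "U' = four_block_mat (1\<^sub>m k) (- X) (0\<^sub>m l k) (1\<^sub>m l)"
  have Uc: "U \<in> carrier_mat d d" "U' \<in> carrier_mat d d"
    unfolding U_def U'_def kl(3) by (rule four_block_carrier_mat; simp)+
  have unip: "four_block_mat (1\<^sub>m k) Y (0\<^sub>m l k) (1\<^sub>m l) * four_block_mat (1\<^sub>m k) Z (0\<^sub>m l k) (1\<^sub>m l) = 1\<^sub>m d"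
    if YZ: "Y \<in> carrier_mat k l" "Z \<in> carrier_mat k l" "Z + Y = 0\<^sub>m k l" for Y Z :: "complex mat"
  proof -
    have "four_block_mat (1\<^sub>m k) Y (0\<^sub>m l k) (1\<^sub>m l) * four_block_mat (1\<^sub>m k) Z (0\<^sub>m l k) (1\<^sub>m l) =
      four_block_mat (1\<^sub>m k * 1\<^sub>m k + Y * 0\<^sub>m l k) (1\<^sub>m k * Z + Y * 1\<^sub>m l)
        (0\<^sub>m l k * 1\<^sub>m k + 1\<^sub>m l * 0\<^sub>m l k) (0\<^sub>m l k * Z + 1\<^sub>m l * 1\<^sub>m l)"
      by (rule mult_four_block_mat) (use YZ in auto)
    also have "\<dots> = four_block_mat (1\<^sub>m k) (0\<^sub>m k l) (0\<^sub>m l k) (1\<^sub>m l)"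
      using YZ by (simp add: right_mult_zero_mat[of _ k l] left_mult_zero_mat[of _ k l])
    finally show ?thesis using kl by simp
  qed
  have UU: "U * U' = 1\<^sub>m d" "U' * U = 1\<^sub>m d"
    unfolding U_def U'_def using Xc
    by (intro unip; force)+
  define E where "E g = four_block_mat (A g) (0\<^sub>m k l) (0\<^sub>m l k) (D g)" for g
  have Ec: "E g \<in> carrier_mat d d" if "g \<in> carrier G" for g
    unfolding E_def kl(3) using Ac[OF that] Dc[OF that] by (rule four_block_carrier_mat)
  have RU: "R g * U = U * E g" if g: "g \<in> carrier G" for g
  proof -
    note c = Ac[OF g] Bc[OF g] Dc[OF g] Xc
    have "R g * U = four_block_mat (A g * 1\<^sub>m k + B g * 0\<^sub>m l k) (A g * X + B g * 1\<^sub>m l)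
        (0\<^sub>m l k * 1\<^sub>m k + D g * 0\<^sub>m l k) (0\<^sub>m l k * X + D g * 1\<^sub>m l)"
      unfolding R_def U_def by (rule mult_four_block_mat) (use c in auto)
    also have "\<dots> = four_block_mat (A g) (X * D g) (0\<^sub>m l k) (D g)"
      using c AX[OF g] by (simp add: right_mult_zero_mat[of _ k l] right_mult_zero_mat[of _ l l] left_mult_zero_mat[of _ k l])
    also have "\<dots> = four_block_mat (1\<^sub>m k * A g + X * 0\<^sub>m l k) (1\<^sub>m k * 0\<^sub>m k l + X * D g)
        (0\<^sub>m l k * A g + 1\<^sub>m l * 0\<^sub>m l k) (0\<^sub>m l k * 0\<^sub>m k l + 1\<^sub>m l * D g)"
      using c by (simp add: right_mult_zero_mat[of _ k l] left_mult_zero_mat[of _ k k])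
    also have "\<dots> = U * E g"
      unfolding E_def U_def by (rule mult_four_block_mat[symmetric]) (use c in auto)
    finally show ?thesis .
  qed
  have "equiv_rep G (d, \<rho>) (d, R)"
    by (rule equiv_repI_right[OF PQ]) (use \<rho>c Rc tri in \<open>auto simp: R_def\<close>)
  moreover have "equiv_rep G (d, R) (d, E)"
    by (rule equiv_repI_right[OF Uc UU]) (use Rc Ec RU in auto)
  ultimately have "equiv_rep G (d, \<rho>) (d, E)"
    using \<rho>c Rc Ec by (rule equiv_rep_trans)
  then show ?thesis using that[of k l A D] kl repA repD unfolding E_def by auto
qed

lemma direct_sum_carrier:
  assumes "\<And>\<sigma>. \<sigma> \<in> set \<sigma>s \<Longrightarrow> snd \<sigma> g \<in> carrier_mat (fst \<sigma>) (fst \<sigma>)"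
  shows "snd (direct_sum_rep \<sigma>s) g \<in> carrier_mat (fst (direct_sum_rep \<sigma>s)) (fst (direct_sum_rep \<sigma>s))"
proof -
  have "sum_list (map (dim_row \<circ> (\<lambda>\<rho>. snd \<rho> g)) \<sigma>s) = sum_list (map fst \<sigma>s)"
    "sum_list (map (dim_col \<circ> (\<lambda>\<rho>. snd \<rho> g)) \<sigma>s) = sum_list (map fst \<sigma>s)"
    using assms by (auto intro!: arg_cong[of _ _ sum_list] dest!: assms)
  then show ?thesis by (auto simp: direct_sum_rep_def dim_diag_block_mat)
qed

lemma equiv_rep_block_diag:
  assumes "equiv_rep G (k, A) (k', A')" "equiv_rep G (l, D) (l', D')"
    and c: "\<And>g. g \<in> carrier G \<Longrightarrow> A g \<in> carrier_mat k k" "\<And>g. g \<in> carrier G \<Longrightarrow> D g \<in> carrier_mat l l"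
      "\<And>g. g \<in> carrier G \<Longrightarrow> A' g \<in> carrier_mat k' k'" "\<And>g. g \<in> carrier G \<Longrightarrow> D' g \<in> carrier_mat l' l'"
  shows "equiv_rep G (k + l, \<lambda>g. four_block_mat (A g) (0\<^sub>m k l) (0\<^sub>m l k) (D g))
      (k' + l', \<lambda>g. four_block_mat (A' g) (0\<^sub>m k' l') (0\<^sub>m l' k') (D' g))"
proof -
  obtain P Q where PQ: "k' = k" "P \<in> carrier_mat k k" "Q \<in> carrier_mat k k"
    "P * Q = 1\<^sub>m k" "Q * P = 1\<^sub>m k" "\<And>g. g \<in> carrier G \<Longrightarrow> P * A g = A' g * P"
    using equiv_repE[OF assms(1)] by metis
  obtain R S where RS: "l' = l" "R \<in> carrier_mat l l" "S \<in> carrier_mat l l"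
    "R * S = 1\<^sub>m l" "S * R = 1\<^sub>m l" "\<And>g. g \<in> carrier G \<Longrightarrow> R * D g = D' g * R"
    using equiv_repE[OF assms(2)] by metis
  let ?b = "\<lambda>M N. four_block_mat M (0\<^sub>m k l) (0\<^sub>m l k) N"
  have mult: "?b M N * ?b M' N' = ?b (M * M') (N * N')"
    if c: "M \<in> carrier_mat k k" "N \<in> carrier_mat l l" "M' \<in> carrier_mat k k" "N' \<in> carrier_mat l l"
    for M N M' N' :: "complex mat"
  proof -
    have "?b M N * ?b M' N' = four_block_mat (M * M' + 0\<^sub>m k l * 0\<^sub>m l k) (M * 0\<^sub>m k l + 0\<^sub>m k l * N')
        (0\<^sub>m l k * M' + N * 0\<^sub>m l k) (0\<^sub>m l k * 0\<^sub>m k l + N * N')"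
      by (rule mult_four_block_mat) (use c in auto)
    also have "\<dots> = ?b (M * M') (N * N')"
      using c by (simp add: left_mult_zero_mat[of _ k k] left_mult_zero_mat[of _ l l]
          right_mult_zero_mat[of _ k k] right_mult_zero_mat[of _ l l] right_add_zero_mat[of _ k k] left_add_zero_mat[of _ l l])
    finally show ?thesis .
  qed
  have "equiv_rep G (k + l, \<lambda>g. ?b (A g) (D g)) (k + l, \<lambda>g. ?b (A' g) (D' g))"
  proof (rule equiv_repI[of "?b P R" _ "?b Q S"])
    show "?b P R * ?b Q S = 1\<^sub>m (k + l)" "?b Q S * ?b P R = 1\<^sub>m (k + l)"
      using PQ RS by (simp_all add: mult)
    show "?b P R * ?b (A g) (D g) = ?b (A' g) (D' g) * ?b P R" if "g \<in> carrier G" for g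
      using PQ RS c[OF that] that by (simp add: mult)
  qed (use PQ RS in auto)
  then show ?thesis using PQ(1) RS(1) by simp
qed

text \<open>Splitting off invariant subspaces lowers the degree. The representation of degree \<open>0\<close>, which is not
  irreducible, is the empty direct sum.\<close>

theorem (in group) decomposition_exists:
  assumes fin: "finite (carrier G)" and "is_rep G (d, \<rho>)"
  shows "\<exists>\<sigma>s. (\<forall>\<sigma>\<in>set \<sigma>s. irreducible_rep G \<sigma>) \<and> equiv_rep G (d, \<rho>) (direct_sum_rep \<sigma>s)"
  using assms(2)
proof (induction d arbitrary: \<rho> rule: less_induct)
  case (less d)
  have \<rho>c: "\<And>g. g \<in> carrier G \<Longrightarrow> \<rho> g \<in> carrier_mat d d" using less.prems by (simp add: is_rep_iff)
  have irr_c: "snd \<sigma> g \<in> carrier_mat (fst \<sigma>) (fst \<sigma>)" if "irreducible_rep G \<sigma>" "g \<in> carrier G" for \<sigma> g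
    using that by (cases \<sigma>) (auto simp: irreducible_rep_def is_rep_iff)
  consider "d = 0" | "irreducible_rep G (d, \<rho>)" | "d > 0" "\<not> irreducible_rep G (d, \<rho>)" by auto
  then show ?case
  proof cases
    case 1
    have "\<rho> g = 0\<^sub>m 0 0" if "g \<in> carrier G" for g
      using \<rho>c[OF that] 1 by (intro eq_matI) auto
    then have "equiv_rep G (d, \<rho>) (0, \<lambda>g. 0\<^sub>m 0 0)"
      unfolding 1 by (intro equiv_repI[of "1\<^sub>m 0" _ "1\<^sub>m 0"]) auto
    then show ?thesis by (intro exI[of _ "[]"]) (simp add: direct_sum_rep_def)
  next
    case 2
    have "equiv_rep G (d, \<rho>) (direct_sum_rep [(d, \<rho>)])"
      using equiv_rep_refl[of G \<rho> d] \<rho>c by (simp add: direct_sum_rep_def del: diag_block_mat.simps)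
    then show ?thesis using 2 by (intro exI[of _ "[(d, \<rho>)]"]) simp
  next
    case 3
    obtain k l A D where kl: "0 < k" "0 < l" "d = k + l" and rep: "is_rep G (k, A)" "is_rep G (l, D)"
      and eq: "equiv_rep G (d, \<rho>) (d, \<lambda>g. four_block_mat (A g) (0\<^sub>m k l) (0\<^sub>m l k) (D g))"
      proof (rule maschke_splitting[OF fin less.prems 3], goal_cases)
      case 1
      show ?case by (rule 1(1)[OF 1(2-)])
    qed
    obtain as where as: "\<forall>\<sigma>\<in>set as. irreducible_rep G \<sigma>" "equiv_rep G (k, A) (direct_sum_rep as)"
      using less.IH[OF _ rep(1)] kl by auto
    obtain ds where ds: "\<forall>\<sigma>\<in>set ds. irreducible_rep G \<sigma>" "equiv_rep G (l, D) (direct_sum_rep ds)"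
      using less.IH[OF _ rep(2)] kl by auto
    obtain k' A' where A': "direct_sum_rep as = (k', A')" by fastforce
    obtain l' D' where D': "direct_sum_rep ds = (l', D')" by fastforce
    have c: "\<And>g. g \<in> carrier G \<Longrightarrow> A' g \<in> carrier_mat k' k'" "\<And>g. g \<in> carrier G \<Longrightarrow> D' g \<in> carrier_mat l' l'"
      using direct_sum_carrier[of as] direct_sum_carrier[of ds] irr_c as ds A' D' by auto
    have cAD: "\<And>g. g \<in> carrier G \<Longrightarrow> A g \<in> carrier_mat k k" "\<And>g. g \<in> carrier G \<Longrightarrow> D g \<in> carrier_mat l l"
      using rep by (auto simp: is_rep_iff)
    let ?E = "\<lambda>g. four_block_mat (A g) (0\<^sub>m k l) (0\<^sub>m l k) (D g)"
    let ?E' = "\<lambda>g. four_block_mat (A' g) (0\<^sub>m k' l') (0\<^sub>m l' k') (D' g)"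
    have "equiv_rep G (k + l, ?E) (k' + l', ?E')"
      by (rule equiv_rep_block_diag[OF as(2)[unfolded A'] ds(2)[unfolded D'] cAD c])
    then have 1: "equiv_rep G (d, \<rho>) (k' + l', ?E')"
      by (intro equiv_rep_trans[OF eq[unfolded kl(3)], folded kl(3)]) (use \<rho>c cAD c kl in auto)
    obtain F where F_def: "F = snd (direct_sum_rep (as @ ds))" by simp
    have ds_eq: "direct_sum_rep (as @ ds) = (k' + l', F)"
      unfolding F_def using A' D' by (auto simp: direct_sum_rep_def)
    have F: "F g = ?E' g" if "g \<in> carrier G" for g
      unfolding F_def using c[OF that] A' D' by (auto simp: direct_sum_rep_def diag_block_mat_append Let_def)
    have "equiv_rep G (k' + l', ?E') (k' + l', F)"
      using F c by (intro equiv_repI[of "1\<^sub>m (k' + l')" _ "1\<^sub>m (k' + l')"])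
        (auto simp: left_mult_one_mat[of _ "k' + l'" "k' + l'"] right_mult_one_mat[of _ "k' + l'" "k' + l'"])
    with 1 have "equiv_rep G (d, \<rho>) (direct_sum_rep (as @ ds))"
      unfolding ds_eq by (rule equiv_rep_trans) (use \<rho>c c F in auto)
    then show ?thesis using as ds by (intro exI[of _ "as @ ds"]) auto
  qed
qed

section \<open>Traces and Schur's lemma\<close>

lemma trace_mat_comm:
  assumes "A \<in> carrier_mat n m" "B \<in> carrier_mat m n"
  shows "trace_mat (A * B) = trace_mat (B * A)"
proof -
  have "trace_mat (A * B) = (\<Sum>i<n. \<Sum>j<m. A $$ (i, j) * B $$ (j, i))"
    using assms by (simp add: trace_mat_def scalar_prod_def lessThan_atLeast0)
  also have "\<dots> = (\<Sum>j<m. \<Sum>i<n. B $$ (j, i) * A $$ (i, j))"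
    by (subst sum.swap) (simp add: mult.commute)
  also have "\<dots> = trace_mat (B * A)"
    using assms by (simp add: trace_mat_def scalar_prod_def lessThan_atLeast0)
  finally show ?thesis .
qed

lemma trace_one_mat [simp]: "trace_mat (1\<^sub>m n) = of_nat n"
  by (simp add: trace_mat_def)

lemma trace_four_block_mat:
  assumes "A \<in> carrier_mat k k" "D \<in> carrier_mat l l"
  shows "trace_mat (four_block_mat A B C D) = trace_mat A + trace_mat D"
proof -
  have "(\<Sum>i<k + l. f i) = (\<Sum>i<k. f i) + (\<Sum>i<l. f (i + k))" for f :: "nat \<Rightarrow> complex"
    by (induction l) (simp_all add: ac_simps)
  then show ?thesis using assms by (simp add: trace_mat_def)
qed

lemma trace_equiv_rep:
  assumes "equiv_rep G (d, \<rho>) (d', \<rho>')" "g \<in> carrier G"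
    and c: "\<rho> g \<in> carrier_mat d d" "\<rho>' g \<in> carrier_mat d' d'"
  shows "trace_mat (\<rho>' g) = trace_mat (\<rho> g)"
proof -
  obtain P Q where PQ: "d' = d" "P \<in> carrier_mat d d" "Q \<in> carrier_mat d d"
    "P * Q = 1\<^sub>m d" "Q * P = 1\<^sub>m d" "\<And>g. g \<in> carrier G \<Longrightarrow> P * \<rho> g = \<rho>' g * P"
    using equiv_repE[OF assms(1)] by metis
  have "trace_mat (\<rho>' g * (P * Q)) = trace_mat (\<rho>' g * P * Q)"
    using assoc_mult_mat[OF _ PQ(2,3)] c PQ(1) by simp
  also have "\<dots> = trace_mat (P * (\<rho> g * Q))"
    using PQ(6)[OF assms(2)] assoc_mult_mat[OF PQ(2) c(1) PQ(3)] by simp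
  also have "\<dots> = trace_mat (\<rho> g * Q * P)"
    using PQ(2,3) c by (intro trace_mat_comm[of _ d d]) auto
  also have "\<dots> = trace_mat (\<rho> g)"
    using assoc_mult_mat[OF c(1) PQ(3,2)] PQ(5) c(1) by (simp add: right_mult_one_mat[of _ d d])
  finally show ?thesis using PQ(1,4) c by (simp add: right_mult_one_mat[of _ d d])
qed

lemma trace_direct_sum:
  assumes "\<And>\<sigma>. \<sigma> \<in> set \<sigma>s \<Longrightarrow> snd \<sigma> g \<in> carrier_mat (fst \<sigma>) (fst \<sigma>)"
  shows "trace_mat (snd (direct_sum_rep \<sigma>s) g) = (\<Sum>\<sigma>\<leftarrow>\<sigma>s. trace_mat (snd \<sigma> g))"
  using assms
proof (induction \<sigma>s)
  case Nil
  then show ?case by (simp add: direct_sum_rep_def trace_mat_def)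
next
  case (Cons \<sigma> \<sigma>s)
  have "snd (direct_sum_rep \<sigma>s) g \<in> carrier_mat (fst (direct_sum_rep \<sigma>s)) (fst (direct_sum_rep \<sigma>s))"
    by (rule direct_sum_carrier) (use Cons.prems in auto)
  moreover have "snd \<sigma> g \<in> carrier_mat (fst \<sigma>) (fst \<sigma>)" by (rule Cons.prems) simp
  ultimately have "trace_mat (snd (direct_sum_rep (\<sigma> # \<sigma>s)) g) =
      trace_mat (snd \<sigma> g) + trace_mat (snd (direct_sum_rep \<sigma>s) g)"
    by (auto simp: direct_sum_rep_def Let_def intro: trace_four_block_mat)
  then show ?case using Cons by simp
qed

lemma irreducible_repD:
  assumes "irreducible_rep G (d, \<rho>)"
    and "W \<subseteq> carrier_vec d" "0\<^sub>v d \<in> W" "\<And>v w. v \<in> W \<Longrightarrow> w \<in> W \<Longrightarrow> v + w \<in> W"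
    "\<And>c v. v \<in> W \<Longrightarrow> c \<cdot>\<^sub>v v \<in> W" "\<And>g w. g \<in> carrier G \<Longrightarrow> w \<in> W \<Longrightarrow> \<rho> g *\<^sub>v w \<in> W"
  shows "W = {0\<^sub>v d} \<or> W = carrier_vec d"
proof -
  have "VectorSpace.subspace class_ring W (module_vec TYPE(complex) d)"
    unfolding subspace_vec_iff by (intro conjI ballI allI assms(2-5))
  moreover have "\<forall>g\<in>carrier G. \<forall>w\<in>W. \<rho> g *\<^sub>v w \<in> W" using assms(6) by simp
  ultimately show ?thesis using assms(1) by (simp add: irreducible_rep_def)
qed

lemma mult_mat_zero_vec: "A \<in> carrier_mat n m \<Longrightarrow> A *\<^sub>v 0\<^sub>v m = (0\<^sub>v n :: complex vec)"
  by (intro eq_vecI) auto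

lemma mat_eq_by_vectors:
  assumes "A \<in> carrier_mat n m" "B \<in> carrier_mat n m"
    and "\<And>v. v \<in> carrier_vec m \<Longrightarrow> A *\<^sub>v v = B *\<^sub>v (v :: complex vec)"
  shows "A = B"
proof (rule eq_matI)
  fix i j assume "i < dim_row B" "j < dim_col B"
  then have ij: "i < n" "j < m" using assms by auto
  then show "A $$ (i, j) = B $$ (i, j)"
  proof -
    have "(A *\<^sub>v unit_vec m j) $ i = (B *\<^sub>v unit_vec m j) $ i" by (simp add: assms(3))
    then show ?thesis using ij assms(1,2) by simp
  qed
qed (use assms in auto)

text \<open>Kernel and image of an intertwining matrix \<open>T\<close> are invariant subspaces. If \<open>T\<close> is not zero, the
  kernel is therefore zero and the image is everything, so \<open>T\<close> has a two-sided inverse \<open>S\<close>. Since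
  \<open>T S\<close> and \<open>S T\<close> have the same trace, the two degrees agree.\<close>

lemma (in group) schur:
  assumes irr: "irreducible_rep G (d, \<rho>)" "irreducible_rep G (d', \<rho>')"
    and T: "T \<in> carrier_mat d' d" and int: "\<And>g. g \<in> carrier G \<Longrightarrow> T * \<rho> g = \<rho>' g * T"
    and "T \<noteq> 0\<^sub>m d' d"
  shows "equiv_rep G (d, \<rho>) (d', \<rho>')"
proof -
  have c: "\<rho> g \<in> carrier_mat d d" "\<rho>' g \<in> carrier_mat d' d'" if "g \<in> carrier G" for g
    using irr that by (auto simp: irreducible_rep_def is_rep_iff)
  have intv: "T *\<^sub>v (\<rho> g *\<^sub>v v) = \<rho>' g *\<^sub>v (T *\<^sub>v v)" if "g \<in> carrier G" "v \<in> carrier_vec d" for g v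
    using int[OF that(1)] assoc_mult_mat_vec[OF T c(1)[OF that(1)] that(2)]
      assoc_mult_mat_vec[OF c(2)[OF that(1)] T that(2)] by simp
  have nz: False if "\<And>v. v \<in> carrier_vec d \<Longrightarrow> T *\<^sub>v v = 0\<^sub>v d'"
  proof -
    have "T = 0\<^sub>m d' d"
      by (rule mat_eq_by_vectors[OF T]) (auto simp: that intro!: eq_vecI)
    then show False using assms(5) by simp
  qed
  have ker: "{v \<in> carrier_vec d. T *\<^sub>v v = 0\<^sub>v d'} = {0\<^sub>v d}"
  proof -
    have "{v \<in> carrier_vec d. T *\<^sub>v v = 0\<^sub>v d'} = {0\<^sub>v d} \<or> {v \<in> carrier_vec d. T *\<^sub>v v = 0\<^sub>v d'} = carrier_vec d"
      by (rule irreducible_repD[OF irr(1)])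
        (use T c in \<open>auto simp: mult_add_distrib_mat_vec[of _ d' d] mult_mat_vec[of _ d' d] intv mult_mat_zero_vec[of _ d' d']
           intro: mult_mat_vec_carrier\<close>)
    then show ?thesis using nz by blast
  qed
  have im: "(\<lambda>v. T *\<^sub>v v) ` carrier_vec d = carrier_vec d'"
  proof -
    have "(\<lambda>v. T *\<^sub>v v) ` carrier_vec d = {0\<^sub>v d'} \<or> (\<lambda>v. T *\<^sub>v v) ` carrier_vec d = carrier_vec d'"
    proof (rule irreducible_repD[OF irr(2)])
      show "0\<^sub>v d' \<in> (\<lambda>v. T *\<^sub>v v) ` carrier_vec d"
        using T by (intro image_eqI[of _ _ "0\<^sub>v d"]) auto
      show "v + w \<in> (\<lambda>v. T *\<^sub>v v) ` carrier_vec d"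
        if "v \<in> (\<lambda>v. T *\<^sub>v v) ` carrier_vec d" "w \<in> (\<lambda>v. T *\<^sub>v v) ` carrier_vec d" for v w
        using that by (auto simp: mult_add_distrib_mat_vec[OF T, symmetric])
      show "a \<cdot>\<^sub>v v \<in> (\<lambda>v. T *\<^sub>v v) ` carrier_vec d" if "v \<in> (\<lambda>v. T *\<^sub>v v) ` carrier_vec d" for a v
        using that by (auto simp: mult_mat_vec[OF T, symmetric])
      show "\<rho>' g *\<^sub>v w \<in> (\<lambda>v. T *\<^sub>v v) ` carrier_vec d"
        if "g \<in> carrier G" "w \<in> (\<lambda>v. T *\<^sub>v v) ` carrier_vec d" for g w
        using that c[OF that(1)] by (auto simp: intv[symmetric] intro!: imageI intro: mult_mat_vec_carrier)
    qed (use T in \<open>auto intro: mult_mat_vec_carrier\<close>)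
    then show ?thesis using nz by blast
  qed
  have "\<forall>j. \<exists>v. j < d' \<longrightarrow> v \<in> carrier_vec d \<and> T *\<^sub>v v = unit_vec d' j"
    using im unit_vec_carrier[of d'] by (metis image_iff)
  then obtain s where s: "\<And>j. j < d' \<Longrightarrow> s j \<in> carrier_vec d" "\<And>j. j < d' \<Longrightarrow> T *\<^sub>v s j = unit_vec d' j"
    by metis
  define S where "S = mat d d' (\<lambda>(i, j). s j $ i)"
  have S: "S \<in> carrier_mat d d'" by (simp add: S_def)
  have colS: "col S j = s j" if "j < d'" for j
    using that s(1)[OF that] by (intro eq_vecI) (auto simp: S_def)
  have TS: "T * S = 1\<^sub>m d'"
  proof (rule eq_matI)
    fix i j assume "i < dim_row (1\<^sub>m d' :: complex mat)" "j < dim_col (1\<^sub>m d' :: complex mat)"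
    then have ij: "i < d'" "j < d'" by auto
    have "(T * S) $$ (i, j) = (T *\<^sub>v col S j) $ i" using ij T S by simp
    also have "\<dots> = (1\<^sub>m d') $$ (i, j)" using ij s colS by (simp add: unit_vec_def)
    finally show "(T * S) $$ (i, j) = (1\<^sub>m d') $$ (i, j)" .
  qed (use T S in auto)
  have ST: "S * T = 1\<^sub>m d"
  proof (rule mat_eq_by_vectors[of _ d d])
    fix v :: "complex vec" assume v: "v \<in> carrier_vec d"
    define w where "w = S *\<^sub>v (T *\<^sub>v v)"
    have Tv: "T *\<^sub>v v \<in> carrier_vec d'" using T v by (rule mult_mat_vec_carrier)
    have w: "w \<in> carrier_vec d" unfolding w_def using S Tv by (rule mult_mat_vec_carrier)
    have "T *\<^sub>v w = T *\<^sub>v v"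
      unfolding w_def using assoc_mult_mat_vec[OF T S Tv] TS Tv by simp
    then have "T *\<^sub>v (w - v) = 0\<^sub>v d'"
      using mult_minus_distrib_mat_vec[OF T w v] Tv by simp
    then have "w - v \<in> {v \<in> carrier_vec d. T *\<^sub>v v = 0\<^sub>v d'}" using v w by simp
    then have wv: "w - v = 0\<^sub>v d" unfolding ker by simp
    have "w = v"
    proof (rule eq_vecI)
      fix i assume "i < dim_vec v"
      then show "w $ i = v $ i" using arg_cong[OF wv, of "\<lambda>u. u $ i"] v w by simp
    qed (use v w in simp)
    then show "S * T *\<^sub>v v = 1\<^sub>m d *\<^sub>v v"
      using assoc_mult_mat_vec[OF S T v] v by (simp add: w_def)
  qed (use S T in auto)
  \<comment> \<open>compare the traces of \<open>T S\<close> and \<open>S T\<close>\<close>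
  have "complex_of_nat d' = of_nat d"
    using trace_mat_comm[OF T S] TS ST by simp
  then have "d' = d" by simp
  then show ?thesis using equiv_repI[of T d S G \<rho> \<rho>'] T S TS ST int by auto
qed

text \<open>An eigenspace of an intertwining matrix is invariant and nonzero, hence the whole space.\<close>

lemma (in group) schur_scalar:
  assumes irr: "irreducible_rep G (d, \<rho>)" and T: "T \<in> carrier_mat d d"
    and int: "\<And>g. g \<in> carrier G \<Longrightarrow> T * \<rho> g = \<rho> g * T"
  obtains c where "T = c \<cdot>\<^sub>m 1\<^sub>m d"
proof -
  have c: "\<rho> g \<in> carrier_mat d d" if "g \<in> carrier G" for g
    using irr that by (auto simp: irreducible_rep_def is_rep_iff)
  have "d > 0" using irr by (simp add: irreducible_rep_def)
  then obtain k where "eigenvalue T k"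
    using spectrum_non_empty[OF T] by (auto simp: spectrum_def)
  then obtain v where v: "v \<in> carrier_vec d" "v \<noteq> 0\<^sub>v d" "T *\<^sub>v v = k \<cdot>\<^sub>v v"
    using T by (auto simp: eigenvalue_def eigenvector_def)
  let ?W = "{v \<in> carrier_vec d. T *\<^sub>v v = k \<cdot>\<^sub>v v}"
  have "?W = {0\<^sub>v d} \<or> ?W = carrier_vec d"
  proof (rule irreducible_repD[OF irr])
    fix g w assume g: "g \<in> carrier G" and w: "w \<in> ?W"
    have "T *\<^sub>v (\<rho> g *\<^sub>v w) = \<rho> g *\<^sub>v (T *\<^sub>v w)"
      using int[OF g] assoc_mult_mat_vec[OF T c[OF g], of w] assoc_mult_mat_vec[OF c[OF g] T, of w] w by simp
    also have "\<dots> = k \<cdot>\<^sub>v (\<rho> g *\<^sub>v w)" using w mult_mat_vec[OF c[OF g]] by simp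
    finally show "\<rho> g *\<^sub>v w \<in> ?W" using c[OF g] w by auto
  next
    fix a w assume "w \<in> ?W"
    then show "a \<cdot>\<^sub>v w \<in> ?W" using mult_mat_vec[OF T, of w a] by (auto simp: smult_smult_assoc mult.commute)
  next
    fix w w' assume "w \<in> ?W" "w' \<in> ?W"
    then show "w + w' \<in> ?W"
      using mult_add_distrib_mat_vec[OF T, of w w'] smult_add_distrib_vec[of w d w' k] by auto
  qed (use T in auto)
  then have all: "T *\<^sub>v w = k \<cdot>\<^sub>v w" if "w \<in> carrier_vec d" for w using v that by blast
  have "T = k \<cdot>\<^sub>m 1\<^sub>m d"
  proof (rule mat_eq_by_vectors[OF T])
    fix w :: "complex vec" assume w: "w \<in> carrier_vec d"
    have "k \<cdot>\<^sub>m 1\<^sub>m d *\<^sub>v w = k \<cdot>\<^sub>v w"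
      using w by (intro eq_vecI) (auto simp: row_def scalar_prod_def sum.remove if_distrib sum.delta' cong: if_cong)
    then show "T *\<^sub>v w = k \<cdot>\<^sub>m 1\<^sub>m d *\<^sub>v w" using all[OF w] by simp
  qed auto
  then show ?thesis by (rule that)
qed

section \<open>Orthogonality of irreducible characters\<close>

text \<open>On characters of a finite group this is the usual Hermitian inner product, because the value at
  the inverse is the complex conjugate. In this form it is bilinear, and the orthogonality relations
  follow without a passage to unitary representations.\<close>

definition class_inner :: "('g, 'b) monoid_scheme \<Rightarrow> ('g \<Rightarrow> complex) \<Rightarrow> ('g \<Rightarrow> complex) \<Rightarrow> complex" where
  "class_inner G f h = (\<Sum>g\<in>carrier G. f g * h (inv\<^bsub>G\<^esub> g)) / of_nat (card (carrier G))"

definition unit_mat :: "nat \<Rightarrow> nat \<Rightarrow> nat \<Rightarrow> nat \<Rightarrow> complex mat" where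
  "unit_mat n m i j = mat n m (\<lambda>(a, b). if a = i \<and> b = j then 1 else 0)"

lemma unit_mat_carrier [simp]: "unit_mat n m i j \<in> carrier_mat n m"
  by (simp add: unit_mat_def)

lemma mult_unit_mat_mult:
  assumes A: "A \<in> carrier_mat k n" and B: "B \<in> carrier_mat m l"
    and ij: "i < n" "j < m" and ab: "a < k" "b < l"
  shows "(A * unit_mat n m i j * B) $$ (a, b) = A $$ (a, i) * B $$ (j, b)"
proof -
  have AE: "(A * unit_mat n m i j) $$ (a, c) = (if c = j then A $$ (a, i) else 0)" if "c < m" for c
  proof -
    have "(A * unit_mat n m i j) $$ (a, c) = (\<Sum>e<n. A $$ (a, e) * (if e = i \<and> c = j then 1 else 0))"
      using A ab that by (simp add: scalar_prod_def unit_mat_def lessThan_atLeast0)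
    also have "\<dots> = (\<Sum>e<n. if e = i then (if c = j then A $$ (a, e) else 0) else 0)"
      by (rule sum.cong) auto
    also have "\<dots> = (if c = j then A $$ (a, i) else 0)" using ij by simp
    finally show ?thesis .
  qed
  have "(A * unit_mat n m i j * B) $$ (a, b) = (\<Sum>c<m. (A * unit_mat n m i j) $$ (a, c) * B $$ (c, b))"
    using A B ab by (simp add: scalar_prod_def lessThan_atLeast0 unit_mat_def del: index_mult_mat(1))
      (simp add: scalar_prod_def lessThan_atLeast0)
  also have "\<dots> = (\<Sum>c<m. if c = j then A $$ (a, i) * B $$ (c, b) else 0)"
    by (rule sum.cong) (auto simp: AE)
  also have "\<dots> = A $$ (a, i) * B $$ (j, b)" using ij by simp
  finally show ?thesis .
qed

text \<open>Averaging an arbitrary matrix over the group produces the intertwining matrices to which Schur's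
  lemma is applied.\<close>

lemma (in group) schur_average_intertwines:
  assumes rep: "is_rep G (d, \<rho>)" "is_rep G (d', \<rho>')" and E: "E \<in> carrier_mat d' d"
    and g: "g \<in> carrier G"
  defines "S \<equiv> sum_mat d' d (\<lambda>h. \<rho>' h * E * \<rho> (inv h)) (carrier G)"
  shows "S * \<rho> g = \<rho>' g * S"
proof -
  have c: "\<rho> x \<in> carrier_mat d d" "\<rho>' x \<in> carrier_mat d' d'" if "x \<in> carrier G" for x
    using rep that by (auto simp: is_rep_iff)
  have ci: "\<rho> (inv x) \<in> carrier_mat d d" if "x \<in> carrier G" for x using c(1) that by simp
  have t: "\<rho>' h * E * \<rho> (inv h) \<in> carrier_mat d' d" if "h \<in> carrier G" for h
    using mult_carrier_mat[OF mult_carrier_mat[OF c(2)[OF that] E] ci[OF that]] .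
  have "S * \<rho> g = sum_mat d' d (\<lambda>h. \<rho>' h * E * \<rho> (inv h) * \<rho> g) (carrier G)"
    unfolding S_def by (rule sum_mat_mult[OF c(1)[OF g] t])
  also have "\<dots> = sum_mat d' d (\<lambda>h. \<rho>' (g \<otimes> h) * E * \<rho> (inv (g \<otimes> h)) * \<rho> g) (carrier G)"
    by (rule sum_mat_translate[OF g, symmetric])
  also have "\<dots> = sum_mat d' d (\<lambda>h. \<rho>' g * (\<rho>' h * E * \<rho> (inv h))) (carrier G)"
  proof (rule sum_mat_cong)
    fix h assume h: "h \<in> carrier G"
    note cc = c[OF g] c[OF h] ci[OF g] ci[OF h] c[OF m_closed[OF g h]] ci[OF m_closed[OF g h]]
    have "\<rho> (inv (g \<otimes> h)) * \<rho> g = \<rho> (inv (g \<otimes> h) \<otimes> g)"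
      using rep(1) g h by (simp add: is_rep_iff)
    also have "inv (g \<otimes> h) \<otimes> g = inv h" using g h by (simp add: inv_mult_group m_assoc)
    finally have right: "\<rho> (inv (g \<otimes> h)) * \<rho> g = \<rho> (inv h)" .
    have left: "\<rho>' (g \<otimes> h) * E = \<rho>' g * (\<rho>' h * E)"
      using rep(2) g h assoc_mult_mat[OF cc(2,4) E] by (simp add: is_rep_iff)
    have "\<rho>' (g \<otimes> h) * E * \<rho> (inv (g \<otimes> h)) * \<rho> g = \<rho>' (g \<otimes> h) * E * (\<rho> (inv (g \<otimes> h)) * \<rho> g)"
      by (rule assoc_mult_mat[OF mult_carrier_mat[OF cc(8) E] cc(9) cc(1)])
    also have "\<dots> = \<rho>' g * (\<rho>' h * E * \<rho> (inv h))"
      unfolding right left by (rule assoc_mult_mat[OF cc(2) mult_carrier_mat[OF cc(4) E] cc(6)])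
    finally show "\<rho>' (g \<otimes> h) * E * \<rho> (inv (g \<otimes> h)) * \<rho> g = \<rho>' g * (\<rho>' h * E * \<rho> (inv h))" .
  qed
  also have "\<dots> = \<rho>' g * S"
    unfolding S_def by (rule mult_sum_mat[OF c(2)[OF g] t, symmetric])
  finally show ?thesis .
qed

text \<open>The entry at \<open>(i, j)\<close> of the average of the matrix unit at \<open>(i, j)\<close> is the sum over the group of
  products of the diagonal coefficients with indices \<open>i\<close> and \<open>j\<close>. Summation over \<open>i\<close> and \<open>j\<close>
  turns these coefficients into traces.\<close>

lemma (in group) trace_products_as_averages:
  assumes rep: "is_rep G (d, \<rho>)" "is_rep G (d', \<rho>')"
  shows "(\<Sum>h\<in>carrier G. trace_mat (\<rho>' h) * trace_mat (\<rho> (inv h))) =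
     (\<Sum>i<d'. \<Sum>j<d. sum_mat d' d (\<lambda>h. \<rho>' h * unit_mat d' d i j * \<rho> (inv h)) (carrier G) $$ (i, j))"
proof -
  have c: "\<rho> (inv x) \<in> carrier_mat d d" "\<rho>' x \<in> carrier_mat d' d'" if "x \<in> carrier G" for x
    using rep that by (auto simp: is_rep_iff)
  have "(\<Sum>h\<in>carrier G. trace_mat (\<rho>' h) * trace_mat (\<rho> (inv h))) =
      (\<Sum>h\<in>carrier G. \<Sum>i<d'. \<Sum>j<d. \<rho>' h $$ (i, i) * \<rho> (inv h) $$ (j, j))"
  proof (rule sum.cong[OF refl])
    fix h assume "h \<in> carrier G"
    from c[OF this] show "trace_mat (\<rho>' h) * trace_mat (\<rho> (inv h)) = (\<Sum>i<d'. \<Sum>j<d. \<rho>' h $$ (i, i) * \<rho> (inv h) $$ (j, j))"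
      by (simp add: trace_mat_def sum_product)
  qed
  also have "\<dots> = (\<Sum>i<d'. \<Sum>j<d. \<Sum>h\<in>carrier G. \<rho>' h $$ (i, i) * \<rho> (inv h) $$ (j, j))"
    by (subst sum.swap, subst (2) sum.swap) rule
  also have "\<dots> = (\<Sum>i<d'. \<Sum>j<d. sum_mat d' d (\<lambda>h. \<rho>' h * unit_mat d' d i j * \<rho> (inv h)) (carrier G) $$ (i, j))"
  proof (intro sum.cong refl)
    fix i j assume ij: "i \<in> {..<d'}" "j \<in> {..<d}"
    have "(\<rho>' h * unit_mat d' d i j * \<rho> (inv h)) $$ (i, j) = \<rho>' h $$ (i, i) * \<rho> (inv h) $$ (j, j)"
      if "h \<in> carrier G" for h
      by (rule mult_unit_mat_mult) (use c[OF that] ij in auto)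
    then show "(\<Sum>h\<in>carrier G. \<rho>' h $$ (i, i) * \<rho> (inv h) $$ (j, j)) =
        sum_mat d' d (\<lambda>h. \<rho>' h * unit_mat d' d i j * \<rho> (inv h)) (carrier G) $$ (i, j)"
      using ij by (simp add: sum_mat_def)
  qed
  finally show ?thesis .
qed

lemma (in group) trace_orthogonal:
  assumes irr: "irreducible_rep G (d, \<rho>)" "irreducible_rep G (d', \<rho>')"
    and "\<not> equiv_rep G (d, \<rho>) (d', \<rho>')"
  shows "(\<Sum>h\<in>carrier G. trace_mat (\<rho>' h) * trace_mat (\<rho> (inv h))) = 0"
proof -
  have rep: "is_rep G (d, \<rho>)" "is_rep G (d', \<rho>')" using irr by (auto simp: irreducible_rep_def)
  have "sum_mat d' d (\<lambda>h. \<rho>' h * unit_mat d' d i j * \<rho> (inv h)) (carrier G) = 0\<^sub>m d' d" for i j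
    using schur[OF irr sum_mat_carrier schur_average_intertwines[OF rep unit_mat_carrier]] assms(3) by blast
  then show ?thesis unfolding trace_products_as_averages[OF rep] by simp
qed

text \<open>Now the averages are scalar matrices, and the scalar is found by taking the trace: the average of
  the matrix unit at \<open>(i, j)\<close> has trace \<open>0\<close> for distinct indices and the group order for equal ones.\<close>

lemma (in group) trace_norm:
  assumes irr: "irreducible_rep G (d, \<rho>)"
  shows "(\<Sum>h\<in>carrier G. trace_mat (\<rho> h) * trace_mat (\<rho> (inv h))) = of_nat (card (carrier G))"
proof -
  have rep: "is_rep G (d, \<rho>)" and d: "d > 0" using irr by (auto simp: irreducible_rep_def)
  have c: "\<rho> x \<in> carrier_mat d d" "\<rho> (inv x) \<in> carrier_mat d d" if "x \<in> carrier G" for x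
    using rep that by (auto simp: is_rep_iff)
  define S where "S i j = sum_mat d d (\<lambda>h. \<rho> h * unit_mat d d i j * \<rho> (inv h)) (carrier G)" for i j
  have S: "S i j $$ (i, j) = (if i = j then of_nat (card (carrier G)) / of_nat d else 0)"
    if ij: "i < d" "j < d" for i j
  proof -
    have "\<exists>a. S i j = a \<cdot>\<^sub>m 1\<^sub>m d"
      using schur_scalar[OF irr sum_mat_carrier schur_average_intertwines[OF rep rep unit_mat_carrier]]
      unfolding S_def by blast
    then obtain a where a: "S i j = a \<cdot>\<^sub>m 1\<^sub>m d" by blast
    have "a * of_nat d = trace_mat (S i j)" unfolding a by (simp add: trace_mat_def)
    also have "\<dots> = (\<Sum>b<d. \<Sum>h\<in>carrier G. (\<rho> h * unit_mat d d i j * \<rho> (inv h)) $$ (b, b))"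
      unfolding S_def by (simp add: trace_mat_def sum_mat_def)
    also have "\<dots> = (\<Sum>b<d. \<Sum>h\<in>carrier G. \<rho> (inv h) $$ (j, b) * \<rho> h $$ (b, i))"
      by (intro sum.cong refl, subst mult_unit_mat_mult[of _ d d _ d d]) (use c ij in \<open>auto simp: mult.commute\<close>)
    also have "\<dots> = (\<Sum>h\<in>carrier G. \<Sum>b<d. \<rho> (inv h) $$ (j, b) * \<rho> h $$ (b, i))"
      by (rule sum.swap)
    also have "\<dots> = (\<Sum>h\<in>carrier G. 1\<^sub>m d $$ (j, i))"
    proof (rule sum.cong[OF refl])
      fix h assume h: "h \<in> carrier G"
      have "(\<Sum>b<d. \<rho> (inv h) $$ (j, b) * \<rho> h $$ (b, i)) = (\<rho> (inv h) * \<rho> h) $$ (j, i)"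
        using c[OF h] ij by (simp add: scalar_prod_def lessThan_atLeast0)
      also have "\<rho> (inv h) * \<rho> h = \<rho> (inv h \<otimes> h)"
        using rep h unfolding is_rep_iff by (metis inv_closed)
      also have "\<dots> = 1\<^sub>m d" using rep h by (simp add: is_rep_iff)
      finally show "(\<Sum>b<d. \<rho> (inv h) $$ (j, b) * \<rho> h $$ (b, i)) = 1\<^sub>m d $$ (j, i)" .
    qed
    finally have "a * of_nat d = (if i = j then of_nat (card (carrier G)) else 0)"
      using ij by simp
    then have "a = (if i = j then of_nat (card (carrier G)) else 0) / of_nat d"
      using d by (simp add: field_simps)
    then show ?thesis using a ij by simp
  qed
  have "(\<Sum>h\<in>carrier G. trace_mat (\<rho> h) * trace_mat (\<rho> (inv h))) = (\<Sum>i<d. \<Sum>j<d. S i j $$ (i, j))"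
    unfolding S_def by (rule trace_products_as_averages[OF rep rep])
  also have "\<dots> = (\<Sum>i<d. \<Sum>j<d. if i = j then of_nat (card (carrier G)) / of_nat d else 0)"
    by (intro sum.cong refl) (simp add: S)
  also have "\<dots> = of_nat (card (carrier G))" using d by simp
  finally show ?thesis .
qed

definition char_degree :: "('g, 'b) monoid_scheme \<Rightarrow> ('g \<Rightarrow> complex) \<Rightarrow> nat" where
  "char_degree G x = fst (rep_of_char G x)"

lemma rep_of_char:
  assumes "x \<in> irr_chars G"
  shows "irreducible_rep G (rep_of_char G x)" "ch G (rep_of_char G x) = x"
proof -
  have "\<exists>\<pi>. irreducible_rep G \<pi> \<and> ch G \<pi> = x" using assms by (auto simp: irr_chars_def)
  from someI_ex[OF this] show "irreducible_rep G (rep_of_char G x)" "ch G (rep_of_char G x) = x"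
    unfolding rep_of_char_def by auto
qed

lemma char_degree_pos: "x \<in> irr_chars G \<Longrightarrow> char_degree G x > 0"
  using rep_of_char(1)[of x G] by (cases "rep_of_char G x") (auto simp: char_degree_def irreducible_rep_def)

lemma ch_in_irr_chars: "irreducible_rep G \<pi> \<Longrightarrow> ch G \<pi> \<in> irr_chars G"
  unfolding irr_chars_def by blast

lemma ch_apply: "g \<in> carrier G \<Longrightarrow> ch G (d, \<rho>) g = trace_mat (\<rho> g) / of_nat d"
  by (simp add: ch_def)

lemma (in group) ch_equiv_rep:
  assumes "equiv_rep G (d, \<rho>) (d', \<rho>')" "is_rep G (d, \<rho>)" "is_rep G (d', \<rho>')"
  shows "ch G (d, \<rho>) = ch G (d', \<rho>')"
proof -
  have "d' = d" using assms(1) by (auto simp: equiv_rep_def)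
  then show ?thesis
    using assms trace_equiv_rep[OF assms(1)] by (auto simp: ch_def is_rep_iff intro!: restrict_ext)
qed

lemma (in group) irr_char_inner:
  assumes "irreducible_rep G (d, \<rho>)" "irreducible_rep G (d', \<rho>')" "finite (carrier G)"
  shows "class_inner G (ch G (d', \<rho>')) (ch G (d, \<rho>)) =
     (if equiv_rep G (d, \<rho>) (d', \<rho>') then 1 / of_nat d ^ 2 else 0)"
proof -
  have rep: "is_rep G (d, \<rho>)" "is_rep G (d', \<rho>')" and d: "d > 0"
    using assms by (auto simp: irreducible_rep_def)
  have N: "of_nat (card (carrier G)) \<noteq> (0 :: complex)" using assms(3) one_closed by auto
  have "class_inner G (ch G (d', \<rho>')) (ch G (d, \<rho>)) =
    (\<Sum>h\<in>carrier G. trace_mat (\<rho>' h) * trace_mat (\<rho> (inv h))) / (of_nat d' * of_nat d * of_nat (card (carrier G)))"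
    by (simp add: class_inner_def ch_apply flip: sum_divide_distrib)
  also have "\<dots> = (if equiv_rep G (d, \<rho>) (d', \<rho>') then 1 / of_nat d ^ 2 else 0)"
  proof (cases "equiv_rep G (d, \<rho>) (d', \<rho>')")
    case True
    then have [simp]: "d' = d" by (auto simp: equiv_rep_def)
    have "(\<Sum>h\<in>carrier G. trace_mat (\<rho>' h) * trace_mat (\<rho> (inv h))) =
        (\<Sum>h\<in>carrier G. trace_mat (\<rho> h) * trace_mat (\<rho> (inv h)))"
      using trace_equiv_rep[OF True] rep by (simp add: is_rep_iff)
    then show ?thesis using True trace_norm[OF assms(1)] N by (simp add: power2_eq_square)
  next
    case False
    then show ?thesis using trace_orthogonal[OF assms(1,2)] by simp
  qed
  finally show ?thesis .
qed

text \<open>The norm is not \<open>1\<close> but the inverse square of the degree, since characters are normalized. As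
  this is nonzero and inequivalent representations have orthogonal characters, the normalized
  character determines the equivalence class, and with it the degree.\<close>

lemma (in group) irr_chars_orthogonal:
  assumes x: "x \<in> irr_chars G" and y: "y \<in> irr_chars G" and fin: "finite (carrier G)"
  shows "class_inner G x y = (if x = y then 1 / of_nat (char_degree G y) ^ 2 else 0)"
proof -
  obtain d \<rho> where r: "rep_of_char G y = (d, \<rho>)" by fastforce
  obtain d' \<rho>' where r': "rep_of_char G x = (d', \<rho>')" by fastforce
  have irr: "irreducible_rep G (d, \<rho>)" "irreducible_rep G (d', \<rho>')"
    and ch: "ch G (d, \<rho>) = y" "ch G (d', \<rho>') = x"
    using rep_of_char[OF x] rep_of_char[OF y] r r' by auto
  have rep: "is_rep G (d, \<rho>)" "is_rep G (d', \<rho>')" and d: "d > 0"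
    using irr by (auto simp: irreducible_rep_def)
  have e: "equiv_rep G (d, \<rho>) (d, \<rho>)"
    by (rule equiv_rep_refl) (use rep in \<open>simp add: is_rep_iff\<close>)
  have in1: "class_inner G x y = (if equiv_rep G (d, \<rho>) (d', \<rho>') then 1 / of_nat d ^ 2 else 0)"
    using irr_char_inner[OF irr fin] ch by simp
  have in2: "class_inner G y y = 1 / of_nat d ^ 2"
    using irr_char_inner[OF irr(1) irr(1) fin] ch e by simp
  have "equiv_rep G (d, \<rho>) (d', \<rho>') \<longleftrightarrow> x = y"
    using ch_equiv_rep[OF _ rep] ch in1 in2 d by (auto split: if_splits)
  then show ?thesis using in1 r by (simp add: char_degree_def)
qed

lemma (in group) decomposition:
  assumes fin: "finite (carrier G)" and rep: "is_rep G \<sigma>"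
  shows "\<rho> \<in> set (decomposition G \<sigma>) \<Longrightarrow> irreducible_rep G \<rho>"
    and "equiv_rep G \<sigma> (direct_sum_rep (decomposition G \<sigma>))"
proof -
  have "\<exists>\<sigma>s. (\<forall>\<rho>\<in>set \<sigma>s. irreducible_rep G \<rho>) \<and> equiv_rep G \<sigma> (direct_sum_rep \<sigma>s)"
    using decomposition_exists[OF fin, of "fst \<sigma>" "snd \<sigma>"] rep by simp
  from someI_ex[OF this]
  show "\<rho> \<in> set (decomposition G \<sigma>) \<Longrightarrow> irreducible_rep G \<rho>"
    and "equiv_rep G \<sigma> (direct_sum_rep (decomposition G \<sigma>))"
    unfolding decomposition_def by auto
qed

lemma (in group) ch_decomposition:
  assumes fin: "finite (carrier G)" and rep: "is_rep G \<sigma>" and g: "g \<in> carrier G"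
  shows "ch G \<sigma> g = (\<Sum>\<rho>\<leftarrow>decomposition G \<sigma>. of_nat (fst \<rho>) / of_nat (fst \<sigma>) * ch G \<rho> g)"
proof -
  obtain d \<rho> where \<sigma>: "\<sigma> = (d, \<rho>)" by fastforce
  let ?ds = "decomposition G \<sigma>"
  have irr: "irreducible_rep G \<tau>" if "\<tau> \<in> set ?ds" for \<tau> using decomposition(1)[OF fin rep that] .
  have c: "snd \<tau> g \<in> carrier_mat (fst \<tau>) (fst \<tau>)" if "\<tau> \<in> set ?ds" for \<tau>
    using irr[OF that] g by (cases \<tau>) (auto simp: irreducible_rep_def is_rep_iff)
  have "trace_mat (\<rho> g) = trace_mat (snd (direct_sum_rep ?ds) g)"
    using trace_equiv_rep[of G d \<rho> "fst (direct_sum_rep ?ds)" "snd (direct_sum_rep ?ds)" g]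
      decomposition(2)[OF fin rep] direct_sum_carrier[of ?ds g, OF c] g rep
    by (simp add: \<sigma> is_rep_iff)
  also have "\<dots> = (\<Sum>\<tau>\<leftarrow>?ds. trace_mat (snd \<tau> g))" by (rule trace_direct_sum[OF c])
  also have "\<dots> = (\<Sum>\<tau>\<leftarrow>?ds. of_nat (fst \<tau>) * ch G \<tau> g)"
  proof (intro arg_cong[of _ _ sum_list] map_cong refl)
    fix \<tau> assume "\<tau> \<in> set ?ds"
    then show "trace_mat (snd \<tau> g) = of_nat (fst \<tau>) * ch G \<tau> g"
      using irr[of \<tau>] g by (cases \<tau>) (auto simp: ch_apply irreducible_rep_def)
  qed
  finally have "trace_mat (\<rho> g) / of_nat d = (\<Sum>\<tau>\<leftarrow>?ds. of_nat (fst \<tau>) / of_nat d * ch G \<tau> g)"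
    by (simp add: divide_inverse sum_list_const_mult[symmetric] mult.assoc mult.left_commute mult.commute)
  then show ?thesis using g by (simp add: \<sigma> ch_apply)
qed

section \<open>Tensor products, restriction and induction\<close>

text \<open>Rows and columns of Kronecker products and of induced representations are indexed by pairs, encoded
  by quotient and remainder.\<close>

lemma sum_div_mod:
  fixes f :: "nat \<Rightarrow> nat \<Rightarrow> complex"
  shows "(\<Sum>k<n * m. f (k div m) (k mod m)) = (\<Sum>a<n. \<Sum>b<m. f a b)"
proof (cases "m = 0")
  case False
  have "(\<Sum>k<n * m. f (k div m) (k mod m)) = (\<Sum>(a, b)\<in>{..<n} \<times> {..<m}. f a b)"
  proof (rule sum.reindex_bij_witness[where i = "\<lambda>(a, b). a * m + b" and j = "\<lambda>k. (k div m, k mod m)"])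
    fix ab assume "ab \<in> {..<n} \<times> {..<m}"
    then obtain a b where ab: "ab = (a, b)" "a < n" "b < m" by auto
    then have "a * m + b < Suc a * m" by simp
    also have "\<dots> \<le> n * m" using ab by (intro mult_right_mono) auto
    finally show "(case ab of (a, b) \<Rightarrow> a * m + b) \<in> {..<n * m}" using ab by simp
  qed (use False in \<open>auto simp: less_mult_imp_div_less\<close>)
  then show ?thesis by (simp add: sum.cartesian_product)
qed simp

lemma div_mod_eq_iff: "a div m = b div m \<and> a mod m = b mod m \<longleftrightarrow> a = (b :: nat)"
  by (metis div_mult_mod_eq)

lemma kronecker_carrier:
  "A \<in> carrier_mat n n \<Longrightarrow> B \<in> carrier_mat m m \<Longrightarrow> kronecker A B \<in> carrier_mat (n * m) (n * m)"
  by (auto simp: kronecker_def)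

lemma mod_lt_of_lt_mult: "a < n * m \<Longrightarrow> a mod m < (m :: nat)"
  by (cases "m = 0") auto

lemma kronecker_mult:
  assumes "A \<in> carrier_mat n n" "A' \<in> carrier_mat n n" "B \<in> carrier_mat m m" "B' \<in> carrier_mat m m"
  shows "kronecker A B * kronecker A' B' = kronecker (A * A') (B * B')"
proof (rule eq_matI)
  fix i j assume "i < dim_row (kronecker (A * A') (B * B'))" "j < dim_col (kronecker (A * A') (B * B'))"
  then have ij: "i < n * m" "j < n * m" using assms by (auto simp: kronecker_def)
  note lt = ij[THEN less_mult_imp_div_less] ij[THEN mod_lt_of_lt_mult]
  have "(kronecker A B * kronecker A' B') $$ (i, j) =
      (\<Sum>k<n * m. A $$ (i div m, k div m) * B $$ (i mod m, k mod m) * (A' $$ (k div m, j div m) * B' $$ (k mod m, j mod m)))"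
    using ij assms by (simp add: scalar_prod_def lessThan_atLeast0 kronecker_def)
  also have "\<dots> = (\<Sum>a<n. \<Sum>b<m. A $$ (i div m, a) * B $$ (i mod m, b) * (A' $$ (a, j div m) * B' $$ (b, j mod m)))"
    by (rule sum_div_mod)
  also have "\<dots> = (\<Sum>a<n. A $$ (i div m, a) * A' $$ (a, j div m)) * (\<Sum>b<m. B $$ (i mod m, b) * B' $$ (b, j mod m))"
    by (simp add: sum_product mult_ac)
  also have "\<dots> = kronecker (A * A') (B * B') $$ (i, j)"
    using ij lt assms by (simp add: kronecker_def scalar_prod_def lessThan_atLeast0)
  finally show "(kronecker A B * kronecker A' B') $$ (i, j) = kronecker (A * A') (B * B') $$ (i, j)" .
qed (use assms in \<open>auto simp: kronecker_def\<close>)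

lemma kronecker_one: "kronecker (1\<^sub>m n) (1\<^sub>m m) = 1\<^sub>m (n * m)"
proof (rule eq_matI)
  fix i j assume "i < dim_row (1\<^sub>m (n * m) :: complex mat)" "j < dim_col (1\<^sub>m (n * m) :: complex mat)"
  then have ij: "i < n * m" "j < n * m" by auto
  note lt = ij[THEN less_mult_imp_div_less] ij[THEN mod_lt_of_lt_mult]
  show "kronecker (1\<^sub>m n) (1\<^sub>m m) $$ (i, j) = 1\<^sub>m (n * m) $$ (i, j)"
    using ij lt div_mod_eq_iff[of i m j] by (auto simp: kronecker_def)
qed (auto simp: kronecker_def)

lemma trace_kronecker:
  assumes "A \<in> carrier_mat n n" "B \<in> carrier_mat m m"
  shows "trace_mat (kronecker A B) = trace_mat A * trace_mat B"
proof -
  have "trace_mat (kronecker A B) = (\<Sum>k<n * m. A $$ (k div m, k div m) * B $$ (k mod m, k mod m))"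
    using assms by (simp add: trace_mat_def kronecker_def)
  also have "\<dots> = (\<Sum>a<n. \<Sum>b<m. A $$ (a, a) * B $$ (b, b))" by (rule sum_div_mod)
  finally show ?thesis using assms by (simp add: trace_mat_def sum_product)
qed

lemma fst_tensor_rep [simp]: "fst (tensor_rep \<sigma> \<tau>) = fst \<sigma> * fst \<tau>"
  by (cases \<sigma>; cases \<tau>) (simp add: tensor_rep_def)

lemma (in group) tensor_rep_is_rep:
  assumes "is_rep G \<sigma>" "is_rep G \<tau>"
  shows "is_rep G (tensor_rep \<sigma> \<tau>)"
proof -
  obtain d \<rho> d' \<rho>' where [simp]: "\<sigma> = (d, \<rho>)" "\<tau> = (d', \<rho>')" by fastforce
  have r: "is_rep G (d, \<rho>)" "is_rep G (d', \<rho>')" using assms by simp_all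
  have c: "\<rho> g \<in> carrier_mat d d" "\<rho>' g \<in> carrier_mat d' d'" if "g \<in> carrier G" for g
    using r that by (simp_all add: is_rep_iff)
  have "kronecker (\<rho> (g \<otimes> h)) (\<rho>' (g \<otimes> h)) = kronecker (\<rho> g) (\<rho>' g) * kronecker (\<rho> h) (\<rho>' h)"
    if "g \<in> carrier G" "h \<in> carrier G" for g h
    using kronecker_mult[OF c(1)[OF that(1)] c(1)[OF that(2)] c(2)[OF that(1)] c(2)[OF that(2)]] r that
    by (simp add: is_rep_iff)
  then show ?thesis
    using r by (auto simp: tensor_rep_def is_rep_iff kronecker_one intro: kronecker_carrier)
qed

lemma (in group) ch_tensor_rep:
  assumes "is_rep G \<sigma>" "is_rep G \<tau>" "g \<in> carrier G"
  shows "ch G (tensor_rep \<sigma> \<tau>) g = ch G \<sigma> g * ch G \<tau> g"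
proof -
  obtain d \<rho> d' \<rho>' where [simp]: "\<sigma> = (d, \<rho>)" "\<tau> = (d', \<rho>')" by fastforce
  have "\<rho> g \<in> carrier_mat d d" "\<rho>' g \<in> carrier_mat d' d'"
    using assms by (simp_all add: is_rep_iff)
  then show ?thesis using assms(3) by (simp add: tensor_rep_def ch_apply trace_kronecker)
qed

lemma (in group) restricted_rep:
  assumes "subgroup H G" "is_rep G \<sigma>"
  shows "is_rep (G\<lparr>carrier := H\<rparr>) \<sigma>"
proof -
  interpret H: group "G\<lparr>carrier := H\<rparr>" using assms(1) group_axioms by (rule subgroup.subgroup_is_group)
  obtain d \<rho> where [simp]: "\<sigma> = (d, \<rho>)" by fastforce
  show ?thesis using assms subgroup.mem_carrier[OF assms(1)] by (auto simp: is_rep_iff H.is_rep_iff)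
qed

lemma ch_restricted:
  assumes "h \<in> H" "H \<subseteq> carrier G"
  shows "ch (G\<lparr>carrier := H\<rparr>) \<sigma> h = ch G \<sigma> h"
  using assms by (cases \<sigma>) (auto simp: ch_def)

lemma (in group) ch_one:
  assumes "is_rep G \<sigma>" "fst \<sigma> > 0"
  shows "ch G \<sigma> \<one> = 1"
  using assms by (cases \<sigma>) (simp add: is_rep_iff ch_apply)

lemma (in group) ch_conjugate:
  assumes rep: "is_rep G \<sigma>" and gs: "g \<in> carrier G" "s \<in> carrier G"
  shows "ch G \<sigma> (inv s \<otimes> g \<otimes> s) = ch G \<sigma> g"
proof -
  obtain d \<rho> where [simp]: "\<sigma> = (d, \<rho>)" by fastforce
  have r: "is_rep G (d, \<rho>)" using rep by simp
  have c: "\<rho> g \<in> carrier_mat d d" if "g \<in> carrier G" for g using r that by (simp add: is_rep_iff)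
  have "trace_mat (\<rho> (inv s \<otimes> g \<otimes> s)) = trace_mat (\<rho> (inv s \<otimes> g) * \<rho> s)"
    using r gs unfolding is_rep_iff by (metis inv_closed m_closed)
  also have "\<dots> = trace_mat (\<rho> s * \<rho> (inv s \<otimes> g))"
    by (rule trace_mat_comm[of _ d d]) (use c gs in auto)
  also have "\<rho> s * \<rho> (inv s \<otimes> g) = \<rho> (s \<otimes> (inv s \<otimes> g))"
    using r gs unfolding is_rep_iff by (metis inv_closed m_closed)
  also have "s \<otimes> (inv s \<otimes> g) = g" using gs by (simp flip: m_assoc)
  finally show ?thesis using gs by (simp add: ch_apply)
qed

text \<open>For a class function \<open>f\<close> on \<open>H\<close> this is induction, normalized so that the normalized character of a
  representation goes to the normalized character of the induced representation. The sum runs over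
  the whole group instead of a transversal, which makes it independent of choices.\<close>

definition induced_function :: "('g, 'b) monoid_scheme \<Rightarrow> 'g set \<Rightarrow> ('g \<Rightarrow> complex) \<Rightarrow> 'g \<Rightarrow> complex" where
  "induced_function G H f g =
     (\<Sum>s\<in>carrier G. if inv\<^bsub>G\<^esub> s \<otimes>\<^bsub>G\<^esub> g \<otimes>\<^bsub>G\<^esub> s \<in> H then f (inv\<^bsub>G\<^esub> s \<otimes>\<^bsub>G\<^esub> g \<otimes>\<^bsub>G\<^esub> s) else 0) /
     of_nat (card (carrier G))"

lemma (in group) left_transversal:
  assumes fin: "finite (carrier G)" and H: "subgroup H G"
  defines "ts \<equiv> left_transversal G H"
  shows "set ts \<subseteq> carrier G" and "bij_betw (\<lambda>i. (ts ! i) <# H) {..<length ts} (lcosets H)"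
proof -
  have "lcosets H = (\<lambda>a. a <# H) ` carrier G" by (auto simp: LCOSETS_def)
  then have "finite (lcosets H)" using fin by simp
  then obtain cs where cs: "set cs = lcosets H" "distinct cs" using finite_distinct_list by blast
  have "\<forall>C\<in>set cs. \<exists>a. a \<in> carrier G \<and> a <# H = C" using cs by (auto simp: LCOSETS_def)
  then obtain f where f: "\<And>C. C \<in> set cs \<Longrightarrow> f C \<in> carrier G \<and> f C <# H = C" by metis
  have "bij_betw (\<lambda>i. (map f cs ! i) <# H) {..<length (map f cs)} (lcosets H)"
  proof -
    have "bij_betw ((!) cs) {..<length cs} (lcosets H)" using bij_betw_nth[OF cs(2)] cs(1) by simp
    moreover have "(map f cs ! i) <# H = cs ! i" if "i \<in> {..<length cs}" for i using f that by simp
    ultimately show ?thesis by (subst bij_betw_cong[where g = "(!) cs"]) auto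
  qed
  moreover have "set (map f cs) \<subseteq> carrier G" using f by auto
  ultimately have "\<exists>ts. set ts \<subseteq> carrier G \<and> bij_betw (\<lambda>i. (ts ! i) <# H) {..<length ts} (lcosets H)"
    by blast
  from someI_ex[OF this] show "set ts \<subseteq> carrier G" "bij_betw (\<lambda>i. (ts ! i) <# H) {..<length ts} (lcosets H)"
    unfolding ts_def left_transversal_def by auto
qed

lemma (in group) transversal_unique_index:
  assumes fin: "finite (carrier G)" and H: "subgroup H G" and g: "g \<in> carrier G"
  defines "ts \<equiv> left_transversal G H"
  shows "\<exists>!i. i < length ts \<and> inv (ts ! i) \<otimes> g \<in> H"
proof -
  note t = left_transversal[OF fin H, folded ts_def]
  have tc: "ts ! i \<in> carrier G" if "i < length ts" for i using t(1) that by auto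
  have iff: "inv (ts ! i) \<otimes> g \<in> H \<longleftrightarrow> (ts ! i) <# H = g <# H" if "i < length ts" for i
    using subgroup.lcos_module_imp[OF H group_axioms tc[OF that], of g]
      subgroup.lcos_module_rev[OF H group_axioms tc[OF that] g]
      l_repr_independence[OF _ tc[OF that] H, of g] lcos_self[OF g H] by metis
  have "g <# H \<in> lcosets H" using g by (auto simp: LCOSETS_def)
  then have "\<exists>!i. i \<in> {..<length ts} \<and> (ts ! i) <# H = g <# H"
    using t(2) unfolding bij_betw_def inj_on_def by (metis (no_types, lifting) imageE)
  then show ?thesis using iff by auto
qed

lemma (in group) sum_over_cosets:
  fixes F :: "'a \<Rightarrow> complex"
  assumes fin: "finite (carrier G)" and H: "subgroup H G"
  defines "ts \<equiv> left_transversal G H"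
  shows "(\<Sum>s\<in>carrier G. F s) = (\<Sum>i<length ts. \<Sum>h\<in>H. F (ts ! i \<otimes> h))"
proof -
  note t = left_transversal[OF fin H, folded ts_def]
  have tc: "ts ! i \<in> carrier G" if "i < length ts" for i using t(1) that by auto
  have Hc: "h \<in> carrier G" if "h \<in> H" for h using H that by (rule subgroup.mem_carrier)
  define idx where "idx g = (THE i. i < length ts \<and> inv (ts ! i) \<otimes> g \<in> H)" for g
  have idx: "idx g < length ts \<and> inv (ts ! idx g) \<otimes> g \<in> H" if "g \<in> carrier G" for g
    unfolding idx_def ts_def by (rule theI'[OF transversal_unique_index[OF fin H that]])
  have idx_eq: "idx g = i" if "g \<in> carrier G" "i < length ts" "inv (ts ! i) \<otimes> g \<in> H" for g i
    using transversal_unique_index[OF fin H that(1)] idx[OF that(1)] that(2,3) unfolding ts_def by blast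
  have "(\<Sum>s\<in>carrier G. F s) = (\<Sum>(i, h)\<in>{..<length ts} \<times> H. F (ts ! i \<otimes> h))"
  proof (rule sum.reindex_bij_witness[where i = "\<lambda>(i, h). ts ! i \<otimes> h" and j = "\<lambda>g. (idx g, inv (ts ! idx g) \<otimes> g)"])
    fix g assume g: "g \<in> carrier G"
    note i = idx[OF g]
    have "ts ! idx g \<otimes> (inv (ts ! idx g) \<otimes> g) = g"
      using g tc i by (simp flip: m_assoc)
    then show "(case (idx g, inv (ts ! idx g) \<otimes> g) of (i, h) \<Rightarrow> ts ! i \<otimes> h) = g"
      "(case (idx g, inv (ts ! idx g) \<otimes> g) of (i, h) \<Rightarrow> F (ts ! i \<otimes> h)) = F g" by auto
    show "(idx g, inv (ts ! idx g) \<otimes> g) \<in> {..<length ts} \<times> H" using i by simp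
  next
    fix p assume "p \<in> {..<length ts} \<times> H"
    then obtain i h where p: "p = (i, h)" "i < length ts" "h \<in> H" by auto
    have "inv (ts ! i) \<otimes> (ts ! i \<otimes> h) = h" using tc[OF p(2)] Hc[OF p(3)] by (simp flip: m_assoc)
    moreover from this have "idx (ts ! i \<otimes> h) = i"
      using idx_eq[of "ts ! i \<otimes> h" i] tc[OF p(2)] Hc[OF p(3)] p by simp
    ultimately show "(idx (case p of (i, h) \<Rightarrow> ts ! i \<otimes> h),
        inv (ts ! idx (case p of (i, h) \<Rightarrow> ts ! i \<otimes> h)) \<otimes> (case p of (i, h) \<Rightarrow> ts ! i \<otimes> h)) = p"
      "(case p of (i, h) \<Rightarrow> ts ! i \<otimes> h) \<in> carrier G"
      using p tc[OF p(2)] Hc[OF p(3)] by auto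
  qed
  then show ?thesis by (simp add: sum.cartesian_product)
qed

lemma (in group) transversal_length:
  assumes fin: "finite (carrier G)" and H: "subgroup H G"
  shows "length (left_transversal G H) * card H = card (carrier G)"
proof -
  have "of_nat (card (carrier G)) = (of_nat (length (left_transversal G H) * card H) :: complex)"
    using sum_over_cosets[OF fin H, of "\<lambda>_. 1"] by simp
  then show ?thesis by (simp only: of_nat_eq_iff)
qed

lemma fst_ind_rep: "fst (ind_rep G H \<tau>) = length (left_transversal G H) * fst \<tau>"
  by (cases \<tau>) (simp add: ind_rep_def Let_def)

text \<open>The matrices are block monomial: given \<open>g'\<close> and a block column \<open>j\<close>, the element \<open>g' t\<^sub>j\<close> lies in a
  single coset \<open>t\<^sub>k H\<close>. Hence at most one term contributes to each block of a product, and this term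
  is handled by multiplicativity of \<open>\<rho>\<close>.\<close>

lemma (in group) ind_rep_is_rep:
  assumes fin: "finite (carrier G)" and H: "subgroup H G" and rep: "is_rep (G\<lparr>carrier := H\<rparr>) \<tau>"
  shows "is_rep G (ind_rep G H \<tau>)"
proof -
  interpret H: group "G\<lparr>carrier := H\<rparr>" using H group_axioms by (rule subgroup.subgroup_is_group)
  obtain d \<rho> where \<tau>: "\<tau> = (d, \<rho>)" by fastforce
  define ts where "ts = left_transversal G H"
  define r where "r = length ts"
  note t = left_transversal[OF fin H, folded ts_def]
  have tc: "ts ! i \<in> carrier G" if "i < r" for i using t(1) that by (auto simp: r_def)
  have \<rho>c: "\<rho> h \<in> carrier_mat d d" if "h \<in> H" for h using rep that by (simp add: \<tau> H.is_rep_iff)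
  have \<rho>m: "\<rho> (h \<otimes> h') = \<rho> h * \<rho> h'" if "h \<in> H" "h' \<in> H" for h h'
    using rep that by (simp add: \<tau> H.is_rep_iff)
  have \<rho>1: "\<rho> \<one> = 1\<^sub>m d" using rep by (simp add: \<tau> H.is_rep_iff)
  define q where "q g i j = inv (ts ! i) \<otimes> g \<otimes> (ts ! j)" for g i j
  define M where "M g = mat (r * d) (r * d) (\<lambda>(a, b). if q g (a div d) (b div d) \<in> H
      then \<rho> (q g (a div d) (b div d)) $$ (a mod d, b mod d) else 0)" for g
  have ind: "ind_rep G H \<tau> = (r * d, M)"
    by (auto simp: ind_rep_def \<tau> Let_def ts_def r_def M_def q_def intro!: ext)
  have one: "M \<one> = 1\<^sub>m (r * d)"
  proof (rule eq_matI)
    fix a b assume "a < dim_row (1\<^sub>m (r * d) :: complex mat)" "b < dim_col (1\<^sub>m (r * d) :: complex mat)"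
    then have ab: "a < r * d" "b < r * d" by auto
    note lt = ab[THEN less_mult_imp_div_less] ab[THEN mod_lt_of_lt_mult]
    have q1: "q \<one> i j = inv (ts ! i) \<otimes> ts ! j" if "i < r" for i j using tc[OF that] by (simp add: q_def)
    have "q \<one> i j \<in> H \<longleftrightarrow> i = j" if "i < r" "j < r" for i j
      using transversal_unique_index[OF fin H tc[OF that(2)]] that tc subgroup.one_closed[OF H]
      by (fold ts_def) (metis q1 r_def l_inv)
    then show "M \<one> $$ (a, b) = 1\<^sub>m (r * d) $$ (a, b)"
      using ab lt div_mod_eq_iff[of a d b] \<rho>1 q1 tc by (auto simp: M_def)
  qed (auto simp: M_def)
  have mult: "M (g \<otimes> g') = M g * M g'" if g: "g \<in> carrier G" and g': "g' \<in> carrier G" for g g'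
  proof (rule eq_matI)
    fix a b assume "a < dim_row (M g * M g')" "b < dim_col (M g * M g')"
    then have ab: "a < r * d" "b < r * d" by (auto simp: M_def)
    note lt = ab[THEN less_mult_imp_div_less] ab[THEN mod_lt_of_lt_mult]
    define i where "i = a div d"
    define j where "j = b div d"
    have i: "i < r" and j: "j < r" using lt by (simp_all add: i_def j_def)
    obtain k where k: "k < r" "q g' k j \<in> H" and k_uniq: "\<And>k'. k' < r \<Longrightarrow> q g' k' j \<in> H \<Longrightarrow> k' = k"
    proof -
      have "q g' k j = inv (ts ! k) \<otimes> (g' \<otimes> ts ! j)" if "k < r" for k
        using tc[OF that] tc[OF j] g' by (simp add: q_def m_assoc)
      then have "\<exists>!k. k < r \<and> q g' k j \<in> H"
        using transversal_unique_index[OF fin H m_closed[OF g' tc[OF j]]]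
        unfolding ts_def[symmetric] r_def[symmetric] by (metis (no_types, lifting))
      then show ?thesis using that by blast
    qed
    have qq: "q g i k \<otimes> q g' k j = q (g \<otimes> g') i j"
    proof -
      have "q g i k \<otimes> q g' k j = inv (ts ! i) \<otimes> g \<otimes> (ts ! k \<otimes> inv (ts ! k)) \<otimes> g' \<otimes> ts ! j"
        by (simp only: q_def m_assoc m_closed inv_closed tc[OF i] tc[OF k(1)] tc[OF j] g g')
      also have "\<dots> = q (g \<otimes> g') i j"
        by (simp only: q_def r_inv r_one l_one m_assoc m_closed inv_closed one_closed
            tc[OF i] tc[OF k(1)] tc[OF j] g g')
      finally show ?thesis .
    qed
    have qc: "q g i k \<in> carrier G" "q g' k j \<in> carrier G"
      using tc[OF i] tc[OF k(1)] tc[OF j] g g' by (simp_all add: q_def)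
    have qH: "q (g \<otimes> g') i j \<in> H \<longleftrightarrow> q g i k \<in> H"
    proof
      assume "q (g \<otimes> g') i j \<in> H"
      then have "q (g \<otimes> g') i j \<otimes> inv (q g' k j) \<in> H"
        using k(2) H by (auto intro: subgroup.m_closed subgroup.m_inv_closed)
      then show "q g i k \<in> H" using qc by (simp add: qq[symmetric] m_assoc)
    next
      assume "q g i k \<in> H"
      then show "q (g \<otimes> g') i j \<in> H" using k(2) H by (auto simp: qq[symmetric] intro: subgroup.m_closed)
    qed
    let ?F = "\<lambda>k' e. (if q g i k' \<in> H then \<rho> (q g i k') $$ (a mod d, e) else 0) *
        (if q g' k' j \<in> H then \<rho> (q g' k' j) $$ (e, b mod d) else 0)"
    have "(M g * M g') $$ (a, b) = (\<Sum>c<r * d. ?F (c div d) (c mod d))"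
      using ab by (simp add: M_def scalar_prod_def lessThan_atLeast0 i_def j_def cong: if_cong)
    also have "\<dots> = (\<Sum>k'<r. \<Sum>e<d. ?F k' e)" by (rule sum_div_mod)
    also have "\<dots> = (\<Sum>k'<r. if k' = k then \<Sum>e<d. ?F k' e else 0)"
    proof (rule sum.cong[OF refl])
      fix k' assume "k' \<in> {..<r}"
      then have "q g' k' j \<notin> H" if "k' \<noteq> k" using k_uniq that by blast
      then show "(\<Sum>e<d. ?F k' e) = (if k' = k then \<Sum>e<d. ?F k' e else 0)" by simp
    qed
    also have "\<dots> = (\<Sum>e<d. ?F k e)" using k(1) by simp
    also have "\<dots> = (if q g i k \<in> H then (\<rho> (q g i k) * \<rho> (q g' k j)) $$ (a mod d, b mod d) else 0)"
      using k(2) \<rho>c[of "q g i k"] \<rho>c[OF k(2)] lt by (auto simp: scalar_prod_def lessThan_atLeast0)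
    also have "\<dots> = M (g \<otimes> g') $$ (a, b)"
      using ab qH k(2) \<rho>m[of "q g i k" "q g' k j"] qq by (simp add: M_def flip: i_def j_def)
    finally show "M (g \<otimes> g') $$ (a, b) = (M g * M g') $$ (a, b)" by simp
  qed (auto simp: M_def)
  show ?thesis unfolding ind is_rep_iff using one mult by (auto simp: M_def)
qed

text \<open>The trace is a sum over the transversal. Replacing \<open>t\<^sub>i\<close> by \<open>t\<^sub>i h\<close> with \<open>h\<close> in \<open>H\<close> does not change
  a summand, so averaging over all of \<open>G\<close> gives the same value.\<close>

lemma (in group) ch_ind_rep:
  assumes fin: "finite (carrier G)" and H: "subgroup H G" and rep: "is_rep (G\<lparr>carrier := H\<rparr>) \<tau>"
    and g: "g \<in> carrier G"
  shows "ch G (ind_rep G H \<tau>) g = induced_function G H (ch (G\<lparr>carrier := H\<rparr>) \<tau>) g"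
proof -
  interpret H: group "G\<lparr>carrier := H\<rparr>" using H group_axioms by (rule subgroup.subgroup_is_group)
  obtain d \<rho> where \<tau>: "\<tau> = (d, \<rho>)" by fastforce
  define ts where "ts = left_transversal G H"
  define r where "r = length ts"
  define \<chi> where "\<chi> = ch (G\<lparr>carrier := H\<rparr>) \<tau>"
  note t = left_transversal[OF fin H, folded ts_def]
  have tc: "ts ! i \<in> carrier G" if "i < r" for i using t(1) that by (auto simp: r_def)
  have Hc: "h \<in> carrier G" if "h \<in> H" for h using H that by (rule subgroup.mem_carrier)
  have finH: "finite H" using fin Hc by (metis finite_subset subsetI)
  have card: "r * card H = card (carrier G)" unfolding r_def ts_def by (rule transversal_length[OF fin H])
  define q where "q i = inv (ts ! i) \<otimes> g \<otimes> (ts ! i)" for i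
  let ?F = "\<lambda>s. if inv s \<otimes> g \<otimes> s \<in> H then \<chi> (inv s \<otimes> g \<otimes> s) else 0"
  have F: "?F (ts ! i \<otimes> h) = (if q i \<in> H then \<chi> (q i) else 0)" if i: "i < r" and h: "h \<in> H" for i h
  proof -
    have e: "inv (ts ! i \<otimes> h) \<otimes> g \<otimes> (ts ! i \<otimes> h) = inv h \<otimes> q i \<otimes> h"
      using tc[OF i] Hc[OF h] g by (simp add: q_def inv_mult_group m_assoc)
    have qc: "q i \<in> carrier G" using tc[OF i] g by (simp add: q_def)
    have "inv h \<otimes> q i \<otimes> h \<in> H \<longleftrightarrow> q i \<in> H"
    proof
      assume "inv h \<otimes> q i \<otimes> h \<in> H"
      then have "h \<otimes> (inv h \<otimes> q i \<otimes> h) \<otimes> inv h \<in> H"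
        using h H by (auto intro: subgroup.m_closed subgroup.m_inv_closed)
      also have "h \<otimes> (inv h \<otimes> q i \<otimes> h) \<otimes> inv h = h \<otimes> inv h \<otimes> q i \<otimes> (h \<otimes> inv h)"
        by (simp only: m_assoc m_closed inv_closed Hc[OF h] qc)
      also have "\<dots> = q i" by (simp only: r_inv l_one r_one Hc[OF h] qc)
      finally show "q i \<in> H" .
    qed (use h H in \<open>auto intro: subgroup.m_closed subgroup.m_inv_closed\<close>)
    moreover have "\<chi> (inv h \<otimes> q i \<otimes> h) = \<chi> (q i)" if "q i \<in> H"
      using H.ch_conjugate[OF rep, of "q i" h] that h H by (simp add: \<chi>_def m_inv_consistent)
    ultimately show ?thesis by (simp add: e)
  qed
  have "(\<Sum>s\<in>carrier G. ?F s) = (\<Sum>i<r. \<Sum>h\<in>H. ?F (ts ! i \<otimes> h))"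
    unfolding r_def ts_def by (rule sum_over_cosets[OF fin H])
  also have "\<dots> = (\<Sum>i<r. \<Sum>h\<in>H. if q i \<in> H then \<chi> (q i) else 0)"
    by (intro sum.cong refl) (use F in auto)
  also have "\<dots> = of_nat (card H) * (\<Sum>i<r. if q i \<in> H then \<chi> (q i) else 0)"
    by (simp add: sum_distrib_left)
  finally have ind: "induced_function G H \<chi> g =
      of_nat (card H) * (\<Sum>i<r. if q i \<in> H then \<chi> (q i) else 0) / of_nat (card (carrier G))"
    by (simp add: induced_function_def)
  have "card H \<noteq> 0" using finH subgroup.one_closed[OF H] by auto
  then have ind': "induced_function G H \<chi> g = (\<Sum>i<r. if q i \<in> H then \<chi> (q i) else 0) / of_nat r"
    unfolding ind card[symmetric] by simp
  have "trace_mat (snd (ind_rep G H \<tau>) g) =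
      (\<Sum>a<r * d. if q (a div d) \<in> H then \<rho> (q (a div d)) $$ (a mod d, a mod d) else 0)"
    by (simp add: ind_rep_def \<tau> Let_def trace_mat_def q_def ts_def r_def cong: if_cong)
  also have "\<dots> = (\<Sum>i<r. \<Sum>e<d. if q i \<in> H then \<rho> (q i) $$ (e, e) else 0)"
    by (rule sum_div_mod)
  also have "\<dots> = (\<Sum>i<r. if q i \<in> H then trace_mat (\<rho> (q i)) else 0)"
  proof (intro sum.cong refl)
    fix i
    show "(\<Sum>e<d. if q i \<in> H then \<rho> (q i) $$ (e, e) else 0) = (if q i \<in> H then trace_mat (\<rho> (q i)) else 0)"
      using rep by (auto simp: \<tau> H.is_rep_iff trace_mat_def)
  qed
  finally have "ch G (ind_rep G H \<tau>) g = (\<Sum>i<r. if q i \<in> H then trace_mat (\<rho> (q i)) else 0) / of_nat (r * d)"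
    using g by (simp add: ch_def case_prod_beta fst_ind_rep \<tau> r_def ts_def)
  also have "\<dots> = (\<Sum>i<r. if q i \<in> H then \<chi> (q i) else 0) / of_nat r"
    by (simp add: \<chi>_def \<tau> ch_def sum_divide_distrib if_distrib[of "\<lambda>x. x / y" for y] mult.commute cong: if_cong)
  finally show ?thesis using ind' by (simp add: \<chi>_def)
qed

section \<open>The measure of a representation\<close>

lemma sum_list_group_by:
  fixes F :: "'b \<Rightarrow> complex" and w :: "'a \<Rightarrow> real"
  assumes "finite X" "f ` set xs \<subseteq> X"
  shows "(\<Sum>a\<leftarrow>xs. of_real (w a) * F (f a)) =
     (\<Sum>x\<in>X. of_real (\<Sum>a\<leftarrow>xs. if f a = x then w a else 0) * F x)"
  using assms(2)
proof (induction xs)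
  case (Cons a xs)
  have "(\<Sum>x\<in>X. of_real (\<Sum>a\<leftarrow>a # xs. if f a = x then w a else 0) * F x) =
      (\<Sum>x\<in>X. (if x = f a then of_real (w a) * F x else 0) +
         of_real (\<Sum>a\<leftarrow>xs. if f a = x then w a else 0) * F x)"
    by (intro sum.cong) (auto simp: algebra_simps)
  also have "\<dots> = of_real (w a) * F (f a) + (\<Sum>x\<in>X. of_real (\<Sum>a\<leftarrow>xs. if f a = x then w a else 0) * F x)"
    using Cons.prems assms(1) by (simp add: sum.distrib)
  finally show ?case using Cons by simp
qed simp

lemma class_inner_sum:
  "class_inner G (\<lambda>g. \<Sum>x\<in>X. c x * F x g) h = (\<Sum>x\<in>X. c x * class_inner G (F x) h)"
proof -
  have "(\<Sum>g\<in>carrier G. (\<Sum>x\<in>X. c x * F x g) * h (inv\<^bsub>G\<^esub> g)) =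
      (\<Sum>x\<in>X. c x * (\<Sum>g\<in>carrier G. F x g * h (inv\<^bsub>G\<^esub> g)))"
    unfolding sum_distrib_left sum_distrib_right by (subst sum.swap) (simp add: mult.assoc)
  then have "class_inner G (\<lambda>g. \<Sum>x\<in>X. c x * F x g) h =
      (\<Sum>x\<in>X. c x * (\<Sum>g\<in>carrier G. F x g * h (inv\<^bsub>G\<^esub> g))) / of_nat (card (carrier G))"
    by (simp add: class_inner_def)
  also have "\<dots> = (\<Sum>x\<in>X. c x * (\<Sum>g\<in>carrier G. F x g * h (inv\<^bsub>G\<^esub> g)) / of_nat (card (carrier G)))"
    by (rule sum_divide_distrib)
  finally show ?thesis by (simp add: class_inner_def)
qed

lemma class_inner_cong:
  "(\<And>g. g \<in> carrier G \<Longrightarrow> f g = f' g) \<Longrightarrow> class_inner G f h = class_inner G f' h"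
  by (simp add: class_inner_def)

lemma ch_measure_nonneg: "ch_measure G \<sigma> x \<ge> 0"
  unfolding ch_measure_def by (rule sum_list_nonneg) auto

lemma (in group) ch_measure_support:
  assumes "finite (carrier G)" "is_rep G \<sigma>" "x \<notin> ch G ` set (decomposition G \<sigma>)"
  shows "ch_measure G \<sigma> x = 0"
proof -
  have m: "map (\<lambda>\<rho>. if ch G \<rho> = x then real (fst \<rho>) / real (fst \<sigma>) else 0) (decomposition G \<sigma>) =
      map (\<lambda>_. 0) (decomposition G \<sigma>)"
    using assms by (intro map_cong) auto
  show ?thesis unfolding ch_measure_def m by simp
qed

lemma (in group) ch_measure_expansion:
  assumes fin: "finite (carrier G)" and rep: "is_rep G \<sigma>" and g: "g \<in> carrier G"
    and X: "finite X" "ch G ` set (decomposition G \<sigma>) \<subseteq> X"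
  shows "ch G \<sigma> g = (\<Sum>x\<in>X. of_real (ch_measure G \<sigma> x) * x g)"
proof -
  have "ch G \<sigma> g = (\<Sum>\<rho>\<leftarrow>decomposition G \<sigma>. of_real (real (fst \<rho>) / real (fst \<sigma>)) * ch G \<rho> g)"
    using ch_decomposition[OF fin rep g] by simp
  also have "\<dots> = (\<Sum>x\<in>X. of_real (ch_measure G \<sigma> x) * x g)"
    unfolding ch_measure_def by (rule sum_list_group_by[OF X])
  finally show ?thesis .
qed

text \<open>The regular representation, obtained by induction from the trivial subgroup, has a character that
  vanishes off the unit. Its pairing with an irreducible character is therefore nonzero, so every
  irreducible character occurs among its finitely many constituents.\<close>

theorem (in group) finite_irr_chars:
  assumes fin: "finite (carrier G)"
  shows "finite (irr_chars G)"
proof -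
  have sub: "subgroup {\<one>} G" by (rule triv_subgroup)
  interpret T: group "G\<lparr>carrier := {\<one>}\<rparr>" using sub group_axioms by (rule subgroup.subgroup_is_group)
  \<comment> \<open>the trivial representation of the trivial subgroup, which induces the regular representation\<close>
  define \<tau> where "\<tau> = (1 :: nat, \<lambda>g :: 'a. 1\<^sub>m 1 :: complex mat)"
  have \<tau>: "is_rep (G\<lparr>carrier := {\<one>}\<rparr>) \<tau>" by (simp add: \<tau>_def T.is_rep_iff)
  define \<sigma> where "\<sigma> = ind_rep G {\<one>} \<tau>"
  have \<sigma>: "is_rep G \<sigma>" unfolding \<sigma>_def by (rule ind_rep_is_rep[OF fin sub \<tau>])
  have conj_one: "inv s \<otimes> g \<otimes> s = \<one> \<longleftrightarrow> g = \<one>" if "g \<in> carrier G" "s \<in> carrier G" for g s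
  proof
    assume e: "inv s \<otimes> g \<otimes> s = \<one>"
    have "g = s \<otimes> inv s \<otimes> g \<otimes> (s \<otimes> inv s)" using that by simp
    also have "\<dots> = s \<otimes> (inv s \<otimes> g \<otimes> s) \<otimes> inv s"
      by (simp only: m_assoc m_closed inv_closed that)
    finally show "g = \<one>" using that by (simp add: e)
  qed (use that in simp)
  have ch_\<sigma>: "ch G \<sigma> g = (if g = \<one> then 1 else 0)" if g: "g \<in> carrier G" for g
  proof -
    have "ch G \<sigma> g = induced_function G {\<one>} (ch (G\<lparr>carrier := {\<one>}\<rparr>) \<tau>) g"
      unfolding \<sigma>_def by (rule ch_ind_rep[OF fin sub \<tau> g])
    also have "\<dots> = (\<Sum>s\<in>carrier G. if g = \<one> then 1 else 0) / of_nat (card (carrier G))"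
      unfolding induced_function_def
      by (intro arg_cong2[of _ _ _ _ "(/)"] sum.cong refl) (auto simp: conj_one g \<tau>_def ch_def)
    finally show ?thesis using fin one_closed by auto
  qed
  have N: "of_nat (card (carrier G)) \<noteq> (0 :: complex)" using fin one_closed by auto
  let ?X = "ch G ` set (decomposition G \<sigma>)"
  have "irr_chars G \<subseteq> ?X"
  proof
    fix y assume y: "y \<in> irr_chars G"
    show "y \<in> ?X"
    proof (rule ccontr)
      assume n: "y \<notin> ?X"
      have "class_inner G (ch G \<sigma>) y = (\<Sum>x\<in>?X. of_real (ch_measure G \<sigma> x) * class_inner G x y)"
        unfolding class_inner_sum[symmetric]
        by (rule class_inner_cong, rule ch_measure_expansion[OF fin \<sigma>]) auto
      also have "\<dots> = 0"
      proof (rule sum.neutral, rule ballI)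
        fix x assume x: "x \<in> ?X"
        then have "x \<in> irr_chars G" using decomposition(1)[OF fin \<sigma>] by (auto intro: ch_in_irr_chars)
        moreover have "x \<noteq> y" using x n by blast
        ultimately show "of_real (ch_measure G \<sigma> x) * class_inner G x y = 0"
          using irr_chars_orthogonal[OF _ y fin] by simp
      qed
      finally have zero: "class_inner G (ch G \<sigma>) y = 0" .
      have "class_inner G (ch G \<sigma>) y = (\<Sum>g\<in>carrier G. if g = \<one> then y (inv g) else 0) / of_nat (card (carrier G))"
        unfolding class_inner_def by (intro arg_cong2[of _ _ _ _ "(/)"] sum.cong refl) (simp add: ch_\<sigma>)
      also have "\<dots> = y \<one> / of_nat (card (carrier G))" using fin by simp
      also have "y \<one> = 1"
        using rep_of_char[OF y] ch_one[of "rep_of_char G y"] char_degree_pos[OF y]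
        by (cases "rep_of_char G y") (auto simp: irreducible_rep_def char_degree_def)
      finally show False using zero N by simp
    qed
  qed
  then show ?thesis by (rule finite_subset) simp
qed

lemma (in group) irr_char_rep:
  assumes "x \<in> irr_chars G"
  shows "is_rep G (rep_of_char G x)" "fst (rep_of_char G x) > 0"
  using rep_of_char(1)[OF assms] by (cases "rep_of_char G x"; auto simp: irreducible_rep_def)+

lemma (in group) irr_char_one: "x \<in> irr_chars G \<Longrightarrow> x \<one> = 1"
  using ch_one[OF irr_char_rep] rep_of_char(2) by metis

lemma (in group) irr_char_conjugate:
  "x \<in> irr_chars G \<Longrightarrow> g \<in> carrier G \<Longrightarrow> s \<in> carrier G \<Longrightarrow> x (inv s \<otimes> g \<otimes> s) = x g"
  using ch_conjugate[OF irr_char_rep(1)] rep_of_char(2) by metis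

lemma (in group) ch_measure_outside:
  assumes "finite (carrier G)" "is_rep G \<sigma>" "x \<notin> irr_chars G"
  shows "ch_measure G \<sigma> x = 0"
  by (rule ch_measure_support[OF assms(1,2)])
    (use assms decomposition(1)[OF assms(1,2)] ch_in_irr_chars in blast)

lemma (in group) ch_as_measure:
  assumes fin: "finite (carrier G)" and rep: "is_rep G \<sigma>" and g: "g \<in> carrier G"
  shows "(\<Sum>x\<in>irr_chars G. of_real (ch_measure G \<sigma> x) * x g) = ch G \<sigma> g"
  by (rule ch_measure_expansion[OF fin rep g finite_irr_chars[OF fin], symmetric])
    (use decomposition(1)[OF fin rep] ch_in_irr_chars in blast)

text \<open>Every normalized character has the value \<open>1\<close> at the unit, so the total mass can be read off there.\<close>

lemma (in group) ch_measure_total: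
  assumes fin: "finite (carrier G)" and rep: "is_rep G \<sigma>" and "fst \<sigma> > 0"
  shows "(\<Sum>x\<in>irr_chars G. ch_measure G \<sigma> x) = 1"
proof -
  have "(\<Sum>x\<in>irr_chars G. of_real (ch_measure G \<sigma> x) * x \<one>) = (1 :: complex)"
    using ch_as_measure[OF fin rep one_closed] ch_one[OF rep assms(3)] by simp
  then have "of_real (\<Sum>x\<in>irr_chars G. ch_measure G \<sigma> x) = (1 :: complex)"
    by (simp add: irr_char_one)
  then show ?thesis by (simp only: of_real_eq_1_iff)
qed

text \<open>By orthogonality, the inner product with \<open>y\<close> extracts the coefficient at \<open>y\<close>. This gives both the
  linear independence of the irreducible characters and the mass of a measure at the unit.\<close>

lemma (in group) irr_chars_coefficient:
  assumes fin: "finite (carrier G)" and y: "y \<in> irr_chars G"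
    and f: "\<And>g. g \<in> carrier G \<Longrightarrow> f g = (\<Sum>x\<in>irr_chars G. c x * x g)"
  shows "class_inner G f y = c y / of_nat (char_degree G y) ^ 2"
proof -
  have "class_inner G f y = (\<Sum>x\<in>irr_chars G. c x * class_inner G x y)"
    unfolding class_inner_sum[symmetric] by (rule class_inner_cong) (rule f)
  also have "\<dots> = (\<Sum>x\<in>irr_chars G. if x = y then c x / of_nat (char_degree G y) ^ 2 else 0)"
    by (intro sum.cong refl) (simp add: irr_chars_orthogonal[OF _ y fin])
  also have "\<dots> = c y / of_nat (char_degree G y) ^ 2"
    using y finite_irr_chars[OF fin] by simp
  finally show ?thesis .
qed

lemma (in group) irr_chars_independent:
  assumes fin: "finite (carrier G)" and y: "y \<in> irr_chars G"
    and e: "\<And>g. g \<in> carrier G \<Longrightarrow> (\<Sum>x\<in>irr_chars G. c x * x g) = (\<Sum>x\<in>irr_chars G. c' x * x g)"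
  shows "c y = c' y"
proof -
  have "c y / of_nat (char_degree G y) ^ 2 = class_inner G (\<lambda>g. \<Sum>x\<in>irr_chars G. c x * x g) y"
    by (rule irr_chars_coefficient[OF fin y refl, symmetric])
  also have "\<dots> = class_inner G (\<lambda>g. \<Sum>x\<in>irr_chars G. c' x * x g) y"
    by (rule class_inner_cong) (rule e)
  also have "\<dots> = c' y / of_nat (char_degree G y) ^ 2"
    by (rule irr_chars_coefficient[OF fin y refl])
  finally have "c y / of_nat (char_degree G y) ^ 2 = c' y / of_nat (char_degree G y) ^ 2" .
  then show ?thesis using char_degree_pos[OF y] by auto
qed

section \<open>Dual and trivial characters\<close>

text \<open>The annihilator of a subspace \<open>W\<close> that is invariant under the transposed inverse matrices is invariant
  under \<open>\<rho>\<close>, hence zero or everything. If \<open>W\<close> is proper and nonzero, neither is possible: in a basis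
  adapted to \<open>W\<close> the row \<open>k\<close> of \<open>Q\<close> annihilates \<open>W\<close>, and a vector that is orthogonal to all
  vectors is zero.\<close>

lemma (in group) dual_rep_irreducible:
  assumes irr: "irreducible_rep G (d, \<rho>)"
  shows "irreducible_rep G (d, \<lambda>g. transpose_mat (\<rho> (inv g)))"
proof -
  define \<rho>' where "\<rho>' g = transpose_mat (\<rho> (inv g))" for g
  have rep: "is_rep G (d, \<rho>)" and d: "d > 0" using irr by (auto simp: irreducible_rep_def)
  have c: "\<rho> g \<in> carrier_mat d d" if "g \<in> carrier G" for g using rep that by (simp add: is_rep_iff)
  have rep': "is_rep G (d, \<rho>')"
    unfolding is_rep_iff
  proof (intro conjI ballI)
    fix g h assume g: "g \<in> carrier G" and h: "h \<in> carrier G"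
    have "\<rho> (inv (g \<otimes> h)) = \<rho> (inv h) * \<rho> (inv g)"
      using rep g h by (simp add: inv_mult_group is_rep_iff)
    then show "\<rho>' (g \<otimes> h) = \<rho>' g * \<rho>' h"
      unfolding \<rho>'_def using transpose_mult[OF c[OF inv_closed[OF h]] c[OF inv_closed[OF g]]] by simp
  qed (use rep c in \<open>auto simp: \<rho>'_def is_rep_iff\<close>)
  have "W = {0\<^sub>v d} \<or> W = carrier_vec d"
    if W: "VectorSpace.subspace class_ring W (module_vec TYPE(complex) d)"
      and inv: "\<forall>g\<in>carrier G. \<forall>w\<in>W. \<rho>' g *\<^sub>v w \<in> W" for W
  proof (rule ccontr)
    assume "\<not> (W = {0\<^sub>v d} \<or> W = carrier_vec d)"
    then have ne: "W \<noteq> {0\<^sub>v d}" "W \<noteq> carrier_vec d" by auto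
    have Wc: "W \<subseteq> carrier_vec d" and W0: "0\<^sub>v d \<in> W" using W[unfolded subspace_vec_iff] by blast+
    obtain k P Q where k: "k < d" and PQ: "P \<in> carrier_mat d d" "Q \<in> carrier_mat d d"
      "P * Q = 1\<^sub>m d" "Q * P = 1\<^sub>m d"
      and PW: "\<And>v. v \<in> carrier_vec d \<Longrightarrow> P *\<^sub>v v \<in> W \<longleftrightarrow> (\<forall>i. k \<le> i \<longrightarrow> i < d \<longrightarrow> v $ i = 0)"
    proof (rule adapted_basis[OF W ne], goal_cases)
      case 1
      show ?case by (rule 1(1)[OF 1(3-)])
    qed
    define A where "A = {v \<in> carrier_vec d. \<forall>w\<in>W. w \<bullet> v = 0}"
    have "A = {0\<^sub>v d} \<or> A = carrier_vec d"
    proof (rule irreducible_repD[OF irr])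
      fix g v assume g: "g \<in> carrier G" and v: "v \<in> A"
      have "w \<bullet> (\<rho> g *\<^sub>v v) = 0" if w: "w \<in> W" for w
      proof -
        have "w \<bullet> (\<rho> g *\<^sub>v v) = (\<rho>' (inv g) *\<^sub>v w) \<bullet> v"
          using transpose_vec_mult_scalar[OF c[OF g], of v w] v w Wc g by (auto simp: A_def \<rho>'_def)
        moreover have "\<rho>' (inv g) *\<^sub>v w \<in> W" using inv g w by simp
        ultimately show ?thesis using v by (simp add: A_def)
      qed
      then show "\<rho> g *\<^sub>v v \<in> A" using v c[OF g] by (simp add: A_def)
    next
      fix v w assume "v \<in> A" "w \<in> A"
      then show "v + w \<in> A" using Wc by (auto simp: A_def scalar_prod_add_distrib[of _ d])
    next
      fix a v assume "v \<in> A"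
      then show "a \<cdot>\<^sub>v v \<in> A" using Wc by (auto simp: A_def)
    qed (use Wc in \<open>auto simp: A_def\<close>)
    moreover have "row Q k \<in> A"
    proof -
      have "w \<bullet> row Q k = 0" if w: "w \<in> W" for w
      proof -
        have wc: "w \<in> carrier_vec d" using w Wc by blast
        have Qw: "Q *\<^sub>v w \<in> carrier_vec d" using PQ(2) wc by (rule mult_mat_vec_carrier)
        have "P *\<^sub>v (Q *\<^sub>v w) = w"
          using assoc_mult_mat_vec[OF PQ(1,2) wc] PQ(3) wc by simp
        then have "(Q *\<^sub>v w) $ k = 0" using PW[OF Qw] w k by simp
        moreover have "(Q *\<^sub>v w) $ k = row Q k \<bullet> w" using PQ(2) k by simp
        moreover have "row Q k \<bullet> w = w \<bullet> row Q k"
          by (rule comm_scalar_prod[of _ d]) (use PQ(2) k wc in auto)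
        ultimately show ?thesis by simp
      qed
      then show ?thesis using PQ(2) k by (simp add: A_def)
    qed
    moreover have "row Q k \<noteq> 0\<^sub>v d"
    proof
      assume z: "row Q k = 0\<^sub>v d"
      have "(Q * P) $$ (k, k) = row Q k \<bullet> col P k" using PQ(1,2) k by simp
      then show False using PQ(1,4) k by (simp add: z)
    qed
    ultimately have "A = carrier_vec d" by blast
    then have all: "w \<bullet> unit_vec d i = 0" if "w \<in> W" for w i
      using that unit_vec_carrier[of d i] unfolding A_def by blast
    have "w = 0\<^sub>v d" if w: "w \<in> W" for w
    proof (rule eq_vecI)
      fix i assume "i < dim_vec (0\<^sub>v d :: complex vec)"
      then have i: "i < d" by simp
      have wc: "w \<in> carrier_vec d" using w Wc by blast
      show "w $ i = 0\<^sub>v d $ i" using all[OF w, of i] scalar_prod_right_unit[OF i] i by simp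
    qed (use w Wc in auto)
    then show False using W0 ne(1) by blast
  qed
  then have "irreducible_rep G (d, \<rho>')" using rep' d unfolding irreducible_rep_def by blast
  then show ?thesis by (simp only: \<rho>'_def[abs_def])
qed

definition dual_char :: "('g, 'b) monoid_scheme \<Rightarrow> ('g \<Rightarrow> complex) \<Rightarrow> 'g \<Rightarrow> complex" where
  "dual_char G x = (\<lambda>g\<in>carrier G. x (inv\<^bsub>G\<^esub> g))"

lemma (in group) dual_char_irr:
  assumes x: "x \<in> irr_chars G"
  shows "dual_char G x \<in> irr_chars G"
proof -
  obtain d \<rho> where r: "rep_of_char G x = (d, \<rho>)" by fastforce
  have irr: "irreducible_rep G (d, \<rho>)" and ch: "ch G (d, \<rho>) = x"
    using rep_of_char[OF x] r by auto
  have c: "\<rho> g \<in> carrier_mat d d" if "g \<in> carrier G" for g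
    using irr that by (simp add: irreducible_rep_def is_rep_iff)
  have "ch G (d, \<lambda>g. transpose_mat (\<rho> (inv g))) = dual_char G x"
  proof
    fix g
    show "ch G (d, \<lambda>g. transpose_mat (\<rho> (inv g))) g = dual_char G x g"
      using c[of "inv g"] by (auto simp: ch[symmetric] dual_char_def ch_def trace_mat_def)
  qed
  then show ?thesis using ch_in_irr_chars[OF dual_rep_irreducible[OF irr]] by simp
qed

lemma irr_char_extensional: "x \<in> irr_chars G \<Longrightarrow> g \<notin> carrier G \<Longrightarrow> x g = undefined"
  by (auto simp: irr_chars_def ch_def)

lemma (in group) dual_char_involutive:
  assumes "x \<in> irr_chars G"
  shows "dual_char G (dual_char G x) = x"
  using irr_char_extensional[OF assms] by (auto simp: dual_char_def)

definition trivial_char :: "('g, 'b) monoid_scheme \<Rightarrow> 'g \<Rightarrow> complex" where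
  "trivial_char G = (\<lambda>g\<in>carrier G. 1)"

lemma (in group) trivial_char_irr: "trivial_char G \<in> irr_chars G"
proof -
  let ?\<tau> = "(1 :: nat, \<lambda>g :: 'a. 1\<^sub>m 1 :: complex mat)"
  have "W = {0\<^sub>v 1} \<or> W = carrier_vec 1"
    if W: "VectorSpace.subspace class_ring W (module_vec TYPE(complex) 1)" for W
  proof (cases "W \<subseteq> {0\<^sub>v 1}")
    case True
    then show ?thesis using W[unfolded subspace_vec_iff] by blast
  next
    case False
    then obtain w where w: "w \<in> W" "w \<noteq> 0\<^sub>v 1" by blast
    have wc: "w \<in> carrier_vec 1" using W[unfolded subspace_vec_iff] w by blast
    have w0: "w $ 0 \<noteq> 0"
    proof
      assume "w $ 0 = 0"
      then have "w = 0\<^sub>v 1" using wc by (intro eq_vecI) auto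
      then show False using w by simp
    qed
    have "v \<in> W" if v: "v \<in> carrier_vec 1" for v
    proof -
      have "v = (v $ 0 / w $ 0) \<cdot>\<^sub>v w" using v wc w0 by (intro eq_vecI) auto
      moreover have "(v $ 0 / w $ 0) \<cdot>\<^sub>v w \<in> W" using W[unfolded subspace_vec_iff] w by blast
      ultimately show ?thesis by simp
    qed
    then show ?thesis using W[unfolded subspace_vec_iff] by blast
  qed
  moreover have "is_rep G ?\<tau>" by (simp add: is_rep_iff)
  ultimately have "irreducible_rep G ?\<tau>" by (simp add: irreducible_rep_def)
  moreover have "ch G ?\<tau> = trivial_char G" by (auto simp: ch_def trivial_char_def)
  ultimately show ?thesis using ch_in_irr_chars by metis
qed

section \<open>Integration against measures on a finite set\<close>

lemma bilinear_ext_in_measures: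
  assumes "\<And>x y. x \<in> K \<Longrightarrow> y \<in> K \<Longrightarrow> conv x y \<in> measures_on K"
  shows "bilinear_ext K conv \<mu> \<nu> \<in> measures_on K"
  using assms by (auto simp: bilinear_ext_def measures_on_def intro!: sum.neutral)

lemma prob_measures_onD: "\<mu> \<in> prob_measures_on K \<Longrightarrow> \<mu> \<in> measures_on K"
  by (simp add: prob_measures_on_def)

definition integral_on :: "'k set \<Rightarrow> ('k \<Rightarrow> real) \<Rightarrow> ('k \<Rightarrow> complex) \<Rightarrow> complex" where
  "integral_on K \<mu> F = (\<Sum>x\<in>K. of_real (\<mu> x) * F x)"

lemma integral_on_dirac:
  assumes "finite K" "x \<in> K"
  shows "integral_on K (dirac x) F = F x"
proof -
  have "integral_on K (dirac x) F = (\<Sum>y\<in>K. if y = x then F y else 0)"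
    unfolding integral_on_def by (intro sum.cong) (auto simp: dirac_def)
  then show ?thesis using assms by simp
qed

lemma integral_on_bilinear_ext:
  "integral_on K (bilinear_ext K conv \<mu> \<nu>) F =
     (\<Sum>x\<in>K. \<Sum>y\<in>K. of_real (\<mu> x) * of_real (\<nu> y) * integral_on K (conv x y) F)"
proof -
  have "integral_on K (bilinear_ext K conv \<mu> \<nu>) F =
      (\<Sum>z\<in>K. \<Sum>x\<in>K. \<Sum>y\<in>K. of_real (\<mu> x) * of_real (\<nu> y) * (of_real (conv x y z) * F z))"
    unfolding integral_on_def bilinear_ext_def by (simp add: sum_distrib_right mult.assoc)
  also have "\<dots> = (\<Sum>x\<in>K. \<Sum>z\<in>K. \<Sum>y\<in>K. of_real (\<mu> x) * of_real (\<nu> y) * (of_real (conv x y z) * F z))"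
    by (rule sum.swap)
  also have "\<dots> = (\<Sum>x\<in>K. \<Sum>y\<in>K. \<Sum>z\<in>K. of_real (\<mu> x) * of_real (\<nu> y) * (of_real (conv x y z) * F z))"
    by (rule sum.cong[OF refl], rule sum.swap)
  finally show ?thesis by (simp add: integral_on_def sum_distrib_left)
qed

lemma integral_on_push_forward:
  assumes "finite K" "f ` K \<subseteq> K"
  shows "integral_on K (push_forward K f \<mu>) F = integral_on K \<mu> (\<lambda>x. F (f x))"
proof -
  have "integral_on K (push_forward K f \<mu>) F = (\<Sum>z\<in>K. \<Sum>x\<in>{x \<in> K. f x = z}. of_real (\<mu> x) * F (f x))"
    unfolding integral_on_def push_forward_def by (simp add: sum_distrib_right)
  also have "\<dots> = (\<Sum>x\<in>K. of_real (\<mu> x) * F (f x))"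
    by (rule sum.group) (use assms in auto)
  finally show ?thesis by (simp add: integral_on_def)
qed

lemma push_forward_in_measures:
  assumes "f ` K \<subseteq> K"
  shows "push_forward K f \<mu> \<in> measures_on K"
  using assms by (auto simp: push_forward_def measures_on_def intro!: sum.neutral)

section \<open>Induction of class functions\<close>

lemma induced_function_sum:
  "induced_function G H (\<lambda>h. \<Sum>i\<in>I. c i * F i h) g = (\<Sum>i\<in>I. c i * induced_function G H (F i) g)"
proof -
  let ?q = "\<lambda>s. inv\<^bsub>G\<^esub> s \<otimes>\<^bsub>G\<^esub> g \<otimes>\<^bsub>G\<^esub> s"
  have "(\<Sum>s\<in>carrier G. if ?q s \<in> H then \<Sum>i\<in>I. c i * F i (?q s) else 0) =
      (\<Sum>s\<in>carrier G. \<Sum>i\<in>I. c i * (if ?q s \<in> H then F i (?q s) else 0))"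
    by (intro sum.cong refl) simp
  also have "\<dots> = (\<Sum>i\<in>I. \<Sum>s\<in>carrier G. c i * (if ?q s \<in> H then F i (?q s) else 0))"
    by (rule sum.swap)
  finally have "(\<Sum>s\<in>carrier G. if ?q s \<in> H then \<Sum>i\<in>I. c i * F i (?q s) else 0) =
      (\<Sum>i\<in>I. c i * (\<Sum>s\<in>carrier G. if ?q s \<in> H then F i (?q s) else 0))"
    by (simp add: sum_distrib_left)
  then have "induced_function G H (\<lambda>h. \<Sum>i\<in>I. c i * F i h) g =
      (\<Sum>i\<in>I. c i * (\<Sum>s\<in>carrier G. if ?q s \<in> H then F i (?q s) else 0)) / of_nat (card (carrier G))"
    by (simp add: induced_function_def)
  also have "\<dots> = (\<Sum>i\<in>I. c i * (\<Sum>s\<in>carrier G. if ?q s \<in> H then F i (?q s) else 0) / of_nat (card (carrier G)))"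
    by (rule sum_divide_distrib)
  finally show ?thesis by (simp add: induced_function_def)
qed

lemma induced_function_add:
  "induced_function G H (\<lambda>h. \<phi> h + \<psi> h) g = induced_function G H \<phi> g + induced_function G H \<psi> g"
  using induced_function_sum[of G H "\<lambda>_. 1" "\<lambda>i. if i then \<phi> else \<psi>" "{True, False}" g] by simp

lemma induced_function_cong:
  assumes "\<And>h. h \<in> H \<Longrightarrow> \<phi> h = \<psi> h"
  shows "induced_function G H \<phi> g = induced_function G H \<psi> g"
  using assms by (auto simp: induced_function_def intro!: sum.cong)

text \<open>A function that is constant on the conjugates of \<open>g\<close> can be pulled out of the average.\<close>

lemma (in group) projection_formula:
  assumes "\<And>s. s \<in> carrier G \<Longrightarrow> f (inv s \<otimes> g \<otimes> s) = f g"
  shows "induced_function G H (\<lambda>h. f h * \<phi> h) g = f g * induced_function G H \<phi> g"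
proof -
  have "(\<Sum>s\<in>carrier G. if inv s \<otimes> g \<otimes> s \<in> H then f (inv s \<otimes> g \<otimes> s) * \<phi> (inv s \<otimes> g \<otimes> s) else 0) =
      f g * (\<Sum>s\<in>carrier G. if inv s \<otimes> g \<otimes> s \<in> H then \<phi> (inv s \<otimes> g \<otimes> s) else 0)"
    unfolding sum_distrib_left by (intro sum.cong refl) (simp add: assms)
  then show ?thesis by (simp add: induced_function_def)
qed

lemma (in group) induced_function_inverse:
  assumes H: "subgroup H G" and g: "g \<in> carrier G"
  shows "induced_function G H (\<lambda>h. \<phi> (inv h)) g = induced_function G H \<phi> (inv g)"
proof -
  have "inv s \<otimes> inv g \<otimes> s = inv (inv s \<otimes> g \<otimes> s)" if "s \<in> carrier G" for s
    using that g by (simp add: inv_mult_group m_assoc)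
  moreover have "inv h \<in> H \<longleftrightarrow> h \<in> H" if "h \<in> carrier G" for h
    using subgroup.m_inv_closed[OF H] inv_inv[OF that] by metis
  ultimately show ?thesis
    unfolding induced_function_def using g
    by (intro arg_cong2[of _ _ _ _ "(/)"] sum.cong refl) simp
qed

text \<open>Frobenius reciprocity for the trivial character. For each \<open>s\<close>, conjugation by \<open>s\<close> permutes \<open>G\<close>, so
  that the inner sum is the sum over \<open>H\<close>.\<close>

lemma (in group) sum_induced_function:
  assumes fin: "finite (carrier G)" and H: "subgroup H G"
  shows "(\<Sum>g\<in>carrier G. induced_function G H \<phi> g) = (\<Sum>h\<in>H. \<phi> h)"
proof -
  have HG: "H \<subseteq> carrier G" by (rule subgroup.subset[OF H])
  have "(\<Sum>g\<in>carrier G. if inv s \<otimes> g \<otimes> s \<in> H then \<phi> (inv s \<otimes> g \<otimes> s) else 0) = (\<Sum>h\<in>H. \<phi> h)"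
    if s: "s \<in> carrier G" for s
  proof -
    have "bij_betw (\<lambda>g. inv s \<otimes> g \<otimes> s) (carrier G) (carrier G)"
    proof (rule bij_betwI[where g = "\<lambda>g. s \<otimes> g \<otimes> inv s"])
      fix g assume g: "g \<in> carrier G"
      have "s \<otimes> (inv s \<otimes> g \<otimes> s) \<otimes> inv s = s \<otimes> inv s \<otimes> g \<otimes> (s \<otimes> inv s)"
        by (simp only: m_assoc m_closed inv_closed s g)
      then show "s \<otimes> (inv s \<otimes> g \<otimes> s) \<otimes> inv s = g" using s g by simp
      have "inv s \<otimes> (s \<otimes> g \<otimes> inv s) \<otimes> s = inv s \<otimes> s \<otimes> g \<otimes> (inv s \<otimes> s)"
        by (simp only: m_assoc m_closed inv_closed s g)
      then show "inv s \<otimes> (s \<otimes> g \<otimes> inv s) \<otimes> s = g" using s g by simp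
    qed (use s in auto)
    from sum.reindex_bij_betw[OF this, of "\<lambda>h. if h \<in> H then \<phi> h else 0"]
    have "(\<Sum>g\<in>carrier G. if inv s \<otimes> g \<otimes> s \<in> H then \<phi> (inv s \<otimes> g \<otimes> s) else 0) =
        (\<Sum>h\<in>carrier G. if h \<in> H then \<phi> h else 0)" .
    also have "\<dots> = (\<Sum>h\<in>H. \<phi> h)"
      using fin HG by (simp add: sum.inter_restrict[symmetric] Int_absorb1)
    finally show ?thesis .
  qed
  then have "(\<Sum>s\<in>carrier G. \<Sum>g\<in>carrier G. if inv s \<otimes> g \<otimes> s \<in> H then \<phi> (inv s \<otimes> g \<otimes> s) else 0) =
      of_nat (card (carrier G)) * (\<Sum>h\<in>H. \<phi> h)" by simp
  moreover have "of_nat (card (carrier G)) \<noteq> (0 :: complex)" using fin one_closed by auto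
  moreover have "(\<Sum>g\<in>carrier G. induced_function G H \<phi> g) =
      (\<Sum>s\<in>carrier G. \<Sum>g\<in>carrier G. if inv s \<otimes> g \<otimes> s \<in> H then \<phi> (inv s \<otimes> g \<otimes> s) else 0) / of_nat (card (carrier G))"
    unfolding induced_function_def sum_divide_distrib[symmetric] by (subst sum.swap) rule
  ultimately show ?thesis by simp
qed

section \<open>The hypergroup of a fusion controlling subgroup\<close>

text \<open>The subgroup controls fusion: elements of \<open>H\<close> that are conjugate in \<open>G\<close> are conjugate in \<open>H\<close>. This
  makes the convolution of three bullet points associative.\<close>

locale fusion_controlling_subgroup = group G for G (structure) +
  fixes H
  assumes finite_carrier: "finite (carrier G)"
    and subgroup_H: "subgroup H G"
    and fusion: "\<lbrakk>h \<in> H; s \<in> carrier G; inv s \<otimes> h \<otimes> s \<in> H\<rbrakk>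
      \<Longrightarrow> \<exists>t\<in>H. inv s \<otimes> h \<otimes> s = inv t \<otimes> h \<otimes> t"
begin

abbreviation "G\<^sub>0 \<equiv> G\<lparr>carrier := H\<rparr>"

sublocale H: group "G\<^sub>0"
  using subgroup_H group_axioms by (rule subgroup.subgroup_is_group)

lemma H_carrier: "h \<in> H \<Longrightarrow> h \<in> carrier G"
  using subgroup_H by (rule subgroup.mem_carrier)

lemma H_subset: "H \<subseteq> carrier G" using H_carrier by blast

lemma finite_H: "finite (carrier G\<^sub>0)"
  using finite_subset[OF H_subset finite_carrier] by simp

lemma H_inv: "h \<in> H \<Longrightarrow> inv\<^bsub>G\<^sub>0\<^esub> h = inv h"
  using m_inv_consistent[OF subgroup_H] by simp

lemma H_inv_closed: "h \<in> H \<Longrightarrow> inv h \<in> H"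
  using subgroup.m_inv_closed[OF subgroup_H] .

text \<open>Control of fusion makes a class function of \<open>H\<close> constant on all \<open>G\<close>-conjugates of \<open>h\<close> that lie in
  \<open>H\<close>. So, on \<open>H\<close>, induction is multiplication by a function that does not depend on \<open>\<phi>\<close>.\<close>

lemma induced_function_restrict:
  assumes const: "\<And>h t. h \<in> H \<Longrightarrow> t \<in> H \<Longrightarrow> \<phi> (inv t \<otimes> h \<otimes> t) = \<phi> h" and h: "h \<in> H"
  shows "induced_function G H \<phi> h = \<phi> h * induced_function G H (\<lambda>_. 1) h"
proof -
  have "\<phi> (inv s \<otimes> h \<otimes> s) = \<phi> h" if "s \<in> carrier G" "inv s \<otimes> h \<otimes> s \<in> H" for s
    using fusion[OF h that] const[OF h] by auto
  then have "(\<Sum>s\<in>carrier G. if inv s \<otimes> h \<otimes> s \<in> H then \<phi> (inv s \<otimes> h \<otimes> s) else 0) =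
      \<phi> h * (\<Sum>s\<in>carrier G. if inv s \<otimes> h \<otimes> s \<in> H then 1 else 0)"
    unfolding sum_distrib_left by (intro sum.cong refl) simp
  then show ?thesis by (simp add: induced_function_def)
qed

abbreviation "K \<equiv> char_set G H"
abbreviation "conv \<equiv> char_conv G H"

lemma finite_K: "finite K"
  using finite_irr_chars[OF finite_carrier] H.finite_irr_chars[OF finite_H] by (simp add: char_set_def)

lemma K_cases:
  assumes "p \<in> K"
  obtains (circ) x where "p = Inl x" "x \<in> irr_chars G" | (bullet) t where "p = Inr t" "t \<in> irr_chars G\<^sub>0"
  using assms unfolding char_set_def by auto

lemma K_memI [simp]: "Inl x \<in> K \<longleftrightarrow> x \<in> irr_chars G" "Inr t \<in> K \<longleftrightarrow> t \<in> irr_chars G\<^sub>0"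
  by (auto simp: char_set_def)

lemma sum_K: "(\<Sum>p\<in>K. F p) = (\<Sum>x\<in>irr_chars G. F (Inl x)) + (\<Sum>t\<in>irr_chars G\<^sub>0. F (Inr t))"
  using finite_irr_chars[OF finite_carrier] H.finite_irr_chars[OF finite_H]
  by (simp add: char_set_def sum.Plus comp_def)

text \<open>Each of the two evaluations vanishes on the other kind of points. In this way single formulas cover
  the four cases in the definition of the convolution.\<close>

definition circ_value :: "'a \<Rightarrow> 'a char_point \<Rightarrow> complex" where
  "circ_value g = case_sum (\<lambda>x. x g) (\<lambda>_. 0)"

definition bullet_value :: "'a \<Rightarrow> 'a char_point \<Rightarrow> complex" where
  "bullet_value h = case_sum (\<lambda>_. 0) (\<lambda>t. t h)"

definition circ_fun :: "('a char_point \<Rightarrow> real) \<Rightarrow> 'a \<Rightarrow> complex" where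
  "circ_fun \<mu> g = integral_on K \<mu> (circ_value g)"

definition bullet_fun :: "('a char_point \<Rightarrow> real) \<Rightarrow> 'a \<Rightarrow> complex" where
  "bullet_fun \<mu> h = integral_on K \<mu> (bullet_value h)"

lemma circ_fun_eq: "circ_fun \<mu> g = (\<Sum>x\<in>irr_chars G. of_real (\<mu> (Inl x)) * x g)"
  by (simp add: circ_fun_def integral_on_def sum_K circ_value_def)

lemma bullet_fun_eq: "bullet_fun \<mu> h = (\<Sum>t\<in>irr_chars G\<^sub>0. of_real (\<mu> (Inr t)) * t h)"
  by (simp add: bullet_fun_def integral_on_def sum_K bullet_value_def)

text \<open>Linear independence of the irreducible characters of \<open>G\<close> and of those of \<open>H\<close>. Identities between
  measures are reduced to identities between functions by this rule.\<close>

lemma measure_eqI: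
  assumes \<mu>: "\<mu> \<in> measures_on K" and \<nu>: "\<nu> \<in> measures_on K"
    and c: "\<And>g. g \<in> carrier G \<Longrightarrow> circ_fun \<mu> g = circ_fun \<nu> g"
    and b: "\<And>h. h \<in> H \<Longrightarrow> bullet_fun \<mu> h = bullet_fun \<nu> h"
  shows "\<mu> = \<nu>"
proof
  fix p
  show "\<mu> p = \<nu> p"
  proof (cases "p \<in> K")
    case True
    then show ?thesis
    proof (cases rule: K_cases)
      case (circ x)
      have "complex_of_real (\<mu> (Inl x)) = of_real (\<nu> (Inl x))"
        using irr_chars_independent[OF finite_carrier circ(2), of "\<lambda>x. of_real (\<mu> (Inl x))" "\<lambda>x. of_real (\<nu> (Inl x))"] c
        by (simp add: circ_fun_eq)
      then show ?thesis using circ by simp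
    next
      case (bullet t)
      have "complex_of_real (\<mu> (Inr t)) = of_real (\<nu> (Inr t))"
        using H.irr_chars_independent[OF finite_H bullet(2), of "\<lambda>t. of_real (\<mu> (Inr t))" "\<lambda>t. of_real (\<nu> (Inr t))"] b
        by (simp add: bullet_fun_eq)
      then show ?thesis using bullet by simp
    qed
  next
    case False
    then show ?thesis using \<mu> \<nu> by (simp add: measures_on_def)
  qed
qed

lemma circ_measure_prob:
  assumes "is_rep G \<sigma>" "fst \<sigma> > 0"
  shows "circ_measure G \<sigma> \<in> prob_measures_on K"
proof -
  have "circ_measure G \<sigma> p = 0" if "p \<notin> K" for p
    using that ch_measure_outside[OF finite_carrier assms(1)] by (cases p) (auto simp: circ_measure_def)
  moreover have "(\<Sum>p\<in>K. circ_measure G \<sigma> p) = 1"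
    using ch_measure_total[OF finite_carrier assms] by (simp add: sum_K circ_measure_def)
  moreover have "circ_measure G \<sigma> p \<ge> 0" for p
    by (cases p) (auto simp: circ_measure_def ch_measure_nonneg)
  ultimately show ?thesis by (simp add: prob_measures_on_def measures_on_def)
qed

lemma bullet_measure_prob:
  assumes "is_rep G\<^sub>0 \<sigma>" "fst \<sigma> > 0"
  shows "bullet_measure G H \<sigma> \<in> prob_measures_on K"
proof -
  have "bullet_measure G H \<sigma> p = 0" if "p \<notin> K" for p
    using that H.ch_measure_outside[OF finite_H assms(1)] by (cases p) (auto simp: bullet_measure_def)
  moreover have "(\<Sum>p\<in>K. bullet_measure G H \<sigma> p) = 1"
    using H.ch_measure_total[OF finite_H assms] by (simp add: sum_K bullet_measure_def)
  moreover have "bullet_measure G H \<sigma> p \<ge> 0" for p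
    by (cases p) (auto simp: bullet_measure_def ch_measure_nonneg)
  ultimately show ?thesis by (simp add: prob_measures_on_def measures_on_def)
qed

lemma circ_measure_funs:
  assumes "is_rep G \<sigma>"
  shows "g \<in> carrier G \<Longrightarrow> circ_fun (circ_measure G \<sigma>) g = ch G \<sigma> g"
    and "bullet_fun (circ_measure G \<sigma>) h = 0"
  using ch_as_measure[OF finite_carrier assms] by (simp_all add: circ_fun_eq bullet_fun_eq circ_measure_def)

lemma bullet_measure_funs:
  assumes "is_rep G\<^sub>0 \<sigma>"
  shows "h \<in> H \<Longrightarrow> bullet_fun (bullet_measure G H \<sigma>) h = ch G\<^sub>0 \<sigma> h"
    and "circ_fun (bullet_measure G H \<sigma>) g = 0"
  using H.ch_as_measure[OF finite_H assms] by (simp_all add: circ_fun_eq bullet_fun_eq bullet_measure_def)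

lemma transversal_nonempty: "length (left_transversal G H) > 0"
  using transversal_length[OF finite_carrier subgroup_H] finite_carrier one_closed by (metis card_gt_0_iff empty_iff gr0I mult_0)

text \<open>In each of the four cases the convolution is the measure of a tensor product, of \<open>G\<close> or of \<open>H\<close>, or
  of an induced representation, whose character is known.\<close>

lemma conv_prob_and_funs:
  assumes "p \<in> K" "q \<in> K"
  shows conv_prob: "conv p q \<in> prob_measures_on K"
    and circ_fun_conv: "g \<in> carrier G \<Longrightarrow> circ_fun (conv p q) g =
      circ_value g p * circ_value g q + induced_function G H (\<lambda>h. bullet_value h p * bullet_value h q) g"
    and bullet_fun_conv: "h \<in> H \<Longrightarrow> bullet_fun (conv p q) h =
      circ_value h p * bullet_value h q + bullet_value h p * circ_value h q"
proof -
  note R = irr_char_rep and HR = H.irr_char_rep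
  have ind0: "induced_function G H (\<lambda>_. 0) g = 0" for g by (simp add: induced_function_def)
  have "conv p q \<in> prob_measures_on K \<and>
    (\<forall>g\<in>carrier G. circ_fun (conv p q) g =
      circ_value g p * circ_value g q + induced_function G H (\<lambda>h. bullet_value h p * bullet_value h q) g) \<and>
    (\<forall>h\<in>H. bullet_fun (conv p q) h = circ_value h p * bullet_value h q + bullet_value h p * circ_value h q)"
    using assms(1)
  proof (cases rule: K_cases)
    case (circ x)
    note x = R[OF circ(2)] and chx = rep_of_char(2)[OF circ(2)]
    note xH = restricted_rep[OF subgroup_H x(1)]
    show ?thesis using assms(2)
    proof (cases rule: K_cases)
      case (circ y)
      note y = R[OF circ(2)] and chy = rep_of_char(2)[OF circ(2)]
      note T = tensor_rep_is_rep[OF x(1) y(1)]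
      show ?thesis
        using circ_measure_prob[OF T] circ_measure_funs[OF T] ch_tensor_rep[OF x(1) y(1)] x y chx chy
        by (simp add: \<open>p = Inl x\<close> \<open>q = Inl y\<close> circ_value_def bullet_value_def ind0)
    next
      case (bullet t)
      note t = HR[OF bullet(2)] and cht = rep_of_char(2)[OF bullet(2)]
      note T = H.tensor_rep_is_rep[OF xH t(1)]
      show ?thesis
        using bullet_measure_prob[OF T] bullet_measure_funs[OF T] H.ch_tensor_rep[OF xH t(1)] x t chx cht
          ch_restricted[OF _ H_subset]
        by (simp add: \<open>p = Inl x\<close> \<open>q = Inr t\<close> circ_value_def bullet_value_def ind0)
    qed
  next
    case (bullet s)
    note s = HR[OF bullet(2)] and chs = rep_of_char(2)[OF bullet(2)]
    show ?thesis using assms(2)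
    proof (cases rule: K_cases)
      case (circ y)
      note y = R[OF circ(2)] and chy = rep_of_char(2)[OF circ(2)]
      note yH = restricted_rep[OF subgroup_H y(1)]
      note T = H.tensor_rep_is_rep[OF s(1) yH]
      show ?thesis
        using bullet_measure_prob[OF T] bullet_measure_funs[OF T] H.ch_tensor_rep[OF s(1) yH] s y chs chy
          ch_restricted[OF _ H_subset]
        by (simp add: \<open>p = Inr s\<close> \<open>q = Inl y\<close> circ_value_def bullet_value_def ind0)
    next
      case (bullet t)
      note t = HR[OF bullet(2)] and cht = rep_of_char(2)[OF bullet(2)]
      note T = H.tensor_rep_is_rep[OF s(1) t(1)]
      note I = ind_rep_is_rep[OF finite_carrier subgroup_H T]
      have "induced_function G H (ch G\<^sub>0 (tensor_rep (rep_of_char G\<^sub>0 s) (rep_of_char G\<^sub>0 t))) g =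
          induced_function G H (\<lambda>h. s h * t h) g" for g
        by (rule induced_function_cong) (use H.ch_tensor_rep[OF s(1) t(1)] chs cht in simp)
      then show ?thesis
        using circ_measure_prob[OF I] circ_measure_funs[OF I] ch_ind_rep[OF finite_carrier subgroup_H T]
          s t transversal_nonempty
        by (simp add: \<open>p = Inr s\<close> \<open>q = Inr t\<close> circ_value_def bullet_value_def fst_ind_rep)
    qed
  qed
  then show "conv p q \<in> prob_measures_on K"
    "g \<in> carrier G \<Longrightarrow> circ_fun (conv p q) g =
      circ_value g p * circ_value g q + induced_function G H (\<lambda>h. bullet_value h p * bullet_value h q) g"
    "h \<in> H \<Longrightarrow> bullet_fun (conv p q) h =
      circ_value h p * bullet_value h q + bullet_value h p * circ_value h q" by auto
qed

abbreviation "star \<equiv> bilinear_ext K conv"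

lemma star_measure: "star \<mu> \<nu> \<in> measures_on K"
  by (rule bilinear_ext_in_measures) (use conv_prob prob_measures_onD in blast)

lemma circ_fun_star:
  assumes g: "g \<in> carrier G"
  shows "circ_fun (star \<mu> \<nu>) g = circ_fun \<mu> g * circ_fun \<nu> g +
    induced_function G H (\<lambda>h. bullet_fun \<mu> h * bullet_fun \<nu> h) g"
proof -
  have ind: "induced_function G H (\<lambda>h. bullet_fun \<mu> h * bullet_fun \<nu> h) g =
      (\<Sum>p\<in>K. \<Sum>q\<in>K. of_real (\<mu> p) * of_real (\<nu> q) *
         induced_function G H (\<lambda>h. bullet_value h p * bullet_value h q) g)"
  proof -
    have "bullet_fun \<mu> h * bullet_fun \<nu> h =
        (\<Sum>r\<in>K \<times> K. (of_real (\<mu> (fst r)) * of_real (\<nu> (snd r))) * (bullet_value h (fst r) * bullet_value h (snd r)))" for h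
      by (simp add: bullet_fun_def integral_on_def sum_product sum.cartesian_product case_prod_beta mult_ac)
    then show ?thesis
      by (simp add: induced_function_sum[where I = "K \<times> K" and c = "\<lambda>r. of_real (\<mu> (fst r)) * of_real (\<nu> (snd r))"
            and F = "\<lambda>r h. bullet_value h (fst r) * bullet_value h (snd r)"] sum.cartesian_product case_prod_beta)
  qed
  have "circ_fun (star \<mu> \<nu>) g = (\<Sum>p\<in>K. \<Sum>q\<in>K. of_real (\<mu> p) * of_real (\<nu> q) * circ_fun (conv p q) g)"
    unfolding circ_fun_def by (rule integral_on_bilinear_ext)
  also have "\<dots> = (\<Sum>p\<in>K. \<Sum>q\<in>K. of_real (\<mu> p) * of_real (\<nu> q) *
      (circ_value g p * circ_value g q + induced_function G H (\<lambda>h. bullet_value h p * bullet_value h q) g))"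
    by (intro sum.cong refl) (simp add: circ_fun_conv g)
  also have "\<dots> = circ_fun \<mu> g * circ_fun \<nu> g + induced_function G H (\<lambda>h. bullet_fun \<mu> h * bullet_fun \<nu> h) g"
    unfolding ind by (simp add: circ_fun_def integral_on_def sum_product distrib_left sum.distrib mult_ac)
  finally show ?thesis .
qed

lemma bullet_fun_star:
  assumes h: "h \<in> H"
  shows "bullet_fun (star \<mu> \<nu>) h = circ_fun \<mu> h * bullet_fun \<nu> h + bullet_fun \<mu> h * circ_fun \<nu> h"
proof -
  have "bullet_fun (star \<mu> \<nu>) h = (\<Sum>p\<in>K. \<Sum>q\<in>K. of_real (\<mu> p) * of_real (\<nu> q) * bullet_fun (conv p q) h)"
    unfolding bullet_fun_def by (rule integral_on_bilinear_ext)
  also have "\<dots> = (\<Sum>p\<in>K. \<Sum>q\<in>K. of_real (\<mu> p) * of_real (\<nu> q) *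
      (circ_value h p * bullet_value h q + bullet_value h p * circ_value h q))"
    by (intro sum.cong refl) (simp add: bullet_fun_conv h)
  also have "\<dots> = circ_fun \<mu> h * bullet_fun \<nu> h + bullet_fun \<mu> h * circ_fun \<nu> h"
    by (simp add: circ_fun_def bullet_fun_def integral_on_def sum_product distrib_left sum.distrib mult_ac)
  finally show ?thesis .
qed

lemma circ_fun_class:
  "g \<in> carrier G \<Longrightarrow> s \<in> carrier G \<Longrightarrow> circ_fun \<mu> (inv s \<otimes> g \<otimes> s) = circ_fun \<mu> g"
  unfolding circ_fun_eq by (intro sum.cong refl) (simp add: irr_char_conjugate)

lemma bullet_fun_class:
  assumes "h \<in> H" "t \<in> H"
  shows "bullet_fun \<mu> (inv t \<otimes> h \<otimes> t) = bullet_fun \<mu> h"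
  unfolding bullet_fun_eq
proof (intro sum.cong refl)
  fix x assume "x \<in> irr_chars G\<^sub>0"
  then show "of_real (\<mu> (Inr x)) * x (inv t \<otimes> h \<otimes> t) = of_real (\<mu> (Inr x)) * x h"
    using H.irr_char_conjugate[of x h t] assms H_inv by simp
qed

text \<open>On \<open>G\<close> the projection formula moves all circle functions out of the induction, and the two sides
  contain the same terms. On \<open>H\<close> the only critical terms are those with three bullet functions; there
  both sides equal the product of these functions and the restriction of the induced constant \<open>1\<close>.\<close>

theorem star_assoc: "star (star \<mu> \<nu>) \<kappa> = star \<mu> (star \<nu> \<kappa>)"
proof (rule measure_eqI[OF star_measure star_measure])
  fix g assume g: "g \<in> carrier G"
  let ?I = "\<lambda>\<phi>. induced_function G H \<phi> g"
  have proj: "?I (\<lambda>h. circ_fun \<xi> h * \<phi> h) = circ_fun \<xi> g * ?I \<phi>" for \<xi> \<phi>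
    by (rule projection_formula) (simp add: circ_fun_class g)
  have l: "?I (\<lambda>h. bullet_fun (star \<mu> \<nu>) h * bullet_fun \<kappa> h) =
      circ_fun \<mu> g * ?I (\<lambda>h. bullet_fun \<nu> h * bullet_fun \<kappa> h) +
      circ_fun \<nu> g * ?I (\<lambda>h. bullet_fun \<mu> h * bullet_fun \<kappa> h)"
  proof -
    have "?I (\<lambda>h. bullet_fun (star \<mu> \<nu>) h * bullet_fun \<kappa> h) =
        ?I (\<lambda>h. circ_fun \<mu> h * (bullet_fun \<nu> h * bullet_fun \<kappa> h) + circ_fun \<nu> h * (bullet_fun \<mu> h * bullet_fun \<kappa> h))"
      by (rule induced_function_cong) (simp add: bullet_fun_star algebra_simps)
    then show ?thesis by (simp add: induced_function_add proj)
  qed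
  have r: "?I (\<lambda>h. bullet_fun \<mu> h * bullet_fun (star \<nu> \<kappa>) h) =
      circ_fun \<nu> g * ?I (\<lambda>h. bullet_fun \<mu> h * bullet_fun \<kappa> h) +
      circ_fun \<kappa> g * ?I (\<lambda>h. bullet_fun \<mu> h * bullet_fun \<nu> h)"
  proof -
    have "?I (\<lambda>h. bullet_fun \<mu> h * bullet_fun (star \<nu> \<kappa>) h) =
        ?I (\<lambda>h. circ_fun \<nu> h * (bullet_fun \<mu> h * bullet_fun \<kappa> h) + circ_fun \<kappa> h * (bullet_fun \<mu> h * bullet_fun \<nu> h))"
      by (rule induced_function_cong) (simp add: bullet_fun_star algebra_simps)
    then show ?thesis by (simp add: induced_function_add proj)
  qed
  show "circ_fun (star (star \<mu> \<nu>) \<kappa>) g = circ_fun (star \<mu> (star \<nu> \<kappa>)) g"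
    unfolding circ_fun_star[OF g] l r by (simp add: algebra_simps)
next
  fix h assume h: "h \<in> H"
  have hG: "h \<in> carrier G" using h by (rule H_carrier)
  have res: "induced_function G H (\<lambda>h. bullet_fun \<xi> h * bullet_fun \<zeta> h) h =
      bullet_fun \<xi> h * bullet_fun \<zeta> h * induced_function G H (\<lambda>_. 1) h" for \<xi> \<zeta>
    by (rule induced_function_restrict[OF _ h]) (simp add: bullet_fun_class)
  show "bullet_fun (star (star \<mu> \<nu>) \<kappa>) h = bullet_fun (star \<mu> (star \<nu> \<kappa>)) h"
    by (simp add: bullet_fun_star[OF h] circ_fun_star[OF hG] res algebra_simps)
qed

abbreviation "unit_point \<equiv> Inl (trivial_char G) :: 'a char_point"

lemma dirac_measure: "p \<in> K \<Longrightarrow> dirac p \<in> measures_on K"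
  by (auto simp: dirac_def measures_on_def)

lemma funs_dirac:
  "p \<in> K \<Longrightarrow> circ_fun (dirac p) g = circ_value g p" "p \<in> K \<Longrightarrow> bullet_fun (dirac p) h = bullet_value h p"
  by (simp_all add: circ_fun_def bullet_fun_def integral_on_dirac finite_K)

lemma unit_point:
  shows unit_point_mem: "unit_point \<in> K"
    and "p \<in> K \<Longrightarrow> conv unit_point p = dirac p" "p \<in> K \<Longrightarrow> conv p unit_point = dirac p"
proof -
  show e: "unit_point \<in> K" by (simp add: trivial_char_irr)
  have v: "circ_value g unit_point = 1" if "g \<in> carrier G" for g
    using that by (simp add: circ_value_def trivial_char_def)
  have w: "bullet_value h unit_point = 0" for h by (simp add: bullet_value_def)
  have ind0: "induced_function G H (\<lambda>_. 0) g = 0" for g by (simp add: induced_function_def)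
  show "conv unit_point p = dirac p" if p: "p \<in> K"
    by (rule measure_eqI[OF prob_measures_onD[OF conv_prob[OF e p]] dirac_measure[OF p]])
      (simp_all add: circ_fun_conv[OF e p] bullet_fun_conv[OF e p] funs_dirac[OF p] v w ind0 H_carrier)
  show "conv p unit_point = dirac p" if p: "p \<in> K"
    by (rule measure_eqI[OF prob_measures_onD[OF conv_prob[OF p e]] dirac_measure[OF p]])
      (simp_all add: circ_fun_conv[OF p e] bullet_fun_conv[OF p e] funs_dirac[OF p] v w ind0 H_carrier)
qed

definition dual_point :: "'a char_point \<Rightarrow> 'a char_point" where
  "dual_point = map_sum (dual_char G) (dual_char G\<^sub>0)"

lemma dual_point_mem: "p \<in> K \<Longrightarrow> dual_point p \<in> K"
  by (erule K_cases) (simp_all add: dual_point_def dual_char_irr H.dual_char_irr)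

lemma dual_point_involutive: "p \<in> K \<Longrightarrow> dual_point (dual_point p) = p"
  by (erule K_cases) (simp_all add: dual_point_def dual_char_involutive H.dual_char_involutive)

lemma value_dual_point:
  assumes "p \<in> K"
  shows "g \<in> carrier G \<Longrightarrow> circ_value g (dual_point p) = circ_value (inv g) p"
    and "h \<in> H \<Longrightarrow> bullet_value h (dual_point p) = bullet_value (inv h) p"
  using assms
  by (cases p; simp add: dual_point_def circ_value_def bullet_value_def dual_char_def H_inv)+

lemma funs_push_forward:
  shows "g \<in> carrier G \<Longrightarrow> circ_fun (push_forward K dual_point \<mu>) g = circ_fun \<mu> (inv g)"
    and "h \<in> H \<Longrightarrow> bullet_fun (push_forward K dual_point \<mu>) h = bullet_fun \<mu> (inv h)"
proof -
  have im: "dual_point ` K \<subseteq> K" using dual_point_mem by blast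
  show "circ_fun (push_forward K dual_point \<mu>) g = circ_fun \<mu> (inv g)" if "g \<in> carrier G"
    unfolding circ_fun_def integral_on_push_forward[OF finite_K im]
    by (simp add: integral_on_def value_dual_point that)
  show "bullet_fun (push_forward K dual_point \<mu>) h = bullet_fun \<mu> (inv h)" if "h \<in> H"
    unfolding bullet_fun_def integral_on_push_forward[OF finite_K im]
    by (simp add: integral_on_def value_dual_point that)
qed

lemma conv_dual_point:
  assumes p: "p \<in> K" and q: "q \<in> K"
  shows "conv (dual_point p) (dual_point q) = push_forward K dual_point (conv q p)"
proof (rule measure_eqI)
  note dp = dual_point_mem[OF p] and dq = dual_point_mem[OF q]
  show "conv (dual_point p) (dual_point q) \<in> measures_on K"
    by (rule prob_measures_onD[OF conv_prob[OF dp dq]])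
  show "push_forward K dual_point (conv q p) \<in> measures_on K"
    by (rule push_forward_in_measures) (use dual_point_mem in blast)
  fix g assume g: "g \<in> carrier G"
  have "induced_function G H (\<lambda>h. bullet_value h (dual_point p) * bullet_value h (dual_point q)) g =
      induced_function G H (\<lambda>h. bullet_value (inv h) q * bullet_value (inv h) p) g"
    by (rule induced_function_cong) (simp add: value_dual_point p q)
  also have "\<dots> = induced_function G H (\<lambda>h. bullet_value h q * bullet_value h p) (inv g)"
    by (rule induced_function_inverse[OF subgroup_H g])
  finally show "circ_fun (conv (dual_point p) (dual_point q)) g = circ_fun (push_forward K dual_point (conv q p)) g"
    using g by (simp add: circ_fun_conv[OF dp dq] circ_fun_conv[OF q p] funs_push_forward value_dual_point p q)
next
  note dp = dual_point_mem[OF p] and dq = dual_point_mem[OF q]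
  fix h assume h: "h \<in> H"
  then show "bullet_fun (conv (dual_point p) (dual_point q)) h = bullet_fun (push_forward K dual_point (conv q p)) h"
    by (simp add: bullet_fun_conv[OF dp dq] bullet_fun_conv[OF q p] funs_push_forward value_dual_point p q
        H_carrier H_inv_closed)
qed

text \<open>The mass at the unit is, up to a positive factor, the pairing with the trivial character of \<open>G\<close>,
  that is, the sum over \<open>G\<close>. Frobenius reciprocity turns the induced part into a sum over \<open>H\<close>.\<close>

lemma conv_at_unit:
  assumes p: "p \<in> K" and q: "q \<in> K"
  shows "conv p q unit_point = 0 \<longleftrightarrow>
    (\<Sum>g\<in>carrier G. circ_value g p * circ_value g q) + (\<Sum>h\<in>H. bullet_value h p * bullet_value h q) = 0"
proof -
  have N: "of_nat (card (carrier G)) \<noteq> (0 :: complex)" using finite_carrier one_closed by auto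
  have "class_inner G (circ_fun (conv p q)) (trivial_char G) =
      of_real (conv p q unit_point) / of_nat (char_degree G (trivial_char G)) ^ 2"
    by (rule irr_chars_coefficient[OF finite_carrier trivial_char_irr]) (rule circ_fun_eq)
  then have "conv p q unit_point = 0 \<longleftrightarrow> class_inner G (circ_fun (conv p q)) (trivial_char G) = 0"
    using char_degree_pos[OF trivial_char_irr] by simp
  also have "\<dots> \<longleftrightarrow> (\<Sum>g\<in>carrier G. circ_fun (conv p q) g) = 0"
    using N by (simp add: class_inner_def trivial_char_def)
  also have "(\<Sum>g\<in>carrier G. circ_fun (conv p q) g) = (\<Sum>g\<in>carrier G. circ_value g p * circ_value g q) +
      (\<Sum>g\<in>carrier G. induced_function G H (\<lambda>h. bullet_value h p * bullet_value h q) g)"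
    by (simp add: circ_fun_conv[OF p q] sum.distrib)
  finally show ?thesis by (simp add: sum_induced_function[OF finite_carrier subgroup_H])
qed

lemma unit_in_supp_iff:
  assumes p: "p \<in> K" and q: "q \<in> K"
  shows "unit_point \<in> supp (conv p q) \<longleftrightarrow> p = dual_point q"
proof -
  have "(\<Sum>g\<in>carrier G. circ_value g p * circ_value g q) + (\<Sum>h\<in>H. bullet_value h p * bullet_value h q) \<noteq> 0
      \<longleftrightarrow> p = dual_point q"
    using p
  proof (cases rule: K_cases)
    case (circ x)
    note x = this
    show ?thesis using q
    proof (cases rule: K_cases)
      case (circ y)
      have "(\<Sum>g\<in>carrier G. x g * y g) = of_nat (card (carrier G)) * class_inner G x (dual_char G y)"
        using finite_carrier one_closed by (auto simp: class_inner_def dual_char_def)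
      then show ?thesis
        using x circ irr_chars_orthogonal[OF x(2) dual_char_irr[OF circ(2)] finite_carrier]
          char_degree_pos[OF dual_char_irr[OF circ(2)]] finite_carrier one_closed
        by (auto simp: circ_value_def bullet_value_def dual_point_def)
    next
      case (bullet t)
      then show ?thesis using x by (simp add: circ_value_def bullet_value_def dual_point_def)
    qed
  next
    case (bullet s)
    note s = this
    show ?thesis using q
    proof (cases rule: K_cases)
      case (circ y)
      then show ?thesis using s by (simp add: circ_value_def bullet_value_def dual_point_def)
    next
      case (bullet t)
      have card: "card H \<noteq> 0" using finite_H subgroup.one_closed[OF subgroup_H] by auto
      then have "(\<Sum>h\<in>H. s h * t h) = of_nat (card H) * class_inner G\<^sub>0 s (dual_char G\<^sub>0 t)"
        by (simp add: class_inner_def dual_char_def H_inv H_inv_closed H_carrier)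
      then show ?thesis
        using s bullet H.irr_chars_orthogonal[OF s(2) H.dual_char_irr[OF bullet(2)] finite_H]
          char_degree_pos[OF H.dual_char_irr[OF bullet(2)]] card
        by (auto simp: circ_value_def bullet_value_def dual_point_def)
    qed
  qed
  then show ?thesis using conv_at_unit[OF p q] by (simp add: supp_def)
qed

theorem char_set_hypergroup: "finite_hypergroup K conv"
  unfolding finite_hypergroup_def
proof (intro conjI ballI)
  show "\<exists>e\<in>K. (\<forall>x\<in>K. conv e x = dirac x \<and> conv x e = dirac x) \<and>
      (\<exists>invol. (\<forall>x\<in>K. invol x \<in> K \<and> invol (invol x) = x) \<and>
        (\<forall>x\<in>K. \<forall>y\<in>K. conv (invol x) (invol y) = push_forward K invol (conv y x) \<and>
          (e \<in> supp (conv x y) \<longleftrightarrow> x = invol y)))"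
    using unit_point dual_point_mem dual_point_involutive conv_dual_point unit_in_supp_iff
    by (intro bexI[of _ unit_point] conjI exI[of _ dual_point] ballI) auto
qed (auto simp: finite_K conv_prob star_assoc)

end

section \<open>Conjugacy in symmetric groups\<close>

text \<open>The conjugating permutation \<open>s\<close> maps the points moved by \<open>k\<close> onto the points moved by \<open>h\<close>, and both
  sets are contained in \<open>N\<close>. Keep \<open>s\<close> on the moved points and continue it by any bijection between
  the fixed points of \<open>k\<close> and of \<open>h\<close> in \<open>N\<close>, which are equal in number.\<close>

lemma conjugate_within_subset:
  assumes "finite N" and h: "h permutes N" and k: "k permutes N" and s: "bij s" and hs: "h \<circ> s = s \<circ> k"
  obtains t where "t permutes N" "h \<circ> t = t \<circ> k"
proof -
  define A where "A = {x. k x \<noteq> x}"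
  define B where "B = {x. h x \<noteq> x}"
  have AN: "A \<subseteq> N" and BN: "B \<subseteq> N"
    using k h by (auto simp: A_def B_def permutes_def)
  have hs': "h (s x) = s (k x)" for x using hs by (metis comp_apply)
  have inj: "inj s" using s by (rule bij_is_inj)
  have "x \<in> A \<longleftrightarrow> s x \<in> B" for x
    using inj_eq[OF inj] by (auto simp: A_def B_def hs')
  then have sA: "bij_betw s A B"
    using s unfolding bij_betw_def bij_def by (auto simp: inj_on_def) (metis image_eqI surjD)
  have "card (N - A) = card (N - B)"
    using bij_betw_same_card[OF sA] AN BN \<open>finite N\<close> by (metis card_Diff_subset finite_subset)
  then obtain b where b: "bij_betw b (N - A) (N - B)"
    using \<open>finite N\<close> by (metis finite_Diff finite_same_card_bij)
  define t where "t x = (if x \<in> A then s x else if x \<in> N then b x else x)" for x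
  have "bij_betw t A B" using sA by (subst bij_betw_cong[where g = s]) (auto simp: t_def)
  moreover have "bij_betw t (N - A) (N - B)" using b by (subst bij_betw_cong[where g = b]) (auto simp: t_def)
  ultimately have "bij_betw t (A \<union> (N - A)) (B \<union> (N - B))" by (rule bij_betw_combine) auto
  moreover have "A \<union> (N - A) = N" "B \<union> (N - B) = N" using AN BN by auto
  ultimately have "bij_betw t N N" by simp
  then have t: "t permutes N" by (rule bij_imp_permutes) (use AN in \<open>auto simp: t_def\<close>)
  have "h (t x) = t (k x)" for x
  proof (cases "x \<in> A")
    case True
    then have "k x \<in> A" using permutes_inj[OF k] by (auto simp: A_def inj_eq)
    then show ?thesis using True by (simp add: t_def hs')
  next
    case False
    then have "k x = x" by (simp add: A_def)
    moreover have "t x \<notin> B"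
    proof (cases "x \<in> N")
      case True
      then show ?thesis using False b by (auto simp: t_def bij_betw_def)
    next
      case False
      then show ?thesis using AN BN by (auto simp: t_def)
    qed
    ultimately show ?thesis by (simp add: B_def)
  qed
  then have "h \<circ> t = t \<circ> k" by (simp add: fun_eq_iff)
  with t show ?thesis by (rule that)
qed

lemma sym_group_ops:
  "x \<otimes>\<^bsub>sym_group m\<^esub> y = x \<circ> y" "\<one>\<^bsub>sym_group m\<^esub> = id"
  by (simp_all add: sym_group_def)

lemma inv_conj_eq_iff:
  assumes "group G" "s \<in> carrier G" "h \<in> carrier G" "k \<in> carrier G"
  shows "inv\<^bsub>G\<^esub> s \<otimes>\<^bsub>G\<^esub> h \<otimes>\<^bsub>G\<^esub> s = k \<longleftrightarrow> h \<otimes>\<^bsub>G\<^esub> s = s \<otimes>\<^bsub>G\<^esub> k"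
proof -
  interpret group G by fact
  show ?thesis using assms(2-4) by (metis inv_solve_left m_assoc inv_closed m_closed)
qed

lemma sym_group_fusion:
  assumes "n \<le> m" and h: "h \<in> carrier (sym_group n)" and s: "s \<in> carrier (sym_group m)"
    and k: "inv\<^bsub>sym_group m\<^esub> s \<otimes>\<^bsub>sym_group m\<^esub> h \<otimes>\<^bsub>sym_group m\<^esub> s \<in> carrier (sym_group n)"
  shows "\<exists>t\<in>carrier (sym_group n). inv\<^bsub>sym_group m\<^esub> s \<otimes>\<^bsub>sym_group m\<^esub> h \<otimes>\<^bsub>sym_group m\<^esub> s =
    inv\<^bsub>sym_group m\<^esub> t \<otimes>\<^bsub>sym_group m\<^esub> h \<otimes>\<^bsub>sym_group m\<^esub> t"
proof -
  let ?k = "inv\<^bsub>sym_group m\<^esub> s \<otimes>\<^bsub>sym_group m\<^esub> h \<otimes>\<^bsub>sym_group m\<^esub> s"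
  note grp = sym_group_is_group[of m]
  have sub: "x \<in> carrier (sym_group m)" if "x \<in> carrier (sym_group n)" for x
    using subgroup.mem_carrier[OF subgroup_sym_group(1)[OF assms(1)] that] .
  have "h \<circ> s = s \<circ> ?k"
    using inv_conj_eq_iff[OF grp s sub[OF h] sub[OF k]] by (simp add: sym_group_ops)
  moreover have "bij s" using s by (simp add: sym_group_carrier permutes_bij)
  moreover have "h permutes {1..n}" "?k permutes {1..n}" using h k by (simp_all only: sym_group_carrier)
  ultimately obtain t where t: "t permutes {1..n}" "h \<circ> t = t \<circ> ?k"
    using conjugate_within_subset[of "{1..n}" h ?k s] by blast
  have tc: "t \<in> carrier (sym_group n)" using t(1) by (simp only: sym_group_carrier)
  have "inv\<^bsub>sym_group m\<^esub> t \<otimes>\<^bsub>sym_group m\<^esub> h \<otimes>\<^bsub>sym_group m\<^esub> t = ?k"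
    using inv_conj_eq_iff[OF grp sub[OF tc] sub[OF h] sub[OF k]] t(2) by (simp add: sym_group_ops)
  then show ?thesis using tc by metis
qed

lemma finite_sym_group: "finite (carrier (sym_group m))"
  by (simp add: sym_group_def finite_permutations)

theorem corollary3p14:
  fixes m n :: nat
  assumes "m > n" and "n \<ge> 1"
  shows "finite_hypergroup
           (char_set (sym_group m) (carrier (sym_group n)))
           (char_conv (sym_group m) (carrier (sym_group n)))"
proof -
  have nm: "n \<le> m" using assms(1) by simp
  have "fusion_controlling_subgroup (sym_group m) (carrier (sym_group n))"
    by (intro fusion_controlling_subgroup.intro fusion_controlling_subgroup_axioms.intro
        sym_group_is_group finite_sym_group subgroup_sym_group(1)[OF nm] sym_group_fusion[OF nm])
  then show ?thesis by (rule fusion_controlling_subgroup.char_set_hypergroup)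
qed

end
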